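(* Let $a>0$, $1\le p\le 2$ and $q=\frac{p}{p-1}$ ($q=\infty$ if $p=1$). If $f\in A^p(S_a,\mathbf C^{(m)})$, then there is a function $g$, namely $g=\mathcal F(f)\in L^q(\mathbf R^m,\mathbf C^{(m)})$ (the Fourier transform of the restriction of $f$ to $\mathbf R^m=\{x_0=0\}$), such that $$f(x)=\frac{1}{(2\pi)^m}\int_{\mathbf R^m}e(x,\underline\xi)\,g(\underline\xi)\,d\underline\xi,\qquad x\in S_a,$$ and, with constants $C_p$ independent of $f$: for $1<p\le 2$, $$\Big(\frac12\int_{\mathbf R^m}\big(e^{pa|\underline\xi|}-e^{-pa|\underline\xi|}\big)^{\frac qp}\frac{|\chi_+(\underline\xi)g(\underline\xi)|^q+|\chi_-(\underline\xi)g(\underline\xi)|^q}{(p|\underline\xi|)^{\frac qp}}\,d\underline\xi\Big)^{\frac1q}\le C_p\|f\|_{A^p(S_a,\mathbf C^{(m)})};$$ and for $p=1$, $$\frac12\sup_{\underline\xi\in\mathbf R^m}\big(e^{a|\underline\xi|}-e^{-a|\underline\xi|}\big)\frac{|\chi_+(\underline\xi)g(\underline\xi)|+|\chi_-(\underline\xi)g(\underline\xi)|}{|\underline\xi|}\le C_1\|f\|_{A^1(S_a,\mathbf C^{(m)})}.$$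
   Context: $\mathbf C^{(m)}$ is the complex Clifford algebra generated by $\mathbf e_1,\dots,\mathbf e_m$ with $\mathbf e_j\mathbf e_k+\mathbf e_k\mathbf e_j=-2\delta_{jk}$, unit $\mathbf e_0=1$, norm $|\sum_T x_T\mathbf e_T|=(\sum_T|x_T|^2)^{1/2}$. Points of $\mathbf R^{m+1}$ are $x=x_0+\underline x$, $\underline x=\sum_{j=1}^m x_j\mathbf e_j$. $F$ is left-monogenic on an open set if $\sum_{k=0}^m\mathbf e_k\partial F/\partial x_k=0$ there. Fourier transform: $\mathcal F(f)(\underline\xi)=\int_{\mathbf R^m}e^{-i\langle\underline x,\underline\xi\rangle}f(\underline x)d\underline x$ (componentwise, extended as usual). For $\underline\xi\ne0$: $\chi_\pm(\underline\xi)=\frac12(1\pm i\underline\xi/|\underline\xi|)$, $e^\pm(x,\underline\xi)=e^{i\langle\underline x,\underline\xi\rangle}e^{\mp x_0|\underline\xi|}\chi_\pm(\underline\xi)$, $e=e^++e^-$. $S_a=\{x:|x_0|<a\}$, and $A^p(S_a,\mathbf C^{(m)})$ is the space of left-monogenic $f$ on $S_a$ with $\|f\|^p_{A^p(S_a,\mathbf C^{(m)})}=\int_{-a}^a\int_{\mathbf R^m}|f(x_0+\underline x)|^pd\underline x\,dx_0<\infty$. *)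

theory Defs
  imports "HOL-Analysis.Analysis"
begin

text \<open>The generators e_1..e_m are indexed by a finite linearly ordered type 'm
  (so m = CARD('m)).  An element of C^(m) is a family of complex coefficients
  x_T indexed by subsets T of the generators: x = sum_T x_T e_T, where
  e_T = e_{t1} ... e_{tk} for t1 < ... < tk and e_{} = e_0 = 1.\<close>

type_synonym 'm clif = "'m set \<Rightarrow> complex"

definition sym_diff :: "'a set \<Rightarrow> 'a set \<Rightarrow> 'a set" where
  "sym_diff S T = (S - T) \<union> (T - S)"

text \<open>e_S e_T = (-1)^(#{(s,t) in S x T. t < s} + #(S \<inter> T)) e_(S sym_diff T),
  from e_j e_k = - e_k e_j (j \<noteq> k) and e_j^2 = -1.\<close>
definition cl_sign :: "'m::{finite,linorder} set \<Rightarrow> 'm::{finite,linorder} set \<Rightarrow> complex" where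
  "cl_sign S T = (-1) ^ (card {(s, t). s \<in> S \<and> t \<in> T \<and> t < s} + card (S \<inter> T))"

definition cl_mult :: "'m::{finite,linorder} clif \<Rightarrow> 'm::{finite,linorder} clif \<Rightarrow> 'm::{finite,linorder} clif" where
  "cl_mult x y = (\<lambda>U. \<Sum>S\<in>UNIV. cl_sign S (sym_diff S U) * x S * y (sym_diff S U))"

definition cl_one :: "'m clif" where
  "cl_one = (\<lambda>T. if T = {} then 1 else 0)"

definition cl_e :: "'m \<Rightarrow> 'm clif" where
  "cl_e j = (\<lambda>T. if T = {j} then 1 else 0)"

definition cl_vec :: "real ^ 'm \<Rightarrow> 'm clif" where
  "cl_vec \<xi> = (\<lambda>T. \<Sum>j\<in>UNIV. complex_of_real (\<xi> $ j) * cl_e j T)"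

definition cl_norm :: "'m::finite clif \<Rightarrow> real" where
  "cl_norm x = sqrt (\<Sum>T\<in>UNIV. (cmod (x T))\<^sup>2)"

text \<open>A point x = x_0 + x_vec of R^(m+1) is represented as the pair (x_0, x_vec).\<close>

definition dir0 :: "real \<times> (real ^ 'm)" where
  "dir0 = (1, 0)"

definition dirj :: "'m \<Rightarrow> real \<times> (real ^ 'm)" where
  "dirj j = (0, axis j 1)"

definition cl_partial ::
  "(real \<times> (real ^ 'm) \<Rightarrow> 'm clif) \<Rightarrow> real \<times> (real ^ 'm) \<Rightarrow> real \<times> (real ^ 'm) \<Rightarrow> 'm clif" where
  "cl_partial F v x = (\<lambda>T. frechet_derivative (\<lambda>y. F y T) (at x) v)"

definition left_monogenic_on ::
  "(real \<times> (real ^ 'm::{finite,linorder})) set \<Rightarrow> (real \<times> (real ^ 'm::{finite,linorder}) \<Rightarrow> 'm::{finite,linorder} clif) \<Rightarrow> bool" where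
  "left_monogenic_on \<Omega> F \<longleftrightarrow>
     open \<Omega> \<and>
     (\<forall>T. \<forall>x\<in>\<Omega>. (\<lambda>y. F y T) differentiable (at x)) \<and>
     (\<forall>T. continuous_on \<Omega> (\<lambda>x. cl_partial F dir0 x T) \<and>
          (\<forall>j. continuous_on \<Omega> (\<lambda>x. cl_partial F (dirj j) x T))) \<and>
     (\<forall>x\<in>\<Omega>. \<forall>U. cl_partial F dir0 x U
                   + (\<Sum>j\<in>UNIV. cl_mult (cl_e j) (cl_partial F (dirj j) x) U) = 0)"

definition strip :: "real \<Rightarrow> (real \<times> (real ^ 'm)) set" where
  "strip a = {x. \<bar>fst x\<bar> < a}"

definition Ap_int :: "real \<Rightarrow> real \<Rightarrow> (real \<times> (real ^ 'm::finite) \<Rightarrow> 'm::finite clif) \<Rightarrow> ennreal" where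
  "Ap_int a p f = (\<integral>\<^sup>+ x \<in> strip a. ennreal (cl_norm (f x) powr p) \<partial>lborel)"

definition in_Ap :: "real \<Rightarrow> real \<Rightarrow> (real \<times> (real ^ 'm::{finite,linorder}) \<Rightarrow> 'm::{finite,linorder} clif) \<Rightarrow> bool" where
  "in_Ap a p f \<longleftrightarrow> left_monogenic_on (strip a) f \<and> Ap_int a p f < \<infinity>"

definition Ap_norm :: "real \<Rightarrow> real \<Rightarrow> (real \<times> (real ^ 'm::finite) \<Rightarrow> 'm::finite clif) \<Rightarrow> real" where
  "Ap_norm a p f = enn2real (Ap_int a p f) powr (1 / p)"

definition in_Lr :: "real \<Rightarrow> (real ^ 'm::finite \<Rightarrow> 'm::finite clif) \<Rightarrow> bool" where
  "in_Lr r g \<longleftrightarrow> (\<forall>T. (\<lambda>\<xi>. g \<xi> T) \<in> borel_measurable lborel) \<and>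
                  (\<integral>\<^sup>+ \<xi>. ennreal (cl_norm (g \<xi>) powr r) \<partial>lborel) < \<infinity>"

definition in_Linf :: "(real ^ 'm::finite \<Rightarrow> 'm::finite clif) \<Rightarrow> bool" where
  "in_Linf g \<longleftrightarrow> (\<forall>T. (\<lambda>\<xi>. g \<xi> T) \<in> borel_measurable lborel) \<and>
                 (\<exists>B. AE \<xi> in lborel. cl_norm (g \<xi>) \<le> B)"

definition fourier_int :: "(real ^ 'm \<Rightarrow> complex) \<Rightarrow> real ^ 'm \<Rightarrow> complex" where
  "fourier_int \<phi> \<xi> = (\<integral> x. exp (- \<i> * complex_of_real (x \<bullet> \<xi>)) * \<phi> x \<partial>lborel)"

text \<open>g is the (extended, componentwise) Fourier transform of h, characterised
  weakly by the multiplication formula  int g phi = int h (F phi)  for all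
  continuous compactly supported test functions phi (this determines g a.e.
  and agrees with the usual L^p extension for 1 <= p <= 2).\<close>
definition is_fourier :: "(real ^ 'm::finite \<Rightarrow> 'm::finite clif) \<Rightarrow> (real ^ 'm::finite \<Rightarrow> 'm::finite clif) \<Rightarrow> bool" where
  "is_fourier h g \<longleftrightarrow>
     (\<forall>\<phi> :: real ^ 'm \<Rightarrow> complex. continuous_on UNIV \<phi> \<longrightarrow> bounded {y. \<phi> y \<noteq> 0} \<longrightarrow>
        (\<forall>T. (\<integral> \<xi>. g \<xi> T * \<phi> \<xi> \<partial>lborel) = (\<integral> x. h x T * fourier_int \<phi> x \<partial>lborel)))"

text \<open>chi_s(xi) = 1/2 (1 + s i xi/|xi|) with s = 1 (chi_+) or s = -1 (chi_-).
  At xi = 0 the value is irrelevant (null set); by x/0 = 0 it is 1/2.\<close>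
definition chi :: "real \<Rightarrow> real ^ 'm \<Rightarrow> 'm clif" where
  "chi s \<xi> = (\<lambda>T. (1/2) * (cl_one T + complex_of_real s * \<i> * cl_vec \<xi> T / complex_of_real (norm \<xi>)))"

definition e_pm :: "real \<Rightarrow> real \<times> (real ^ 'm) \<Rightarrow> real ^ 'm \<Rightarrow> 'm clif" where
  "e_pm s x \<xi> = (\<lambda>T. exp (\<i> * complex_of_real (snd x \<bullet> \<xi>))
                    * complex_of_real (exp (- s * fst x * norm \<xi>)) * chi s \<xi> T)"

definition e_ker :: "real \<times> (real ^ 'm) \<Rightarrow> real ^ 'm \<Rightarrow> 'm clif" where
  "e_ker x \<xi> = (\<lambda>T. e_pm 1 x \<xi> T + e_pm (-1) x \<xi> T)"

end

theory Submission
  imports Defs "HOL-Probability.Probability" "HOL-Real_Asymp.Real_Asymp"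
begin

text \<open>
  Fourier transform in the space variables turns the equation \<open>\<partial>\<^sub>0 f = - \<Sum> e\<^sub>j \<partial>\<^sub>j f\<close> into the
  ordinary differential equation \<open>v' = - i \<xi> v\<close>. Left multiplication by \<open>i \<xi>\<close> has the eigenprojections
  \<open>\<chi>\<^sub>\<plusminus>\<close> with eigenvalues \<open>\<plusminus> |\<xi>|\<close>, so the transform \<open>v\<^sub>t\<close> of the slice at height \<open>t\<close> should satisfy
  \<open>\<chi>\<^sub>\<plusminus> v\<^sub>t = e\<^bsup>\<mp> t |\<xi>|\<^esup> \<chi>\<^sub>\<plusminus> g\<close>. No regularity theory is needed for this: multiplying the slices by a
  cutoff at scale \<open>R\<close> adds to the equation an error of size \<open>1/R\<close> in a weighted \<open>L\<^sup>1\<close> norm in \<open>\<xi>\<close>, which is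
  controlled by the \<open>L\<^sup>p\<close> norm of the slice by splitting it into an \<open>L\<^sup>1\<close> and an \<open>L\<^sup>2\<close> part. Letting
  \<open>R \<rightarrow> \<infinity>\<close> gives \<open>g\<close>. Almost every slice lies in \<open>L\<^sup>p\<close>; Gaussian summation inverts the transform there, and
  continuity in \<open>t\<close> extends the representation to the whole strip, in particular to \<open>t = 0\<close>.
  The Hausdorff--Young inequality on the slices bounds \<open>e\<^bsup>\<mp> t |\<xi>|\<^esup> \<chi>\<^sub>\<plusminus> g\<close> in \<open>L\<^sup>q\<close> by the \<open>L\<^sup>p\<close> norm at
  height \<open>t\<close>, and Jensen's inequality in \<open>t\<close> turns this into the weighted bound.
\<close>

subsection \<open>Gaussian integrals\<close>

text \<open>Only almost every slice is known to lie in L^p, and height 0 might be an exception, so g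
  is not built from f(0, .). It is built at one good height c and carried to 0 by factors e^(s c
  |\<xi>|). Going from c to 0 and on to t costs up to e^(a|\<xi>|) each time, whence the weights
  e^(-(2a+1)|\<xi>|) for the convergence and e^(-(a+1)|\<xi>|) for the error; the spare e^(-|\<xi>|)
  makes transforms of L^p functions integrable. Bounds uniform in R survive the limit by Fatou, and
  good heights near the boundary turn them into exponential decay of the two projections of g. The
  quotient (e^(pa|\<xi>|) - e^(-pa|\<xi>|))/(p|\<xi>|) is the integral of e^(-p s t |\<xi>|) over
  |t| < a. Jensen is applied to it with exponent q/p, which is at least 1 because p is at most 2,
  and with the slice norms as averaging weight, so that their powers recombine into the full norm.
  Test functions in \<open>is_fourier\<close> are merely continuous, so g is identified by an L^2
  pairing; square integrability comes from g in L^1 and in L^q.\<close>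

lemma Basis_vec_real: "(Basis :: (real ^ 'm::finite) set) = range (\<lambda>j. axis j 1)"
  by (auto simp: Basis_vec_def)

lemma inj_axis_one: "inj (\<lambda>j. axis j (1::real) :: real ^ 'm::finite)"
  by (auto simp: inj_def axis_eq_axis)

text \<open>Fubini for products of one-variable functions. \<open>lborel\<close> on vectors is the
  image of a product measure indexed by \<open>Basis\<close>, so the coordinates are relabelled
  along j -> \<open>axis j 1\<close>, with inverse \<open>ix\<close>.\<close>

lemma prod_components_lborel:
  fixes u :: "'m::finite \<Rightarrow> real \<Rightarrow> complex"
  assumes int: "\<And>j. integrable lborel (u j)"
  shows "integrable lborel (\<lambda>x :: real ^ 'm. \<Prod>j\<in>UNIV. u j (x $ j))"
    and "(\<integral>x. (\<Prod>j\<in>UNIV. u j ((x :: real ^ 'm) $ j)) \<partial>lborel) = (\<Prod>j\<in>UNIV. \<integral>x. u j x \<partial>lborel)"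
proof -
  let ?ax = "\<lambda>j::'m. axis j (1::real) :: real ^ 'm"
  interpret product_sigma_finite "\<lambda>_::real ^ 'm. lborel :: real measure"
    by standard
  have [measurable]: "u j \<in> borel_measurable borel" for j
    using int[of j] by (auto dest: borel_measurable_integrable)
  define ix where "ix = inv ?ax"
  have ix[simp]: "ix (axis j 1) = j" for j
    unfolding ix_def using inj_axis_one by (rule inv_f_f)
  have nth: "(\<Sum>b\<in>Basis. f b *\<^sub>R b) $ j = f (axis j 1)" for f :: "real ^ 'm \<Rightarrow> real" and j
  proof -
    have "(\<Sum>b\<in>Basis. f b *\<^sub>R b) $ j = (\<Sum>b\<in>Basis. f b *\<^sub>R b) \<bullet> axis j 1"
      by (simp add: inner_axis)
    also have "\<dots> = f (axis j 1)"
      by (subst inner_sum_left_Basis) (auto simp: Basis_vec_real)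
    finally show ?thesis .
  qed
  have pr: "(\<Prod>b\<in>Basis. u (ix b) (f b)) = (\<Prod>j\<in>UNIV. u j ((\<Sum>b\<in>Basis. f b *\<^sub>R b) $ j))"
    for f :: "real ^ 'm \<Rightarrow> real"
    unfolding nth unfolding Basis_vec_real by (subst prod.reindex[OF inj_axis_one]) simp
  have i1: "integrable (Pi\<^sub>M Basis (\<lambda>_. lborel)) (\<lambda>f. \<Prod>b\<in>Basis. u (ix b) (f b))"
    by (rule product_integrable_prod) (auto intro: int)
  have i2: "(\<integral>f. (\<Prod>b\<in>Basis. u (ix b) (f b)) \<partial>Pi\<^sub>M Basis (\<lambda>_. lborel))
     = (\<Prod>b\<in>Basis. \<integral>x. u (ix b) x \<partial>lborel)"
    by (rule product_integral_prod) (auto intro: int)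
  have eq: "(\<Prod>b\<in>Basis. \<integral>x. u (ix b) x \<partial>lborel) = (\<Prod>j\<in>UNIV. \<integral>x. u j x \<partial>lborel)"
    unfolding Basis_vec_real by (subst prod.reindex[OF inj_axis_one]) simp
  have m: "(\<lambda>x::real^'m. \<Prod>j\<in>UNIV. u j (x $ j)) \<in> borel_measurable borel"
    by measurable
  show "integrable lborel (\<lambda>x :: real ^ 'm. \<Prod>j\<in>UNIV. u j (x $ j))"
    by (subst lborel_eq, subst integrable_distr_eq) (use m i1 pr in auto)
  show "(\<integral>x. (\<Prod>j\<in>UNIV. u j ((x :: real ^ 'm) $ j)) \<partial>lborel) = (\<Prod>j\<in>UNIV. \<integral>x. u j x \<partial>lborel)"
    by (subst lborel_eq, subst integral_distr) (use m i2 pr eq in auto)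
qed

text \<open>A rescaling by s of the characteristic function of the standard normal distribution;
  \<open>F (0 + s * x)\<close> is the wanted integrand up to the factor 1/sqrt(2 pi).\<close>

lemma gauss_1d:
  fixes s t :: real assumes s: "s > 0"
  shows "integrable lborel (\<lambda>x. exp (- \<i> * of_real (x * t)) * complex_of_real (exp (- (s\<^sup>2 * x\<^sup>2) / 2)))" (is ?A)
    and "(\<integral>x. exp (- \<i> * of_real (x * t)) * complex_of_real (exp (- (s\<^sup>2 * x\<^sup>2) / 2)) \<partial>lborel)
       = of_real (sqrt (2 * pi) / s * exp (- t\<^sup>2 / (2 * s\<^sup>2)))" (is ?B)
proof -
  define F where "F = (\<lambda>x. std_normal_density x *\<^sub>R iexp (- t / s * x))"
  have iF: "integrable lborel F"
  proof -
    have "integrable lborel std_normal_density" by simp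
    then show ?thesis unfolding F_def
      by (rule Bochner_Integration.integrable_bound) (auto simp: norm_mult)
  qed
  have eF: "(\<integral>x. F x \<partial>lborel) = of_real (exp (- t\<^sup>2 / (2 * s\<^sup>2)))"
  proof -
    have "char std_normal_distribution (- t / s) = (\<integral>x. F x \<partial>lborel)"
      unfolding char_def F_def by (subst integral_density) auto
    then show ?thesis
      unfolding char_std_normal_distribution by (simp add: power_divide mult.commute)
  qed
  have Fs: "F (0 + s * x) = of_real (1 / sqrt (2 * pi)) *
     (exp (- \<i> * of_real (x * t)) * complex_of_real (exp (- (s\<^sup>2 * x\<^sup>2) / 2)))" for x
  proof -
    have 1: "- t / s * (0 + s * x) = - (x * t)" using s by (simp add: field_simps)
    have "F (0 + s * x) = std_normal_density (0 + s * x) *\<^sub>R iexp (- (x * t))"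
      unfolding F_def 1 ..
    then show ?thesis
      by (simp add: std_normal_density_def scaleR_conv_of_real power_mult_distrib mult_ac exp_minus)
  qed
  have unscale: ?A if "integrable lborel (\<lambda>x. F (0 + s * x))"
  proof -
    have "?A = integrable lborel (\<lambda>x. of_real (sqrt (2 * pi)) * F (0 + s * x))"
      unfolding Fs by (rule arg_cong[where f="integrable lborel"]) (auto simp: field_simps)
    then show ?thesis using that by auto
  qed
  have "integrable lborel (\<lambda>x. F (0 + s * x))"
    using iF s by (intro lborel_integrable_real_affine) auto
  then show ?A
    by (rule unscale)
  have "(\<integral>x. F x \<partial>lborel) = \<bar>s\<bar> *\<^sub>R (\<integral>x. F (0 + s * x) \<partial>lborel)"
    using s by (intro lborel_integral_real_affine) auto
  also have "\<dots> = \<bar>s\<bar> *\<^sub>R (of_real (1 / sqrt (2 * pi)) *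
     (\<integral>x. exp (- \<i> * of_real (x * t)) * complex_of_real (exp (- (s\<^sup>2 * x\<^sup>2) / 2)) \<partial>lborel))"
    unfolding Fs by simp
  finally show ?B
    unfolding eF using s by (simp add: scaleR_conv_of_real field_simps)
qed

text \<open>The density of the centred normal law with variance s^2 in every coordinate. It
  concentrates at 0 as s tends to 0 and serves as the summation kernel of Fourier inversion.\<close>

definition gauss_kernel :: "real \<Rightarrow> real ^ 'm \<Rightarrow> real" where
  "gauss_kernel s x = (1 / (sqrt (2 * pi) * s)) ^ CARD('m) * exp (- (norm x)\<^sup>2 / (2 * s\<^sup>2))"

lemma gauss_kernel_measurable [measurable]: "gauss_kernel s \<in> borel_measurable borel"
  unfolding gauss_kernel_def by measurable

lemma gauss_kernel_nonneg: "s > 0 \<Longrightarrow> gauss_kernel s x \<ge> 0"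
  by (simp add: gauss_kernel_def)

lemma norm_vec_square: "(norm (x :: real ^ 'm::finite))\<^sup>2 = (\<Sum>j\<in>UNIV. (x $ j)\<^sup>2)"
  by (simp add: norm_vec_def L2_set_def sum_nonneg)

text \<open>Both the character and the Gaussian are products over the coordinates, which reduces
  everything to \<open>gauss_1d\<close>.\<close>

lemma gauss_vec:
  fixes x :: "real ^ 'm::finite" assumes s: "s > 0"
  shows "integrable lborel (\<lambda>\<xi>::real^'m. exp (- \<i> * of_real (\<xi> \<bullet> x)) * complex_of_real (exp (- (s\<^sup>2 * (norm \<xi>)\<^sup>2) / 2)))" (is ?A)
    and "fourier_int (\<lambda>\<xi>. complex_of_real (exp (- (s\<^sup>2 * (norm \<xi>)\<^sup>2) / 2))) x
       = of_real ((2 * pi) ^ CARD('m) * gauss_kernel s x)" (is ?B)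
proof -
  define u where "u j y = exp (- \<i> * of_real (y * x $ j)) * complex_of_real (exp (- (s\<^sup>2 * y\<^sup>2) / 2))" for j y
  have 1: "exp (- \<i> * of_real (\<xi> \<bullet> x)) * complex_of_real (exp (- (s\<^sup>2 * (norm \<xi>)\<^sup>2) / 2)) = (\<Prod>j\<in>UNIV. u j (\<xi> $ j))"
    for \<xi> :: "real ^ 'm"
  proof -
    have a: "- \<i> * complex_of_real (\<xi> \<bullet> x) = (\<Sum>j\<in>UNIV. - \<i> * of_real (\<xi> $ j * x $ j))"
      by (simp add: inner_vec_def sum_distrib_left)
    have b: "complex_of_real (exp (- (s\<^sup>2 * (norm \<xi>)\<^sup>2) / 2)) = (\<Prod>j\<in>UNIV. complex_of_real (exp (- (s\<^sup>2 * (\<xi> $ j)\<^sup>2) / 2)))"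
    proof -
      have "- (s\<^sup>2 * (norm \<xi>)\<^sup>2) / 2 = (\<Sum>j\<in>UNIV. - (s\<^sup>2 * (\<xi> $ j)\<^sup>2) / 2)"
        by (simp add: norm_vec_square sum_distrib_left sum_negf sum_divide_distrib)
      then show ?thesis by (simp only: exp_sum[OF finite] of_real_prod)
    qed
    show ?thesis
      unfolding u_def prod.distrib a b exp_sum[OF finite] ..
  qed
  have iu: "integrable lborel (u j)" for j
    unfolding u_def by (rule gauss_1d(1)[OF s])
  show ?A unfolding 1 by (rule prod_components_lborel(1)[OF iu])
  have "fourier_int (\<lambda>\<xi>. complex_of_real (exp (- (s\<^sup>2 * (norm \<xi>)\<^sup>2) / 2))) x = (\<Prod>j\<in>UNIV. \<integral>y. u j y \<partial>lborel)"
    unfolding fourier_int_def 1 by (rule prod_components_lborel(2)[OF iu])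
  also have "\<dots> = (\<Prod>j\<in>UNIV. complex_of_real (sqrt (2 * pi) / s * exp (- (x $ j)\<^sup>2 / (2 * s\<^sup>2))))"
    unfolding u_def by (intro prod.cong refl gauss_1d(2)[OF s])
  also have "\<dots> = of_real ((sqrt (2 * pi) / s) ^ CARD('m) * exp (- (norm x)\<^sup>2 / (2 * s\<^sup>2)))"
  proof -
    have "- (norm x)\<^sup>2 / (2 * s\<^sup>2) = (\<Sum>j\<in>UNIV. - (x $ j)\<^sup>2 / (2 * s\<^sup>2))"
      by (simp add: norm_vec_square sum_negf sum_divide_distrib)
    then show ?thesis by (simp only: exp_sum[OF finite] of_real_mult prod.distrib of_real_prod prod_constant of_real_power)
  qed
  also have "\<dots> = of_real ((2 * pi) ^ CARD('m) * gauss_kernel s x)"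
  proof -
    have "sqrt (2 * pi) / s = (2 * pi) * (1 / (sqrt (2 * pi) * s))"
      using s real_sqrt_pow2[of "2 * pi"] by (simp add: field_simps power2_eq_square)
    then show ?thesis
      unfolding gauss_kernel_def by (simp only: power_mult_distrib mult_ac)
  qed
  finally show ?B .
qed

text \<open>This is \<open>gauss_vec\<close> at frequency 0 with s replaced by 1/s: the integrand
  there is the kernel without its normalising factor.\<close>

lemma gauss_kernel_integral:
  assumes s: "s > 0"
  shows "integrable lborel (gauss_kernel s :: real ^ 'm::finite \<Rightarrow> real)"
    and "(\<integral>x. gauss_kernel s (x :: real ^ 'm) \<partial>lborel) = 1"
proof -
  have s': "1 / s > 0" using s by simp
  have e: "exp (- \<i> * of_real (\<xi> \<bullet> 0)) * complex_of_real (exp (- ((1/s)\<^sup>2 * (norm \<xi>)\<^sup>2) / 2))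
     = complex_of_real (exp (- (norm \<xi>)\<^sup>2 / (2 * s\<^sup>2)))" for \<xi> :: "real ^ 'm"
    by (simp add: power_divide field_simps)
  have i: "integrable lborel (\<lambda>\<xi>::real^'m. exp (- (norm \<xi>)\<^sup>2 / (2 * s\<^sup>2)))"
    using gauss_vec(1)[OF s', of "0::real^'m"] unfolding e by (simp only: complex_of_real_integrable_eq)
  then show "integrable lborel (gauss_kernel s :: real ^ 'm::finite \<Rightarrow> real)"
    unfolding gauss_kernel_def[abs_def] by simp
  have "complex_of_real (\<integral>\<xi>. exp (- (norm (\<xi>::real^'m))\<^sup>2 / (2 * s\<^sup>2)) \<partial>lborel)
     = complex_of_real ((2 * pi) ^ CARD('m) * gauss_kernel (1/s) (0 :: real ^ 'm))"
    using gauss_vec(2)[OF s', of "0::real^'m"] unfolding fourier_int_def e by simp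
  then have "(\<integral>\<xi>. exp (- (norm (\<xi>::real^'m))\<^sup>2 / (2 * s\<^sup>2)) \<partial>lborel) = (2 * pi) ^ CARD('m) * gauss_kernel (1/s) (0 :: real ^ 'm)"
    by (simp only: of_real_eq_iff)
  then have "(\<integral>x. gauss_kernel s (x :: real ^ 'm) \<partial>lborel)
     = (1 / (sqrt (2 * pi) * s)) ^ CARD('m) * ((2 * pi) ^ CARD('m) * (1 / (sqrt (2 * pi) * (1 / s))) ^ CARD('m))"
    by (simp add: gauss_kernel_def)
  also have "\<dots> = ((1 / (sqrt (2 * pi) * s)) * ((2 * pi) * (1 / (sqrt (2 * pi) * (1 / s))))) ^ CARD('m)"
    by (simp only: power_mult_distrib)
  also have "(1 / (sqrt (2 * pi) * s)) * ((2 * pi) * (1 / (sqrt (2 * pi) * (1 / s)))) = 1"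
    using s by (simp add: field_simps flip: power2_eq_square)
  finally show "(\<integral>x. gauss_kernel s (x :: real ^ 'm) \<partial>lborel) = 1"
    by simp
qed

section \<open>Reflections and the Gaussian approximate identity\<close>

lemma lborel_reflect: "distr lborel borel (\<lambda>x. y - x) = (lborel :: 'a::euclidean_space measure)"
  using lborel_affine[of "-1" y] by (simp add: density_1 one_ennreal_def[symmetric])

lemma integral_reflect:
  fixes f :: "'a::euclidean_space \<Rightarrow> 'b::{banach,second_countable_topology}"
  assumes [measurable]: "f \<in> borel_measurable borel"
  shows "(\<integral>x. f (y - x) \<partial>lborel) = (\<integral>x. f x \<partial>lborel)"
  by (subst (2) lborel_reflect[symmetric, of y]) (simp add: integral_distr)

lemma integrable_reflect_iff:
  fixes f :: "'a::euclidean_space \<Rightarrow> 'b::{banach,second_countable_topology}"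
  assumes [measurable]: "f \<in> borel_measurable borel"
  shows "integrable lborel (\<lambda>x. f (y - x)) \<longleftrightarrow> integrable lborel f"
  by (subst (2) lborel_reflect[symmetric, of y]) (simp add: integrable_distr_eq)

text \<open>Near y continuity of u is used; far from y the bounded part M and the integrable part b
  of the majorant are treated separately. The mixed majorant covers both later uses: bounded test
  functions (b = 0) and L^p slices (M = 1, b = |u|^p).\<close>

lemma gauss_kernel_approx:
  fixes u :: "real ^ 'm::finite \<Rightarrow> complex" and b :: "real ^ 'm \<Rightarrow> real"
  assumes [measurable]: "u \<in> borel_measurable borel"
    and b: "integrable lborel b" "\<And>x. b x \<ge> 0" and M: "\<And>x. cmod (u x) \<le> M + b x"
    and cont: "isCont u y"
  shows "(\<lambda>k. \<integral>x. of_real (gauss_kernel (1 / real (Suc k)) (y - x)) * u x \<partial>lborel) \<longlonglongrightarrow> u y"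
proof (rule LIMSEQ_I)
  fix e :: real assume e: "e > 0"
  define s where "s k = 1 / real (Suc k)" for k
  have s: "s k > 0" for k by (simp add: s_def)
  have [measurable]: "b \<in> borel_measurable borel" using b(1) by auto
  obtain d where d: "d > 0" "\<And>x. dist x y < d \<Longrightarrow> dist (u x) (u y) < e / 3"
    using cont e unfolding continuous_at_eps_delta
    by (metis zero_less_divide_iff zero_less_numeral)
  have gi: "integrable lborel (\<lambda>x::real^'m. gauss_kernel (s k) (y - x))" for k
    by (subst integrable_reflect_iff) (auto intro: gauss_kernel_integral s)
  have g1: "(\<integral>x. gauss_kernel (s k) (y - x :: real^'m) \<partial>lborel) = 1" for k
    by (subst integral_reflect) (auto intro: gauss_kernel_integral s)
  have gi2: "integrable lborel (\<lambda>x::real^'m. gauss_kernel (sqrt 2 * s k) (y - x))" for k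
    by (subst integrable_reflect_iff) (auto intro!: gauss_kernel_integral mult_pos_pos s)
  have g12: "(\<integral>x. gauss_kernel (sqrt 2 * s k) (y - x :: real^'m) \<partial>lborel) = 1" for k
    by (subst integral_reflect) (auto intro!: gauss_kernel_integral mult_pos_pos s)
  \<comment> \<open>For |z| at least d, half of the exponent yields the small factor exp(-d^2/(4
    s^2)) and the other half is a Gaussian of width sqrt 2 s, whose normalisation costs sqrt 2 ^ m.
    This \<open>al\<close> handles the constant part of the majorant; \<open>be\<close> is a plain
    supremum bound for the kernel there and handles b.\<close>
  define al where "al k = sqrt 2 ^ CARD('m) * exp (- d\<^sup>2 / (4 * (s k)\<^sup>2))" for k
  define be where "be k = (1 / (sqrt (2 * pi) * s k)) ^ CARD('m) * exp (- d\<^sup>2 / (2 * (s k)\<^sup>2))" for k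
  have al: "gauss_kernel (s k) z \<le> al k * gauss_kernel (sqrt 2 * s k) z" if "norm z \<ge> d" for k and z :: "real ^ 'm"
  proof -
    have "- (norm z)\<^sup>2 / (2 * (s k)\<^sup>2) \<le> - d\<^sup>2 / (4 * (s k)\<^sup>2) + - (norm z)\<^sup>2 / (2 * (sqrt 2 * s k)\<^sup>2)"
      using power_mono[OF that, of 2] d s[of k] by (simp add: field_simps power_mult_distrib)
    then have "exp (- (norm z)\<^sup>2 / (2 * (s k)\<^sup>2)) \<le> exp (- d\<^sup>2 / (4 * (s k)\<^sup>2)) * exp (- (norm z)\<^sup>2 / (2 * (sqrt 2 * s k)\<^sup>2))"
      by (simp only: exp_add[symmetric] exp_le_cancel_iff)
    then have "gauss_kernel (s k) z \<le> (1 / (sqrt (2 * pi) * s k)) ^ CARD('m) * (exp (- d\<^sup>2 / (4 * (s k)\<^sup>2)) * exp (- (norm z)\<^sup>2 / (2 * (sqrt 2 * s k)\<^sup>2)))"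
      unfolding gauss_kernel_def using s[of k] by (intro mult_left_mono) auto
    also have "\<dots> = al k * gauss_kernel (sqrt 2 * s k) z"
      unfolding al_def gauss_kernel_def using s[of k]
      by (simp add: power_mult_distrib power_divide field_simps)
    finally show ?thesis .
  qed
  have be: "gauss_kernel (s k) z \<le> be k" if "norm z \<ge> d" for k and z :: "real ^ 'm"
    unfolding gauss_kernel_def be_def using power_mono[OF that, of 2] d s[of k]
    by (intro mult_left_mono) (auto simp: divide_right_mono)
  define C where "C = \<bar>M\<bar> + cmod (u y)"
  have bound: "cmod ((\<integral>x. of_real (gauss_kernel (s k) (y - x)) * u x \<partial>lborel) - u y)
     \<le> e / 3 + C * al k + be k * (\<integral>x. b x \<partial>lborel)" for k
  proof -
    have iu: "integrable lborel (\<lambda>x. complex_of_real (gauss_kernel (s k) (y - x)) * u x)"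
    proof (rule Bochner_Integration.integrable_bound)
      show "integrable lborel (\<lambda>x. \<bar>M\<bar> * gauss_kernel (s k) (y - x) + (1 / (sqrt (2 * pi) * s k)) ^ CARD('m) * b x)"
        using gi b by auto
      show "AE x in lborel. norm (complex_of_real (gauss_kernel (s k) (y - x)) * u x)
         \<le> norm (\<bar>M\<bar> * gauss_kernel (s k) (y - x) + (1 / (sqrt (2 * pi) * s k)) ^ CARD('m) * b x)"
      proof (intro always_eventually allI)
        fix x
        have "gauss_kernel (s k) (y - x) * cmod (u x) \<le> gauss_kernel (s k) (y - x) * (\<bar>M\<bar> + b x)"
          using M[of x] gauss_kernel_nonneg[OF s, of k "y-x"] by (intro mult_left_mono) auto
        also have "\<dots> \<le> \<bar>M\<bar> * gauss_kernel (s k) (y - x) + (1 / (sqrt (2 * pi) * s k)) ^ CARD('m) * b x"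
        proof -
          have "gauss_kernel (s k) (y - x) \<le> (1 / (sqrt (2 * pi) * s k)) ^ CARD('m) * 1"
            unfolding gauss_kernel_def using s[of k] by (intro mult_left_mono) auto
          from mult_right_mono[OF this b(2)[of x]] show ?thesis by (simp add: algebra_simps)
        qed
        finally show "norm (complex_of_real (gauss_kernel (s k) (y - x)) * u x)
         \<le> norm (\<bar>M\<bar> * gauss_kernel (s k) (y - x) + (1 / (sqrt (2 * pi) * s k)) ^ CARD('m) * b x)"
          using gauss_kernel_nonneg[OF s, of k "y-x"] by (simp add: norm_mult)
      qed
    qed measurable
    have "(\<integral>x. of_real (gauss_kernel (s k) (y - x)) * u x \<partial>lborel) - u y
       = (\<integral>x. of_real (gauss_kernel (s k) (y - x)) * u x \<partial>lborel) - (\<integral>x. of_real (gauss_kernel (s k) (y - x)) * u y \<partial>lborel)"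
      using g1[of k] gi[of k] by simp
    also have "\<dots> = (\<integral>x. of_real (gauss_kernel (s k) (y - x)) * (u x - u y) \<partial>lborel)"
      using iu gi by (subst Bochner_Integration.integral_diff[symmetric]) (auto simp: algebra_simps)
    also have "cmod \<dots> \<le> (\<integral>x. e / 3 * gauss_kernel (s k) (y - x) + (C * al k * gauss_kernel (sqrt 2 * s k) (y - x) + be k * b x) \<partial>lborel)"
    proof (rule Bochner_Integration.integral_norm_bound_integral)
      show "integrable lborel (\<lambda>x. complex_of_real (gauss_kernel (s k) (y - x)) * (u x - u y))"
        using iu gi by (simp add: right_diff_distrib)
      show "integrable lborel (\<lambda>x. e / 3 * gauss_kernel (s k) (y - x) + (C * al k * gauss_kernel (sqrt 2 * s k) (y - x) + be k * b x))"
        using gi gi2 b by auto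
      fix x
      have nn: "0 \<le> C * al k * gauss_kernel (sqrt 2 * s k) (y - x)" "0 \<le> be k * b x"
        using s[of k] b gauss_kernel_nonneg[of "sqrt 2 * s k" "y-x"] by (auto simp: C_def al_def be_def intro!: mult_nonneg_nonneg)
      have gn: "0 \<le> gauss_kernel (s k) (y - x)" using s by (rule gauss_kernel_nonneg)
      show "cmod (complex_of_real (gauss_kernel (s k) (y - x)) * (u x - u y))
        \<le> e / 3 * gauss_kernel (s k) (y - x) + (C * al k * gauss_kernel (sqrt 2 * s k) (y - x) + be k * b x)"
      proof (cases "norm (y - x) < d")
        case True
        then have "cmod (u x - u y) < e / 3" using d(2)[of x] by (simp add: dist_norm norm_minus_commute)
        then have "gauss_kernel (s k) (y - x) * cmod (u x - u y) \<le> gauss_kernel (s k) (y - x) * (e / 3)"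
          using gn by (intro mult_left_mono) auto
        moreover have "gauss_kernel (s k) (y - x) * (e / 3) = e / 3 * gauss_kernel (s k) (y - x)"
          by simp
        ultimately show ?thesis using gn nn by (simp only: norm_mult norm_of_real abs_of_nonneg)
      next
        case False
        have "cmod (u x - u y) \<le> C + b x"
          using norm_triangle_ineq4[of "u x" "u y"] M[of x] unfolding C_def by linarith
        then have "gauss_kernel (s k) (y - x) * cmod (u x - u y) \<le> gauss_kernel (s k) (y - x) * (C + b x)"
          using gn by (intro mult_left_mono) auto
        also have "\<dots> \<le> C * al k * gauss_kernel (sqrt 2 * s k) (y - x) + be k * b x"
          using mult_left_mono[OF al[of "y-x" k], of C] mult_right_mono[OF be[of "y-x" k], of "b x"] False b(2)[of x]
          by (simp add: C_def algebra_simps)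
        moreover have "0 \<le> e / 3 * gauss_kernel (s k) (y - x)" using gn e by simp
        ultimately show ?thesis using gn by (simp only: norm_mult norm_of_real abs_of_nonneg)
      qed
    qed
    also have "\<dots> = e / 3 + (C * al k + be k * (\<integral>x. b x \<partial>lborel))"
      using gi gi2 b g1 g12 by simp
    finally show ?thesis by simp
  qed
  \<comment> \<open>With s = 1/(k+1) both \<open>al\<close> and \<open>be\<close> have this form,
    with i = 0 and i = m respectively.\<close>
  have pe: "(\<lambda>k. real (Suc k) ^ i * exp (- c * (real (Suc k))\<^sup>2)) \<longlonglongrightarrow> 0" if "c > 0" for i c
  proof (rule tendsto_sandwich[OF _ _ tendsto_const])
    have "filterlim (\<lambda>k. c * real (Suc k)) at_top sequentially"
      using that by real_asymp
    from tendsto_mult_left[OF filterlim_compose[OF tendsto_power_div_exp_0 this], of "1 / c ^ i"]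
    show "(\<lambda>k. 1 / c ^ i * ((c * real (Suc k)) ^ i / exp (c * real (Suc k)))) \<longlonglongrightarrow> 0"
      by simp
    show "\<forall>\<^sub>F k in sequentially. 0 \<le> real (Suc k) ^ i * exp (- c * (real (Suc k))\<^sup>2)"
      by simp
    show "\<forall>\<^sub>F k in sequentially. real (Suc k) ^ i * exp (- c * (real (Suc k))\<^sup>2)
       \<le> 1 / c ^ i * ((c * real (Suc k)) ^ i / exp (c * real (Suc k)))"
    proof (intro always_eventually allI)
      fix k
      have "c * real (Suc k) \<le> c * (real (Suc k))\<^sup>2"
        using that by (intro mult_left_mono) (auto simp: power2_eq_square)
      then have "real (Suc k) ^ i * exp (- c * (real (Suc k))\<^sup>2) \<le> real (Suc k) ^ i * exp (- (c * real (Suc k)))"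
        by (intro mult_left_mono) auto
      also have "\<dots> = 1 / c ^ i * ((c * real (Suc k)) ^ i / exp (c * real (Suc k)))"
        using that by (simp only: exp_minus power_mult_distrib) (simp add: field_simps)
      finally show "real (Suc k) ^ i * exp (- c * (real (Suc k))\<^sup>2)
       \<le> 1 / c ^ i * ((c * real (Suc k)) ^ i / exp (c * real (Suc k)))" .
    qed
  qed
  have d4: "d\<^sup>2 / 4 > 0" and d2: "d\<^sup>2 / 2 > 0" using d(1) by auto
  have "al = (\<lambda>k. sqrt 2 ^ CARD('m) * (real (Suc k) ^ 0 * exp (- (d\<^sup>2 / 4) * (real (Suc k))\<^sup>2)))"
    unfolding al_def s_def by (rule ext) (simp add: power_divide)
  then have "al \<longlonglongrightarrow> sqrt 2 ^ CARD('m) * 0"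
    by (simp only: tendsto_mult_left[OF pe[OF d4]])
  moreover have "be = (\<lambda>k. (1 / sqrt (2 * pi)) ^ CARD('m) * (real (Suc k) ^ CARD('m) * exp (- (d\<^sup>2 / 2) * (real (Suc k))\<^sup>2)))"
  proof
    fix k
    have "1 / (sqrt (2 * pi) * (1 / real (Suc k))) = 1 / sqrt (2 * pi) * real (Suc k)"
      by simp
    moreover have "- d\<^sup>2 / (2 * (1 / real (Suc k))\<^sup>2) = - (d\<^sup>2 / 2) * (real (Suc k))\<^sup>2"
      by (simp add: power_divide)
    ultimately show "be k = (1 / sqrt (2 * pi)) ^ CARD('m) * (real (Suc k) ^ CARD('m) * exp (- (d\<^sup>2 / 2) * (real (Suc k))\<^sup>2))"
      unfolding be_def s_def by (simp only: power_mult_distrib mult.assoc)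
  qed
  then have "be \<longlonglongrightarrow> (1 / sqrt (2 * pi)) ^ CARD('m) * 0"
    by (simp only: tendsto_mult_left[OF pe[OF d2]])
  ultimately have "(\<lambda>k. C * al k + be k * (\<integral>x. b x \<partial>lborel)) \<longlonglongrightarrow> C * 0 + 0 * (\<integral>x. b x \<partial>lborel)"
    by (intro tendsto_intros) simp_all
  then have "eventually (\<lambda>k. C * al k + be k * (\<integral>x. b x \<partial>lborel) < e / 3) sequentially"
    using e by (intro order_tendstoD(2)) auto
  then obtain K where K: "\<And>k. k \<ge> K \<Longrightarrow> C * al k + be k * (\<integral>x. b x \<partial>lborel) < e / 3"
    unfolding eventually_sequentially by blast
  show "\<exists>no. \<forall>k\<ge>no. norm ((\<integral>x. of_real (gauss_kernel (1 / real (Suc k)) (y - x)) * u x \<partial>lborel) - u y) < e"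
  proof (intro exI allI impI)
    fix k assume "k \<ge> K"
    from bound[of k] K[OF this] e show "norm ((\<integral>x. of_real (gauss_kernel (1 / real (Suc k)) (y - x)) * u x \<partial>lborel) - u y) < e"
      unfolding s_def by linarith
  qed
qed

subsection \<open>Plancherel's inequality\<close>

lemma fourier_int_measurable [measurable]:
  assumes [measurable]: "\<phi> \<in> borel_measurable borel"
  shows "fourier_int \<phi> \<in> borel_measurable (borel :: (real ^ 'm::finite) measure)"
  unfolding fourier_int_def[abs_def] by measurable

lemma norm_exp_imaginary [simp]: "cmod (exp (- (\<i> * complex_of_real t))) = 1" "cmod (exp (\<i> * complex_of_real t)) = 1"
  using norm_exp_i_times[of "- t"] by auto

lemma integrable_character_mult [intro]:
  fixes \<phi> :: "real ^ 'm::finite \<Rightarrow> complex"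
  assumes "integrable lborel \<phi>"
  shows "integrable lborel (\<lambda>x. exp (- \<i> * complex_of_real (x \<bullet> \<xi>)) * \<phi> x)"
    and "integrable lborel (\<lambda>x. exp (\<i> * complex_of_real (x \<bullet> \<xi>)) * \<phi> x)"
proof -
  have [measurable]: "\<phi> \<in> borel_measurable borel" using assms by auto
  show "integrable lborel (\<lambda>x. exp (- \<i> * complex_of_real (x \<bullet> \<xi>)) * \<phi> x)"
    by (rule Bochner_Integration.integrable_bound[OF assms]) (auto simp: norm_mult)
  show "integrable lborel (\<lambda>x. exp (\<i> * complex_of_real (x \<bullet> \<xi>)) * \<phi> x)"
    by (rule Bochner_Integration.integrable_bound[OF assms]) (auto simp: norm_mult)
qed

lemma fourier_int_bound:
  fixes \<phi> :: "real ^ 'm::finite \<Rightarrow> complex"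
  assumes "integrable lborel \<phi>"
  shows "cmod (fourier_int \<phi> \<xi>) \<le> (\<integral>x. cmod (\<phi> x) \<partial>lborel)"
  unfolding fourier_int_def
  by (rule Bochner_Integration.integral_norm_bound_integral) (use assms integrable_character_mult in \<open>auto simp: norm_mult\<close>)

lemma fourier_int_add:
  fixes \<phi> :: "real ^ 'm::finite \<Rightarrow> complex"
  assumes "integrable lborel \<phi>" "integrable lborel \<psi>"
  shows "fourier_int (\<lambda>x. \<phi> x + \<psi> x) \<xi> = fourier_int \<phi> \<xi> + fourier_int \<psi> \<xi>"
  unfolding fourier_int_def distrib_left using assms by (intro Bochner_Integration.integral_add integrable_character_mult)

lemma fourier_int_diff:
  fixes \<phi> :: "real ^ 'm::finite \<Rightarrow> complex"
  assumes "integrable lborel \<phi>" "integrable lborel \<psi>"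
  shows "fourier_int (\<lambda>x. \<phi> x - \<psi> x) \<xi> = fourier_int \<phi> \<xi> - fourier_int \<psi> \<xi>"
  unfolding fourier_int_def right_diff_distrib using assms by (intro Bochner_Integration.integral_diff integrable_character_mult)

lemma integrable_pair_mult:
  fixes u :: "'a::euclidean_space \<Rightarrow> complex" and v :: "'b::euclidean_space \<Rightarrow> complex"
  assumes u: "integrable lborel u" and v: "integrable lborel v"
    and [measurable]: "k \<in> borel_measurable (borel \<Otimes>\<^sub>M borel)" and k: "\<And>z. cmod (k z) \<le> B"
  shows "integrable (lborel \<Otimes>\<^sub>M lborel) (\<lambda>(x, y). k (x, y) * (u x * v y))"
proof -
  have [measurable]: "u \<in> borel_measurable borel" "v \<in> borel_measurable borel" using u v by auto
  have "B \<ge> 0" using k[of "undefined"] norm_ge_zero order_trans by blast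
  have "integrable (lborel \<Otimes>\<^sub>M lborel) (\<lambda>(x, y). u x * v y)"
  proof (rule lborel_pair.Fubini_integrable)
    show "(\<lambda>(x, y). u x * v y) \<in> borel_measurable (lborel \<Otimes>\<^sub>M lborel)" by measurable
    show "integrable lborel (\<lambda>x. LBINT y. norm (case (x, y) of (x, y) \<Rightarrow> u x * v y))"
      using u by (auto simp: norm_mult)
    show "AE x in lborel. integrable lborel (\<lambda>y. case (x, y) of (x, y) \<Rightarrow> u x * v y)"
      using v by auto
  qed
  then have "integrable (lborel \<Otimes>\<^sub>M lborel) (\<lambda>z. of_real B * (case z of (x, y) \<Rightarrow> u x * v y))"
    by (rule integrable_mult_right)
  then show ?thesis
  proof (rule Bochner_Integration.integrable_bound)
    show "AE z in lborel \<Otimes>\<^sub>M lborel. norm (case z of (x, y) \<Rightarrow> k (x, y) * (u x * v y))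
       \<le> norm (of_real B * (case z of (x, y) \<Rightarrow> u x * v y))"
      using k \<open>B \<ge> 0\<close> by (auto simp: norm_mult intro!: mult_right_mono always_eventually)
  qed measurable
qed

text \<open>Fubini for the bounded kernel exp(-i x . \<xi>), which is symmetric in its two
  arguments.\<close>

lemma fourier_int_multiplication:
  fixes u v :: "real ^ 'm::finite \<Rightarrow> complex"
  assumes u: "integrable lborel u" and v: "integrable lborel v"
  shows "(\<integral>\<xi>. fourier_int u \<xi> * v \<xi> \<partial>lborel) = (\<integral>x. u x * fourier_int v x \<partial>lborel)"
proof -
  have i: "integrable (lborel \<Otimes>\<^sub>M lborel) (\<lambda>(x, y). (\<lambda>(x, y). exp (- \<i> * complex_of_real (x \<bullet> y))) (x, y) * (u x * v y))"
    by (rule integrable_pair_mult[OF u v, where B=1]) auto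
  have "(\<integral>\<xi>. fourier_int u \<xi> * v \<xi> \<partial>lborel) = (\<integral>\<xi>. (\<integral>x. exp (- \<i> * complex_of_real (x \<bullet> \<xi>)) * (u x * v \<xi>) \<partial>lborel) \<partial>lborel)"
    unfolding fourier_int_def by (simp add: mult.assoc flip: integral_mult_left_zero)
  also have "\<dots> = (\<integral>x. (\<integral>\<xi>. exp (- \<i> * complex_of_real (x \<bullet> \<xi>)) * (u x * v \<xi>) \<partial>lborel) \<partial>lborel)"
    using lborel_pair.Fubini_integral[OF i] by simp
  also have "\<dots> = (\<integral>x. u x * fourier_int v x \<partial>lborel)"
    unfolding fourier_int_def by (simp add: mult_ac inner_commute flip: integral_mult_right_zero)
  finally show ?thesis .
qed

lemma fourier_int_reflect:
  fixes v :: "real ^ 'm::finite \<Rightarrow> complex"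
  assumes [measurable]: "v \<in> borel_measurable borel"
  shows "fourier_int (\<lambda>x. v (- x)) \<xi> = fourier_int v (- \<xi>)"
  using integral_reflect[of "\<lambda>x. exp (- \<i> * complex_of_real (x \<bullet> (- \<xi>))) * v x" 0]
  unfolding fourier_int_def by simp

text \<open>Parseval's identity with a Gaussian damping. The damping makes the second factor
  integrable, so the multiplication formula first moves the transform away from u and then, applied
  again, away from v onto a modulated Gaussian, whose transform is a translated kernel. It underlies
  both Plancherel's inequality and the pairing with test functions.\<close>

lemma fourier_int_gauss_bilinear:
  fixes u v :: "real ^ 'm::finite \<Rightarrow> complex"
  assumes u: "integrable lborel u" and v: "integrable lborel v" and s: "s > 0"
  shows "(\<integral>\<xi>. fourier_int u \<xi> * (fourier_int v (- \<xi>) * of_real (exp (- (s\<^sup>2 * (norm \<xi>)\<^sup>2) / 2))) \<partial>lborel)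
    = (2 * pi) ^ CARD('m) * (\<integral>x. u x * (\<integral>y. of_real (gauss_kernel s (x - y)) * v y \<partial>lborel) \<partial>lborel)"
proof -
  let ?G = "\<lambda>\<xi>::real^'m. complex_of_real (exp (- (s\<^sup>2 * (norm \<xi>)\<^sup>2) / 2))"
  have [measurable]: "u \<in> borel_measurable borel" "v \<in> borel_measurable borel" using u v by auto
  have G: "integrable lborel ?G"
    using gauss_vec(1)[OF s, of "0::real^'m"] by simp
  have w: "integrable lborel (\<lambda>\<xi>. fourier_int v (- \<xi>) * ?G \<xi>)"
  proof (rule Bochner_Integration.integrable_bound)
    show "integrable lborel (\<lambda>\<xi>. of_real (\<integral>x. cmod (v x) \<partial>lborel) * ?G \<xi>)" using G by auto
    show "AE \<xi> in lborel. norm (fourier_int v (- \<xi>) * ?G \<xi>) \<le> norm (of_real (\<integral>x. cmod (v x) \<partial>lborel) * ?G \<xi>)"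
      using fourier_int_bound[OF v] by (auto simp: norm_mult intro!: always_eventually)
  qed measurable
  have fw: "fourier_int (\<lambda>\<xi>. fourier_int v (- \<xi>) * ?G \<xi>) x
     = (2 * pi) ^ CARD('m) * (\<integral>y. of_real (gauss_kernel s (x - y)) * v y \<partial>lborel)" for x
  proof -
    have v': "integrable lborel (\<lambda>y. v (- y))"
      using integrable_reflect_iff[of v 0] v by simp
    have "fourier_int (\<lambda>\<xi>. fourier_int v (- \<xi>) * ?G \<xi>) x
       = (\<integral>\<xi>. fourier_int (\<lambda>y. v (- y)) \<xi> * (exp (- \<i> * complex_of_real (\<xi> \<bullet> x)) * ?G \<xi>) \<partial>lborel)"
      unfolding fourier_int_reflect[OF \<open>v \<in> borel_measurable borel\<close>] by (subst fourier_int_def) (simp add: mult_ac)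
    also have "\<dots> = (\<integral>y. v (- y) * fourier_int (\<lambda>\<xi>. exp (- \<i> * complex_of_real (\<xi> \<bullet> x)) * ?G \<xi>) y \<partial>lborel)"
      by (rule fourier_int_multiplication[OF v' gauss_vec(1)[OF s]])
    also have "\<dots> = (\<integral>y. v (- y) * of_real ((2 * pi) ^ CARD('m) * gauss_kernel s (x - (- y))) \<partial>lborel)"
    proof -
      have "fourier_int (\<lambda>\<xi>. exp (- \<i> * complex_of_real (\<xi> \<bullet> x)) * ?G \<xi>) y = fourier_int ?G (x + y)" for y
      proof -
        have "exp (- \<i> * complex_of_real (\<xi> \<bullet> (x + y))) = exp (- \<i> * complex_of_real (\<xi> \<bullet> y)) * exp (- \<i> * complex_of_real (\<xi> \<bullet> x))" for \<xi>
          unfolding exp_add[symmetric] by (simp add: inner_add_right algebra_simps)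
        then show ?thesis unfolding fourier_int_def by (simp only: mult.assoc)
      qed
      then show ?thesis unfolding gauss_vec(2)[OF s] by simp
    qed
    also have "\<dots> = (\<integral>y. v y * of_real ((2 * pi) ^ CARD('m) * gauss_kernel s (x - y)) \<partial>lborel)"
      using integral_reflect[of "\<lambda>y. v y * of_real ((2 * pi) ^ CARD('m) * gauss_kernel s (x - y))" 0] by simp
    also have "\<dots> = (2 * pi) ^ CARD('m) * (\<integral>y. of_real (gauss_kernel s (x - y)) * v y \<partial>lborel)"
      by (simp add: mult_ac flip: integral_mult_right_zero)
    finally show ?thesis .
  qed
  show ?thesis
    unfolding fourier_int_multiplication[OF u w] fw by (simp add: mult_ac flip: integral_mult_right_zero)
qed

text \<open>With v the conjugate of u, the damped identity has |F u|^2 times a Gaussian on its left.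
  On the right, 2|u(x)||u(y)| is at most |u(x)|^2 + |u(y)|^2, and the kernel has mass 1 in either
  variable. The resulting bound does not depend on s, so Fatou removes the Gaussian.\<close>

lemma plancherel_bound:
  fixes u :: "real ^ 'm::finite \<Rightarrow> complex"
  assumes u: "integrable lborel u"
  shows "(\<integral>\<^sup>+\<xi>. ennreal ((cmod (fourier_int u \<xi>))\<^sup>2) \<partial>lborel)
    \<le> ennreal ((2 * pi) ^ CARD('m)) * (\<integral>\<^sup>+x. ennreal ((cmod (u x))\<^sup>2) \<partial>lborel)"
proof (cases "(\<integral>\<^sup>+x. ennreal ((cmod (u x))\<^sup>2) \<partial>lborel) = \<infinity>")
  case True
  then show ?thesis by (simp add: ennreal_mult_top)
next
  case False
  have [measurable]: "u \<in> borel_measurable borel" using u by auto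
  have u2: "integrable lborel (\<lambda>x. (cmod (u x))\<^sup>2)"
    using False by (intro integrableI_bounded) (auto simp: top.not_eq_extremum)
  define J where "J = (\<integral>x. (cmod (u x))\<^sup>2 \<partial>lborel)"
  have J: "(\<integral>\<^sup>+x. ennreal ((cmod (u x))\<^sup>2) \<partial>lborel) = ennreal J"
    unfolding J_def by (rule nn_integral_eq_integral[OF u2]) auto
  define v where "v x = cnj (u x)" for x
  have v: "integrable lborel v" unfolding v_def using u by simp
  then have [measurable]: "v \<in> borel_measurable borel" by auto
  have fv: "fourier_int v (- \<xi>) = cnj (fourier_int u \<xi>)" for \<xi>
  proof -
    have "cnj (fourier_int u \<xi>) = (\<integral>x. cnj (exp (- \<i> * complex_of_real (x \<bullet> \<xi>)) * u x) \<partial>lborel)"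
      unfolding fourier_int_def by (rule Bochner_Integration.integral_cnj[symmetric])
    then show ?thesis unfolding fourier_int_def v_def by (simp add: exp_cnj)
  qed
  define G where "G s \<xi> = exp (- (s\<^sup>2 * (norm \<xi>)\<^sup>2) / 2)" for s and \<xi> :: "real ^ 'm"
  have [measurable]: "G s \<in> borel_measurable borel" for s unfolding G_def by measurable
  have G: "integrable lborel (G s)" if "s > 0" for s
  proof -
    have "integrable lborel (\<lambda>\<xi>. complex_of_real (G s \<xi>))"
      using gauss_vec(1)[OF that, of "0::real^'m"] unfolding G_def by simp
    then show ?thesis by (simp only: complex_of_real_integrable_eq)
  qed
  have main: "(\<integral>\<^sup>+\<xi>. ennreal ((cmod (fourier_int u \<xi>))\<^sup>2 * G s \<xi>) \<partial>lborel) \<le> ennreal ((2 * pi) ^ CARD('m) * J)" if s: "s > 0" for s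
  proof -
    define K where "K = (\<integral>x. cmod (u x) \<partial>lborel)"
    have i: "integrable lborel (\<lambda>\<xi>. (cmod (fourier_int u \<xi>))\<^sup>2 * G s \<xi>)"
    proof (rule Bochner_Integration.integrable_bound)
      show "integrable lborel (\<lambda>\<xi>. K\<^sup>2 * G s \<xi>)" using G[OF s] by auto
      show "AE \<xi> in lborel. norm ((cmod (fourier_int u \<xi>))\<^sup>2 * G s \<xi>) \<le> norm (K\<^sup>2 * G s \<xi>)"
        using fourier_int_bound[OF u] unfolding K_def[symmetric]
        by (auto intro!: always_eventually mult_right_mono power_mono simp: G_def)
    qed measurable
    have gi: "integrable lborel (\<lambda>y::real^'m. gauss_kernel s (x - y))" for x
      by (subst integrable_reflect_iff) (auto intro: gauss_kernel_integral s)
    have g1: "(\<integral>y. gauss_kernel s (x - y :: real^'m) \<partial>lborel) = 1" for x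
      by (subst integral_reflect) (auto intro: gauss_kernel_integral s)
    have gB: "gauss_kernel s z \<le> (1 / (sqrt (2 * pi) * s)) ^ CARD('m)" for z :: "real ^ 'm"
      unfolding gauss_kernel_def using s by (intro mult_left_le) auto
    have "complex_of_real (\<integral>\<xi>. (cmod (fourier_int u \<xi>))\<^sup>2 * G s \<xi> \<partial>lborel)
       = (\<integral>\<xi>. fourier_int u \<xi> * (fourier_int v (- \<xi>) * of_real (G s \<xi>)) \<partial>lborel)"
      unfolding fv by (subst integral_complex_of_real[symmetric]) (simp only: of_real_mult complex_norm_square mult.assoc)
    also have "\<dots> = (2 * pi) ^ CARD('m) * (\<integral>x. u x * (\<integral>y. of_real (gauss_kernel s (x - y)) * v y \<partial>lborel) \<partial>lborel)"
      unfolding G_def by (rule fourier_int_gauss_bilinear[OF u v s])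
    finally have eq: "complex_of_real (\<integral>\<xi>. (cmod (fourier_int u \<xi>))\<^sup>2 * G s \<xi> \<partial>lborel)
       = (2 * pi) ^ CARD('m) * (\<integral>x. u x * (\<integral>y. of_real (gauss_kernel s (x - y)) * v y \<partial>lborel) \<partial>lborel)" .
    have "ennreal (cmod (\<integral>x. u x * (\<integral>y. of_real (gauss_kernel s (x - y)) * v y \<partial>lborel) \<partial>lborel))
       \<le> (\<integral>\<^sup>+x. ennreal (cmod (u x * (\<integral>y. of_real (gauss_kernel s (x - y)) * v y \<partial>lborel))) \<partial>lborel)"
    \<comment> \<open>If the outer integrand were not integrable, its Bochner integral would be 0 by
      convention and the estimate would hold all the same.\<close>
    proof (cases "integrable lborel (\<lambda>x. u x * (\<integral>y. of_real (gauss_kernel s (x - y)) * v y \<partial>lborel))")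
      case True then show ?thesis by (rule integral_norm_bound_ennreal)
    qed (simp add: not_integrable_integral_eq)
    also have "\<dots> \<le> (\<integral>\<^sup>+x. (\<integral>\<^sup>+y. ennreal (gauss_kernel s (x - y) * ((cmod (u x))\<^sup>2 + (cmod (u y))\<^sup>2) / 2) \<partial>lborel) \<partial>lborel)"
    proof (rule nn_integral_mono)
      fix x
      have iy: "integrable lborel (\<lambda>y. complex_of_real (gauss_kernel s (x - y)) * v y)"
      proof (rule Bochner_Integration.integrable_bound)
        show "integrable lborel (\<lambda>y. (1 / (sqrt (2 * pi) * s)) ^ CARD('m) * cmod (v y))" using v by auto
        show "AE y in lborel. norm (complex_of_real (gauss_kernel s (x - y)) * v y) \<le> norm ((1 / (sqrt (2 * pi) * s)) ^ CARD('m) * cmod (v y))"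
          using gB s gauss_kernel_nonneg[OF s]
          by (auto intro!: always_eventually mult_right_mono simp: norm_mult abs_mult abs_of_nonneg[OF gauss_kernel_nonneg[OF s]])
      qed measurable
      have "ennreal (cmod (u x * (\<integral>y. of_real (gauss_kernel s (x - y)) * v y \<partial>lborel)))
         = ennreal (cmod (\<integral>y. u x * (of_real (gauss_kernel s (x - y)) * v y) \<partial>lborel))"
        by simp
      also have "\<dots> \<le> (\<integral>\<^sup>+y. ennreal (cmod (u x * (of_real (gauss_kernel s (x - y)) * v y))) \<partial>lborel)"
        using iy by (intro integral_norm_bound_ennreal) auto
      also have "\<dots> \<le> (\<integral>\<^sup>+y. ennreal (gauss_kernel s (x - y) * ((cmod (u x))\<^sup>2 + (cmod (u y))\<^sup>2) / 2) \<partial>lborel)"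
      proof (intro nn_integral_mono ennreal_leI)
        fix y
        have "2 * (cmod (u x) * cmod (u y)) \<le> (cmod (u x))\<^sup>2 + (cmod (u y))\<^sup>2"
          using sum_squares_bound[of "cmod (u x)" "cmod (u y)"] by simp
        then have "gauss_kernel s (x - y) * (cmod (u x) * cmod (u y)) \<le> gauss_kernel s (x - y) * (((cmod (u x))\<^sup>2 + (cmod (u y))\<^sup>2) / 2)"
          by (intro mult_left_mono gauss_kernel_nonneg s) auto
        then show "cmod (u x * (of_real (gauss_kernel s (x - y)) * v y)) \<le> gauss_kernel s (x - y) * ((cmod (u x))\<^sup>2 + (cmod (u y))\<^sup>2) / 2"
          using gauss_kernel_nonneg[OF s, of "x-y"] by (simp add: norm_mult v_def mult_ac)
      qed
      finally show "ennreal (cmod (u x * (\<integral>y. of_real (gauss_kernel s (x - y)) * v y \<partial>lborel)))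
        \<le> (\<integral>\<^sup>+y. ennreal (gauss_kernel s (x - y) * ((cmod (u x))\<^sup>2 + (cmod (u y))\<^sup>2) / 2) \<partial>lborel)" .
    qed
    also have "\<dots> = (\<integral>\<^sup>+x. (\<integral>\<^sup>+y. ennreal (gauss_kernel s (x - y) * (cmod (u x))\<^sup>2 / 2) + ennreal (gauss_kernel s (x - y) * (cmod (u y))\<^sup>2 / 2) \<partial>lborel) \<partial>lborel)"
      by (intro nn_integral_cong, subst ennreal_plus[symmetric])
        (auto simp: distrib_left add_divide_distrib gauss_kernel_nonneg[OF s])
    also have "\<dots> = (\<integral>\<^sup>+x. (\<integral>\<^sup>+y. ennreal (gauss_kernel s (x - y) * (cmod (u x))\<^sup>2 / 2) \<partial>lborel) \<partial>lborel)
       + (\<integral>\<^sup>+x. (\<integral>\<^sup>+y. ennreal (gauss_kernel s (x - y) * (cmod (u y))\<^sup>2 / 2) \<partial>lborel) \<partial>lborel)"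
    proof -
      have "(\<integral>\<^sup>+y. ennreal (gauss_kernel s (x - y) * (cmod (u x))\<^sup>2 / 2) + ennreal (gauss_kernel s (x - y) * (cmod (u y))\<^sup>2 / 2) \<partial>lborel)
        = (\<integral>\<^sup>+y. ennreal (gauss_kernel s (x - y) * (cmod (u x))\<^sup>2 / 2) \<partial>lborel) + (\<integral>\<^sup>+y. ennreal (gauss_kernel s (x - y) * (cmod (u y))\<^sup>2 / 2) \<partial>lborel)" for x
        by (rule nn_integral_add) measurable
      then show ?thesis
        by (simp only:) (rule nn_integral_add; measurable)
    qed
    also have "(\<integral>\<^sup>+x. (\<integral>\<^sup>+y. ennreal (gauss_kernel s (x - y) * (cmod (u y))\<^sup>2 / 2) \<partial>lborel) \<partial>lborel)
       = (\<integral>\<^sup>+x. (\<integral>\<^sup>+y. ennreal (gauss_kernel s (x - y) * (cmod (u x))\<^sup>2 / 2) \<partial>lborel) \<partial>lborel)"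
    proof -
      have sym: "gauss_kernel s (x - y) = gauss_kernel s (y - x)" for x y :: "real ^ 'm"
        unfolding gauss_kernel_def by (simp add: norm_minus_commute)
      have "(\<integral>\<^sup>+x. (\<integral>\<^sup>+y. ennreal (gauss_kernel s (x - y) * (cmod (u y))\<^sup>2 / 2) \<partial>lborel) \<partial>lborel)
        = (\<integral>\<^sup>+y. (\<integral>\<^sup>+x. ennreal (gauss_kernel s (x - y) * (cmod (u y))\<^sup>2 / 2) \<partial>lborel) \<partial>lborel)"
        by (rule lborel_pair.Fubini'[symmetric]) measurable
      then show ?thesis by (simp add: sym)
    qed
    also have "(\<integral>\<^sup>+x. (\<integral>\<^sup>+y. ennreal (gauss_kernel s (x - y) * (cmod (u x))\<^sup>2 / 2) \<partial>lborel) \<partial>lborel) = ennreal (J / 2)"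
    proof -
      have "(\<integral>\<^sup>+y. ennreal (gauss_kernel s (x - y) * (cmod (u x))\<^sup>2 / 2) \<partial>lborel) = ennreal ((cmod (u x))\<^sup>2 / 2)" for x
      proof -
        have "(\<integral>\<^sup>+y. ennreal (gauss_kernel s (x - y) * (cmod (u x))\<^sup>2 / 2) \<partial>lborel) = ennreal (\<integral>y. gauss_kernel s (x - y) * (cmod (u x))\<^sup>2 / 2 \<partial>lborel)"
          using gi by (intro nn_integral_eq_integral) (auto simp: gauss_kernel_nonneg[OF s])
        then show ?thesis using g1[of x] by simp
      qed
      moreover have "(\<integral>\<^sup>+x. ennreal ((cmod (u x))\<^sup>2 / 2) \<partial>lborel) = ennreal (\<integral>x. (cmod (u x))\<^sup>2 / 2 \<partial>lborel)"
        using u2 by (intro nn_integral_eq_integral) auto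
      ultimately show ?thesis unfolding J_def by simp
    qed
    also have "ennreal (J / 2) + ennreal (J / 2) = ennreal J"
      unfolding J_def by (subst ennreal_plus[symmetric]) auto
    finally have "cmod (\<integral>x. u x * (\<integral>y. of_real (gauss_kernel s (x - y)) * v y \<partial>lborel) \<partial>lborel) \<le> J"
      by (subst (asm) ennreal_le_iff) (auto simp: J_def)
    then have "(\<integral>\<xi>. (cmod (fourier_int u \<xi>))\<^sup>2 * G s \<xi> \<partial>lborel) \<le> (2 * pi) ^ CARD('m) * J"
    proof -
      have "(\<integral>\<xi>. (cmod (fourier_int u \<xi>))\<^sup>2 * G s \<xi> \<partial>lborel) \<le> cmod (complex_of_real (\<integral>\<xi>. (cmod (fourier_int u \<xi>))\<^sup>2 * G s \<xi> \<partial>lborel))"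
        by simp
      also have "\<dots> \<le> (2 * pi) ^ CARD('m) * J"
        unfolding eq norm_mult norm_power
        using \<open>cmod (\<integral>x. u x * (\<integral>y. of_real (gauss_kernel s (x - y)) * v y \<partial>lborel) \<partial>lborel) \<le> J\<close>
        by (intro mult_mono power_mono) (auto simp: norm_mult norm_power)
      finally show ?thesis .
    qed
    moreover have "(\<integral>\<^sup>+\<xi>. ennreal ((cmod (fourier_int u \<xi>))\<^sup>2 * G s \<xi>) \<partial>lborel) = ennreal (\<integral>\<xi>. (cmod (fourier_int u \<xi>))\<^sup>2 * G s \<xi> \<partial>lborel)"
      using i by (intro nn_integral_eq_integral) (auto simp: G_def)
    ultimately show ?thesis by (simp add: ennreal_leI)
  qed
  have "(\<integral>\<^sup>+\<xi>. ennreal ((cmod (fourier_int u \<xi>))\<^sup>2) \<partial>lborel)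
     = (\<integral>\<^sup>+\<xi>. liminf (\<lambda>k. ennreal ((cmod (fourier_int u \<xi>))\<^sup>2 * G (1 / real (Suc k)) \<xi>)) \<partial>lborel)"
  proof (intro nn_integral_cong)
    fix \<xi> :: "real ^ 'm"
    have "(\<lambda>k. G (1 / real (Suc k)) \<xi>) \<longlonglongrightarrow> exp (- (0\<^sup>2 * (norm \<xi>)\<^sup>2) / 2)"
      unfolding G_def by (intro tendsto_intros LIMSEQ_Suc lim_1_over_n) auto
    then have "(\<lambda>k. ennreal ((cmod (fourier_int u \<xi>))\<^sup>2 * G (1 / real (Suc k)) \<xi>)) \<longlonglongrightarrow> ennreal ((cmod (fourier_int u \<xi>))\<^sup>2 * 1)"
      by (intro tendsto_ennrealI tendsto_mult_left) auto
    then show "ennreal ((cmod (fourier_int u \<xi>))\<^sup>2) = liminf (\<lambda>k. ennreal ((cmod (fourier_int u \<xi>))\<^sup>2 * G (1 / real (Suc k)) \<xi>))"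
      using lim_imp_Liminf[OF sequentially_bot] by fastforce
  qed
  also have "\<dots> \<le> liminf (\<lambda>k. \<integral>\<^sup>+\<xi>. ennreal ((cmod (fourier_int u \<xi>))\<^sup>2 * G (1 / real (Suc k)) \<xi>) \<partial>lborel)"
    by (rule nn_integral_liminf) measurable
  also have "\<dots> \<le> ennreal ((2 * pi) ^ CARD('m) * J)"
    by (intro Liminf_le always_eventually allI main) auto
  finally show ?thesis unfolding J by (simp add: ennreal_mult' J_def)
qed

subsection \<open>The Hausdorff--Young inequality\<close>

lemma integrable_exp_abs:
  fixes c :: real assumes c: "c > 0"
  shows "integrable lborel (\<lambda>x::real. exp (- c * \<bar>x\<bar>))"
proof -
  interpret prob_space "density lborel (exponential_density c)"
    by (rule prob_space_exponential_density[OF c])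
  have "(\<integral>\<^sup>+x. ennreal (exponential_density c x) \<partial>lborel) = 1"
    using emeasure_space_1 by (simp add: emeasure_density)
  then have i: "integrable lborel (exponential_density c)"
    by (intro integrableI_nonneg) (auto simp: exponential_density_nonneg[OF c])
  have i': "integrable lborel (\<lambda>x. exponential_density c (0 + (-1) * x))"
    using i by (rule lborel_integrable_real_affine) simp
  show ?thesis
  proof (rule Bochner_Integration.integrable_bound)
    show "integrable lborel (\<lambda>x. (exponential_density c x + exponential_density c (0 + (-1) * x)) / c)"
      using i i' by auto
    show "AE x in lborel. norm (exp (- c * \<bar>x\<bar>)) \<le> norm ((exponential_density c x + exponential_density c (0 + (-1) * x)) / c)"
      using c by (auto simp: exponential_density_def field_simps intro!: always_eventually)
  qed measurable
qed

lemma integrable_exp_norm: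
  fixes \<beta> :: real assumes \<beta>: "\<beta> > 0"
  shows "integrable lborel (\<lambda>\<xi>::real^'m::finite. exp (- \<beta> * norm \<xi>))"
proof -
  \<comment> \<open>Each |\<xi>_j| is at most |\<xi>|, so c times the sum of all |\<xi>_j| is at
    most \<beta>|\<xi>|, and a product of one-dimensional exponentials is an integrable
    majorant.\<close>
  define c where "c = \<beta> / CARD('m)"
  have c: "c > 0" using \<beta> by (simp add: c_def)
  have "integrable lborel (\<lambda>x::real. complex_of_real (exp (- c * \<bar>x\<bar>)))"
    using integrable_exp_abs[OF c] by (simp only: complex_of_real_integrable_eq)
  then have "integrable lborel (\<lambda>\<xi>::real^'m. \<Prod>j\<in>UNIV. complex_of_real (exp (- c * \<bar>\<xi> $ j\<bar>)))"
    by (intro prod_components_lborel(1))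
  then show ?thesis
  proof (rule Bochner_Integration.integrable_bound)
    show "AE \<xi> in lborel. norm (exp (- \<beta> * norm \<xi>)) \<le> norm (\<Prod>j\<in>UNIV. complex_of_real (exp (- c * \<bar>(\<xi>::real^'m) $ j\<bar>)))"
    proof (intro always_eventually allI)
      fix \<xi> :: "real ^ 'm"
      have "(\<Sum>j\<in>UNIV. \<bar>\<xi> $ j\<bar>) \<le> (\<Sum>j\<in>(UNIV::'m set). norm \<xi>)"
        by (intro sum_mono component_le_norm_cart)
      then have "c * (\<Sum>j\<in>UNIV. \<bar>\<xi> $ j\<bar>) \<le> c * (CARD('m) * norm \<xi>)"
        using c by (intro mult_left_mono) auto
      also have "\<dots> = \<beta> * norm \<xi>" by (simp add: c_def)
      finally have "exp (- \<beta> * norm \<xi>) \<le> exp (\<Sum>j\<in>UNIV. - c * \<bar>\<xi> $ j\<bar>)"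
        by (simp add: sum_distrib_left sum_negf)
      then show "norm (exp (- \<beta> * norm \<xi>)) \<le> norm (\<Prod>j\<in>UNIV. complex_of_real (exp (- c * \<bar>\<xi> $ j\<bar>)))"
        by (simp add: exp_sum prod_norm[symmetric])
    qed
  qed measurable
qed

text \<open>The substitute for Hausdorff-Young that works for all p in [1, 2] at once. Where |u| > 1
  one has |u| <= |u|^p, so that part lies in L^1 and has a bounded transform; where |u| <= 1 one has
  |u|^2 <= |u|^p, so that part lies in L^2 and Plancherel applies. The free parameter \<tau>
  matters: when the L^p mass is small, a large \<tau> makes the whole right side small.\<close>

lemma fourier_weighted_bound:
  fixes p \<beta> :: real
  assumes p: "1 \<le> p" "p \<le> 2" and \<beta>: "\<beta> > 0"
  obtains C where "C \<ge> 0" "\<And>\<tau> (u :: real ^ 'm::finite \<Rightarrow> complex). \<tau> \<ge> 1 \<Longrightarrow> integrable lborel u \<Longrightarrow>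
     (\<integral>\<^sup>+\<xi>. ennreal (cmod (fourier_int u \<xi>) * exp (- \<beta> * norm \<xi>)) \<partial>lborel)
     \<le> ennreal C * (ennreal \<tau> * (\<integral>\<^sup>+x. ennreal (cmod (u x) powr p) \<partial>lborel) + ennreal (1 / \<tau>))"
proof -
  define w where "w \<xi> = exp (- \<beta> * norm \<xi>)" for \<xi> :: "real ^ 'm"
  have [measurable]: "w \<in> borel_measurable borel" unfolding w_def by measurable
  have w: "integrable lborel w" unfolding w_def by (rule integrable_exp_norm[OF \<beta>])
  have w2: "integrable lborel (\<lambda>\<xi>. (w \<xi>)\<^sup>2)"
  proof -
    have "(w \<xi>)\<^sup>2 = exp (- (2 * \<beta>) * norm \<xi>)" for \<xi>
      unfolding w_def by (simp add: power2_eq_square flip: exp_add)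
    then show ?thesis using integrable_exp_norm[of "2 * \<beta>"] \<beta> by simp
  qed
  define K1 where "K1 = (\<integral>\<xi>. w \<xi> \<partial>lborel)"
  define K2 where "K2 = (\<integral>\<xi>. (w \<xi>)\<^sup>2 \<partial>lborel)"
  have K1: "(\<integral>\<^sup>+\<xi>. ennreal (w \<xi>) \<partial>lborel) = ennreal K1" "K1 \<ge> 0"
    unfolding K1_def by (rule nn_integral_eq_integral[OF w]) (auto simp: w_def)
  have K2: "(\<integral>\<^sup>+\<xi>. ennreal ((w \<xi>)\<^sup>2) \<partial>lborel) = ennreal K2" "K2 \<ge> 0"
    unfolding K2_def by (rule nn_integral_eq_integral[OF w2]) (auto simp: w_def)
  define C where "C = K1 + (2 * pi) ^ CARD('m) + K2"
  show thesis
  proof (rule that[of C])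
    show "C \<ge> 0" using K1 K2 by (simp add: C_def)
    fix \<tau> :: real and u :: "real ^ 'm \<Rightarrow> complex"
    assume \<tau>: "\<tau> \<ge> 1" and u: "integrable lborel u"
    have [measurable]: "u \<in> borel_measurable borel" using u by auto
    define I where "I = (\<integral>\<^sup>+x. ennreal (cmod (u x) powr p) \<partial>lborel)"
    define ub where "ub x = (if cmod (u x) > 1 then u x else 0)" for x
    define us where "us x = (if cmod (u x) > 1 then 0 else u x)" for x
    have [measurable]: "ub \<in> borel_measurable borel" "us \<in> borel_measurable borel"
      unfolding ub_def us_def by measurable
    have ub: "integrable lborel ub" and us: "integrable lborel us"
      by (rule Bochner_Integration.integrable_bound[OF u]; auto simp: ub_def us_def)+
    have "u = (\<lambda>x. ub x + us x)" by (auto simp: ub_def us_def)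
    then have split: "fourier_int u \<xi> = fourier_int ub \<xi> + fourier_int us \<xi>" for \<xi>
      using fourier_int_add[OF ub us, of \<xi>] by simp
    have b: "ennreal (cmod (fourier_int ub \<xi>)) \<le> I" for \<xi>
    proof -
      have "ennreal (cmod (fourier_int ub \<xi>)) \<le> ennreal (\<integral>x. cmod (ub x) \<partial>lborel)"
        by (intro ennreal_leI fourier_int_bound ub)
      also have "\<dots> = (\<integral>\<^sup>+x. ennreal (cmod (ub x)) \<partial>lborel)"
        using ub by (intro nn_integral_eq_integral[symmetric]) auto
      also have "\<dots> \<le> I"
        unfolding I_def
      proof (intro nn_integral_mono ennreal_leI)
        fix x
        show "cmod (ub x) \<le> cmod (u x) powr p"
          using powr_mono[OF p(1), of "cmod (u x)"] by (auto simp: ub_def)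
      qed
      finally show ?thesis .
    qed
    have s: "(\<integral>\<^sup>+\<xi>. ennreal ((cmod (fourier_int us \<xi>))\<^sup>2) \<partial>lborel) \<le> ennreal ((2 * pi) ^ CARD('m)) * I"
    proof -
      have "(\<integral>\<^sup>+x. ennreal ((cmod (us x))\<^sup>2) \<partial>lborel) \<le> I"
        unfolding I_def
      proof (intro nn_integral_mono ennreal_leI)
        fix x
        have "t powr 2 \<le> t powr p" if "0 \<le> t" "t \<le> 1" for t
          by (rule powr_mono') (use that p in auto)
        from this[of "cmod (u x)"] show "(cmod (us x))\<^sup>2 \<le> cmod (u x) powr p"
          by (auto simp: us_def)
      qed
      then show ?thesis
        by (intro order_trans[OF plancherel_bound[OF us]] mult_left_mono) auto
    qed
    have "ennreal (cmod (fourier_int u \<xi>) * w \<xi>) \<le> I * ennreal (w \<xi>) + (ennreal \<tau> * ennreal ((cmod (fourier_int us \<xi>))\<^sup>2) + ennreal (1 / \<tau>) * ennreal ((w \<xi>)\<^sup>2))" for \<xi>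
    proof -
      define A where "A = cmod (fourier_int us \<xi>)"
      \<comment> \<open>The L^2 part meets the square integrable weight through the inequality of
        the means with parameter \<tau>.\<close>
      have "0 \<le> (\<tau> * A - w \<xi>)\<^sup>2" by simp
      then have "2 * \<tau> * (A * w \<xi>) \<le> \<tau>\<^sup>2 * A\<^sup>2 + (w \<xi>)\<^sup>2"
        by (simp add: power2_diff power_mult_distrib mult_ac)
      moreover have "0 \<le> \<tau> * (A * w \<xi>)" using \<tau> by (simp add: A_def w_def)
      moreover have "\<tau> * (\<tau> * A\<^sup>2 + 1 / \<tau> * (w \<xi>)\<^sup>2) = \<tau>\<^sup>2 * A\<^sup>2 + (w \<xi>)\<^sup>2"
        using \<tau> by (simp add: distrib_left power2_eq_square)
      ultimately have "\<tau> * (A * w \<xi>) \<le> \<tau> * (\<tau> * A\<^sup>2 + 1 / \<tau> * (w \<xi>)\<^sup>2)"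
        by linarith
      then have 1: "A * w \<xi> \<le> \<tau> * A\<^sup>2 + 1 / \<tau> * (w \<xi>)\<^sup>2"
        using \<tau> by (subst (asm) mult_le_cancel_left_pos) auto
      have "cmod (fourier_int u \<xi>) * w \<xi> \<le> (cmod (fourier_int ub \<xi>) + A) * w \<xi>"
        unfolding split A_def by (intro mult_right_mono norm_triangle_ineq) (simp add: w_def)
      then have "cmod (fourier_int u \<xi>) * w \<xi> \<le> cmod (fourier_int ub \<xi>) * w \<xi> + (\<tau> * A\<^sup>2 + 1 / \<tau> * (w \<xi>)\<^sup>2)"
        using 1 by (simp add: distrib_right)
      then have "ennreal (cmod (fourier_int u \<xi>) * w \<xi>) \<le> ennreal (cmod (fourier_int ub \<xi>) * w \<xi> + (\<tau> * A\<^sup>2 + 1 / \<tau> * (w \<xi>)\<^sup>2))"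
        by (rule ennreal_leI)
      also have "\<dots> = ennreal (cmod (fourier_int ub \<xi>)) * ennreal (w \<xi>) + (ennreal \<tau> * ennreal (A\<^sup>2) + ennreal (1 / \<tau>) * ennreal ((w \<xi>)\<^sup>2))"
      proof -
        have "ennreal (a * b + (c * d + e * f)) = ennreal a * ennreal b + (ennreal c * ennreal d + ennreal e * ennreal f)"
          if "0 \<le> a" "0 \<le> b" "0 \<le> c" "0 \<le> d" "0 \<le> e" "0 \<le> f" for a b c d e f :: real
          using that by (simp add: ennreal_plus ennreal_mult)
        from this[of "cmod (fourier_int ub \<xi>)" "w \<xi>" \<tau> "A\<^sup>2" "1 / \<tau>" "(w \<xi>)\<^sup>2"] show ?thesis
          using \<tau> by (simp only: w_def A_def norm_ge_zero exp_ge_zero zero_le_power2 zero_le_divide_1_iff)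
      qed
      also have "\<dots> \<le> I * ennreal (w \<xi>) + (ennreal \<tau> * ennreal (A\<^sup>2) + ennreal (1 / \<tau>) * ennreal ((w \<xi>)\<^sup>2))"
        by (intro add_mono mult_right_mono b) auto
      finally show ?thesis unfolding A_def .
    qed
    then have "(\<integral>\<^sup>+\<xi>. ennreal (cmod (fourier_int u \<xi>) * w \<xi>) \<partial>lborel)
       \<le> (\<integral>\<^sup>+\<xi>. I * ennreal (w \<xi>) + (ennreal \<tau> * ennreal ((cmod (fourier_int us \<xi>))\<^sup>2) + ennreal (1 / \<tau>) * ennreal ((w \<xi>)\<^sup>2)) \<partial>lborel)"
      by (intro nn_integral_mono)
    also have "\<dots> = I * ennreal K1 + (ennreal \<tau> * (\<integral>\<^sup>+\<xi>. ennreal ((cmod (fourier_int us \<xi>))\<^sup>2) \<partial>lborel) + ennreal (1 / \<tau>) * ennreal K2)"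
      by (simp add: nn_integral_add nn_integral_cmult K1 K2)
    also have "\<dots> \<le> ennreal K1 * (ennreal \<tau> * I) + (ennreal ((2 * pi) ^ CARD('m)) * (ennreal \<tau> * I) + ennreal K2 * ennreal (1 / \<tau>))"
    proof (intro add_mono)
      have "1 * I \<le> ennreal \<tau> * I" using \<tau> by (intro mult_right_mono) auto
      then show "I * ennreal K1 \<le> ennreal K1 * (ennreal \<tau> * I)"
        by (subst mult.commute) (auto intro: mult_left_mono)
      show "ennreal \<tau> * (\<integral>\<^sup>+\<xi>. ennreal ((cmod (fourier_int us \<xi>))\<^sup>2) \<partial>lborel) \<le> ennreal ((2 * pi) ^ CARD('m)) * (ennreal \<tau> * I)"
        using mult_left_mono[OF s, of "ennreal \<tau>"] by (simp add: mult_ac)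
    qed (simp add: mult.commute)
    also have "\<dots> \<le> ennreal C * (ennreal \<tau> * I) + ennreal C * ennreal (1 / \<tau>)"
    proof -
      have "ennreal K1 * (ennreal \<tau> * I) + ennreal ((2 * pi) ^ CARD('m)) * (ennreal \<tau> * I) = ennreal (K1 + (2 * pi) ^ CARD('m)) * (ennreal \<tau> * I)"
        using K1 by (simp add: ennreal_plus distrib_right)
      also have "\<dots> \<le> ennreal C * (ennreal \<tau> * I)"
        using K2 by (intro mult_right_mono ennreal_leI) (auto simp: C_def)
      finally have 1: "ennreal K1 * (ennreal \<tau> * I) + ennreal ((2 * pi) ^ CARD('m)) * (ennreal \<tau> * I) \<le> ennreal C * (ennreal \<tau> * I)" .
      have "ennreal K2 * ennreal (1 / \<tau>) \<le> ennreal C * ennreal (1 / \<tau>)"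
        using K1 by (intro mult_right_mono ennreal_leI) (auto simp: C_def)
      with 1 show ?thesis unfolding add.assoc[symmetric] by (rule add_mono)
    qed
    finally show "(\<integral>\<^sup>+\<xi>. ennreal (cmod (fourier_int u \<xi>) * exp (- \<beta> * norm \<xi>)) \<partial>lborel)
     \<le> ennreal C * (ennreal \<tau> * (\<integral>\<^sup>+x. ennreal (cmod (u x) powr p) \<partial>lborel) + ennreal (1 / \<tau>))"
      unfolding w_def I_def by (simp add: distrib_left)
  qed
qed

section \<open>Marcinkiewicz interpolation\<close>

lemma nn_integral_powr_layer:
  fixes r y :: real assumes r: "r > 0" and y: "y \<ge> 0"
  shows "(\<integral>\<^sup>+\<tau>. ennreal (\<tau> powr (r - 1)) * indicator {0..y} \<tau> \<partial>lborel) = ennreal (y powr r / r)"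
  using nn_integral_has_integral_lebesgue'[OF _ has_integral_powr_from_0[of "r - 1" y]] r y by simp

text \<open>Marcinkiewicz interpolation between the bounds \<open>L\<^sup>1 \<rightarrow> L\<^sup>\<infinity>\<close> and \<open>L\<^sup>2 \<rightarrow> L\<^sup>2\<close>:
  at level \<open>\<tau>\<close> the function is cut where \<open>\<tau> |u|\<^bsup>p-1\<^esup> = 2 I\<close>, so that the transform of the large part
  stays below \<open>\<tau>/2\<close>.\<close>

lemma fourier_level_bound:
  fixes u :: "real ^ 'm::finite \<Rightarrow> complex" and p I \<tau> :: real
  assumes u: "integrable lborel u" and I: "I > 0" and p: "1 < p"
    and uI: "(\<integral>\<^sup>+x. ennreal (cmod (u x) powr p) \<partial>lborel) \<le> ennreal I" and \<tau>: "\<tau> > 0"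
  shows "(\<integral>\<^sup>+\<xi>. indicator {0..cmod (fourier_int u \<xi>)} \<tau> \<partial>lborel)
     \<le> ennreal (4 * (2 * pi) ^ CARD('m) / \<tau>\<^sup>2) *
        (\<integral>\<^sup>+x. ennreal ((cmod (u x))\<^sup>2) * indicator {x. \<tau> * cmod (u x) powr (p - 1) \<le> 2 * I} x \<partial>lborel)"
proof -
  have [measurable]: "u \<in> borel_measurable borel" using u by auto
  define S where "S = {x. \<tau> * cmod (u x) powr (p - 1) \<le> 2 * I}"
  have [measurable]: "S \<in> sets borel" unfolding S_def by measurable
  define ub where "ub x = (if x \<in> S then 0 else u x)" for x
  define us where "us x = (if x \<in> S then u x else 0)" for x
  have [measurable]: "ub \<in> borel_measurable borel" "us \<in> borel_measurable borel"
    unfolding ub_def us_def by measurable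
  have ub: "integrable lborel ub" and us: "integrable lborel us"
    by (rule Bochner_Integration.integrable_bound[OF u]; auto simp: ub_def us_def)+
  have "u = (\<lambda>x. ub x + us x)" by (auto simp: ub_def us_def)
  then have split: "fourier_int u \<xi> = fourier_int ub \<xi> + fourier_int us \<xi>" for \<xi>
    using fourier_int_add[OF ub us, of \<xi>] by simp
  have b: "cmod (fourier_int ub \<xi>) \<le> \<tau> / 2" for \<xi>
  proof -
    have "ennreal (cmod (fourier_int ub \<xi>)) \<le> ennreal (\<integral>x. cmod (ub x) \<partial>lborel)"
      by (intro ennreal_leI fourier_int_bound ub)
    also have "\<dots> = (\<integral>\<^sup>+x. ennreal (cmod (ub x)) \<partial>lborel)"
      using ub by (intro nn_integral_eq_integral[symmetric]) auto
    also have "\<dots> \<le> (\<integral>\<^sup>+x. ennreal (\<tau> / (2 * I)) * ennreal (cmod (u x) powr p) \<partial>lborel)"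
    proof (intro nn_integral_mono)
      fix x
      have "cmod (ub x) \<le> \<tau> / (2 * I) * cmod (u x) powr p"
      proof (cases "x \<in> S")
        case True
        then show ?thesis using \<tau> I by (simp add: ub_def)
      next
        case False
        have "2 * I * cmod (u x) \<le> \<tau> * cmod (u x) powr (p - 1) * cmod (u x)"
          using False by (intro mult_right_mono) (auto simp: S_def)
        also have "\<dots> = \<tau> * cmod (u x) powr p"
          by (cases "u x = 0") (auto simp: powr_diff)
        finally show ?thesis using False I by (simp add: ub_def field_simps)
      qed
      then show "ennreal (cmod (ub x)) \<le> ennreal (\<tau> / (2 * I)) * ennreal (cmod (u x) powr p)"
        using \<tau> I by (simp add: ennreal_leI flip: ennreal_mult)
    qed
    also have "\<dots> = ennreal (\<tau> / (2 * I)) * (\<integral>\<^sup>+x. ennreal (cmod (u x) powr p) \<partial>lborel)"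
      by (simp add: nn_integral_cmult)
    also have "\<dots> \<le> ennreal (\<tau> / (2 * I)) * ennreal I"
      using uI by (intro mult_left_mono) auto
    also have "\<dots> = ennreal (\<tau> / 2)"
      using \<tau> I by (simp flip: ennreal_mult)
    finally show ?thesis using \<tau> by (subst (asm) ennreal_le_iff) auto
  qed
  have "(\<integral>\<^sup>+\<xi>. indicator {0..cmod (fourier_int u \<xi>)} \<tau> \<partial>lborel) \<le> (\<integral>\<^sup>+\<xi>. ennreal (4 / \<tau>\<^sup>2) * ennreal ((cmod (fourier_int us \<xi>))\<^sup>2) \<partial>lborel)"
  proof (intro nn_integral_mono)
    fix \<xi>
    show "indicator {0..cmod (fourier_int u \<xi>)} \<tau> \<le> ennreal (4 / \<tau>\<^sup>2) * ennreal ((cmod (fourier_int us \<xi>))\<^sup>2)"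
    proof (cases "\<tau> \<le> cmod (fourier_int u \<xi>)")
      case True
      \<comment> \<open>Where the full transform reaches \<tau>, the small part must contribute at
        least \<tau>/2. What follows is Chebyshev's inequality in L^2 combined with
        Plancherel.\<close>
      then have "\<tau> / 2 \<le> cmod (fourier_int us \<xi>)"
        using norm_triangle_ineq[of "fourier_int ub \<xi>" "fourier_int us \<xi>"] b[of \<xi>] unfolding split by linarith
      then have "(\<tau> / 2)\<^sup>2 \<le> (cmod (fourier_int us \<xi>))\<^sup>2" using \<tau> by (intro power_mono) auto
      then have "1 \<le> 4 / \<tau>\<^sup>2 * (cmod (fourier_int us \<xi>))\<^sup>2" using \<tau> by (simp add: field_simps)
      then have "ennreal 1 \<le> ennreal (4 / \<tau>\<^sup>2) * ennreal ((cmod (fourier_int us \<xi>))\<^sup>2)"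
        by (subst ennreal_mult[symmetric]) (auto intro: ennreal_leI)
      then show ?thesis using True \<tau> by (auto simp: indicator_def)
    qed auto
  qed
  also have "\<dots> = ennreal (4 / \<tau>\<^sup>2) * (\<integral>\<^sup>+\<xi>. ennreal ((cmod (fourier_int us \<xi>))\<^sup>2) \<partial>lborel)"
    by (simp add: nn_integral_cmult)
  also have "\<dots> \<le> ennreal (4 / \<tau>\<^sup>2) * (ennreal ((2 * pi) ^ CARD('m)) * (\<integral>\<^sup>+x. ennreal ((cmod (us x))\<^sup>2) \<partial>lborel))"
    by (intro mult_left_mono plancherel_bound us) auto
  also have "(\<integral>\<^sup>+x. ennreal ((cmod (us x))\<^sup>2) \<partial>lborel) = (\<integral>\<^sup>+x. ennreal ((cmod (u x))\<^sup>2) * indicator S x \<partial>lborel)"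
    by (intro nn_integral_cong) (auto simp: us_def)
  also have "ennreal (4 / \<tau>\<^sup>2) * (ennreal ((2 * pi) ^ CARD('m)) * (\<integral>\<^sup>+x. ennreal ((cmod (u x))\<^sup>2) * indicator S x \<partial>lborel))
     = ennreal (4 * (2 * pi) ^ CARD('m) / \<tau>\<^sup>2) * (\<integral>\<^sup>+x. ennreal ((cmod (u x))\<^sup>2) * indicator S x \<partial>lborel)"
    unfolding mult.assoc[symmetric] by (subst ennreal_mult[symmetric]) auto
  finally show ?thesis unfolding S_def .
qed

text \<open>Layer-cake formula for the q-th power, then the level bound, then exchange of the
  integrals. For fixed x the remaining integral of \<tau>^(q-3) runs up to 2 I / |u(x)|^(p-1) and
  turns |u|^2 into |u|^p. It converges because q > 2; its factor 1/(q - 2) blows up as p tends to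
  2.\<close>

lemma hausdorff_young_interpolation:
  fixes u :: "real ^ 'm::finite \<Rightarrow> complex" and p q I :: real
  assumes p: "1 < p" "p < 2" and q: "q = p / (p - 1)"
    and u: "integrable lborel u" and I: "I > 0"
    and uI: "(\<integral>\<^sup>+x. ennreal (cmod (u x) powr p) \<partial>lborel) \<le> ennreal I"
  shows "(\<integral>\<^sup>+\<xi>. ennreal (cmod (fourier_int u \<xi>) powr q) \<partial>lborel)
     \<le> ennreal (4 * (2 * pi) ^ CARD('m) * q / (q - 2) * 2 powr (q - 2) * I powr (q / p))"
proof -
  have [measurable]: "u \<in> borel_measurable borel" using u by auto
  have q2: "q > 2" unfolding q using p by (simp add: field_simps)
  define D where "D = 4 * (2 * pi) ^ CARD('m) * q"
  have D: "D \<ge> 0" using q2 by (simp add: D_def)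
  have "(\<integral>\<^sup>+\<xi>. ennreal (cmod (fourier_int u \<xi>) powr q) \<partial>lborel)
     = (\<integral>\<^sup>+\<xi>. (\<integral>\<^sup>+\<tau>. ennreal (q * \<tau> powr (q - 1)) * indicator {0..cmod (fourier_int u \<xi>)} \<tau> \<partial>lborel) \<partial>lborel)"
  proof (intro nn_integral_cong)
    fix \<xi>
    have "(\<integral>\<^sup>+\<tau>. ennreal (q * \<tau> powr (q - 1)) * indicator {0..cmod (fourier_int u \<xi>)} \<tau> \<partial>lborel)
       = (\<integral>\<^sup>+\<tau>. ennreal q * (ennreal (\<tau> powr (q - 1)) * indicator {0..cmod (fourier_int u \<xi>)} \<tau>) \<partial>lborel)"
      using q2 by (intro nn_integral_cong) (auto simp: ennreal_mult' mult.assoc)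
    also have "\<dots> = ennreal q * ennreal (cmod (fourier_int u \<xi>) powr q / q)"
      using q2 by (subst nn_integral_cmult) (auto simp: nn_integral_powr_layer)
    also have "\<dots> = ennreal (cmod (fourier_int u \<xi>) powr q)"
      using q2 by (simp flip: ennreal_mult)
    finally show "ennreal (cmod (fourier_int u \<xi>) powr q) = (\<integral>\<^sup>+\<tau>. ennreal (q * \<tau> powr (q - 1)) * indicator {0..cmod (fourier_int u \<xi>)} \<tau> \<partial>lborel)" ..
  qed
  also have "\<dots> = (\<integral>\<^sup>+\<tau>. (\<integral>\<^sup>+\<xi>. ennreal (q * \<tau> powr (q - 1)) * indicator {0..cmod (fourier_int u \<xi>)} \<tau> \<partial>lborel) \<partial>lborel)"
  proof (rule lborel_pair.Fubini')
    have "(\<lambda>(\<tau>, \<xi>). ennreal (q * \<tau> powr (q - 1)) * indicator {0..cmod (fourier_int u \<xi>)} \<tau>)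
       = (\<lambda>(\<tau>, \<xi>). ennreal (q * \<tau> powr (q - 1)) * (if 0 \<le> \<tau> \<and> \<tau> \<le> cmod (fourier_int u \<xi>) then 1 else 0))"
      by (auto simp: fun_eq_iff)
    then show "(\<lambda>(\<tau>, \<xi>). ennreal (q * \<tau> powr (q - 1)) * indicator {0..cmod (fourier_int u \<xi>)} \<tau>) \<in> borel_measurable (lborel \<Otimes>\<^sub>M lborel)"
      by simp
  qed
  also have "\<dots> \<le> (\<integral>\<^sup>+\<tau>. (\<integral>\<^sup>+x. ennreal (D * \<tau> powr (q - 3) * (cmod (u x))\<^sup>2) * (if 0 \<le> \<tau> \<and> \<tau> * cmod (u x) powr (p - 1) \<le> 2 * I then 1 else 0) \<partial>lborel) \<partial>lborel)"
  proof (rule nn_integral_mono)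
    fix \<tau> :: real
    show "(\<integral>\<^sup>+\<xi>. ennreal (q * \<tau> powr (q - 1)) * indicator {0..cmod (fourier_int u \<xi>)} \<tau> \<partial>lborel)
       \<le> (\<integral>\<^sup>+x. ennreal (D * \<tau> powr (q - 3) * (cmod (u x))\<^sup>2) * (if 0 \<le> \<tau> \<and> \<tau> * cmod (u x) powr (p - 1) \<le> 2 * I then 1 else 0) \<partial>lborel)"
    proof (cases "\<tau> > 0")
      case False
      \<comment> \<open>For negative \<tau> the indicator vanishes; at \<tau> = 0 the power does,
        since \<open>0 powr (q - 1)\<close> is 0.\<close>
      then have "ennreal (q * \<tau> powr (q - 1)) * indicator {0..cmod (fourier_int u \<xi>)} \<tau> = 0" for \<xi>
        by (cases "\<tau> = 0") auto
      then show ?thesis by (simp only: nn_integral_const) simp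
    next
      case True
      have m: "(\<lambda>\<xi>. indicator {0..cmod (fourier_int u \<xi>)} \<tau> :: ennreal) \<in> borel_measurable (lborel :: (real^'m) measure)"
      proof -
        have "(\<lambda>\<xi>. indicator {0..cmod (fourier_int u \<xi>)} \<tau>) = (\<lambda>\<xi>. if 0 \<le> \<tau> \<and> \<tau> \<le> cmod (fourier_int u \<xi>) then 1 else (0::ennreal))"
          by (auto simp: fun_eq_iff)
        then show ?thesis by (simp only:) measurable
      qed
      have "(\<integral>\<^sup>+\<xi>. ennreal (q * \<tau> powr (q - 1)) * indicator {0..cmod (fourier_int u \<xi>)} \<tau> \<partial>lborel)
         = ennreal (q * \<tau> powr (q - 1)) * (\<integral>\<^sup>+\<xi>. indicator {0..cmod (fourier_int u \<xi>)} \<tau> \<partial>lborel)"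
        by (rule nn_integral_cmult[OF m])
      also have "\<dots> \<le> ennreal (q * \<tau> powr (q - 1)) * (ennreal (4 * (2 * pi) ^ CARD('m) / \<tau>\<^sup>2) *
        (\<integral>\<^sup>+x. ennreal ((cmod (u x))\<^sup>2) * indicator {x. \<tau> * cmod (u x) powr (p - 1) \<le> 2 * I} x \<partial>lborel))"
        by (intro mult_left_mono fourier_level_bound[OF u I p(1) uI True]) auto
      also have "\<dots> = (\<integral>\<^sup>+x. ennreal (q * \<tau> powr (q - 1)) * (ennreal (4 * (2 * pi) ^ CARD('m) / \<tau>\<^sup>2) * (ennreal ((cmod (u x))\<^sup>2) * indicator {x. \<tau> * cmod (u x) powr (p - 1) \<le> 2 * I} x)) \<partial>lborel)"
        by (simp add: nn_integral_cmult)
      also have "\<dots> \<le> (\<integral>\<^sup>+x. ennreal (D * \<tau> powr (q - 3) * (cmod (u x))\<^sup>2) * (if 0 \<le> \<tau> \<and> \<tau> * cmod (u x) powr (p - 1) \<le> 2 * I then 1 else 0) \<partial>lborel)"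
      proof (intro nn_integral_mono)
        fix x
        have e: "\<tau> powr (q - 1) / \<tau>\<^sup>2 = \<tau> powr (q - 3)"
          using True by (simp add: powr_diff power2_eq_square power3_eq_cube)
        have "q * \<tau> powr (q - 1) * (4 * (2 * pi) ^ CARD('m) / \<tau>\<^sup>2) = D * (\<tau> powr (q - 1) / \<tau>\<^sup>2)"
          by (simp add: D_def)
        then have "ennreal (q * \<tau> powr (q - 1)) * ennreal (4 * (2 * pi) ^ CARD('m) / \<tau>\<^sup>2) * ennreal ((cmod (u x))\<^sup>2) = ennreal (D * \<tau> powr (q - 3) * (cmod (u x))\<^sup>2)"
          unfolding e using q2 True by (simp add: D flip: ennreal_mult)
        then show "ennreal (q * \<tau> powr (q - 1)) * (ennreal (4 * (2 * pi) ^ CARD('m) / \<tau>\<^sup>2) * (ennreal ((cmod (u x))\<^sup>2) * indicator {x. \<tau> * cmod (u x) powr (p - 1) \<le> 2 * I} x))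
          \<le> ennreal (D * \<tau> powr (q - 3) * (cmod (u x))\<^sup>2) * (if 0 \<le> \<tau> \<and> \<tau> * cmod (u x) powr (p - 1) \<le> 2 * I then 1 else 0)"
          using True unfolding mult.assoc[symmetric] by simp
      qed
      finally show ?thesis .
    qed
  qed
  also have "\<dots> = (\<integral>\<^sup>+x. (\<integral>\<^sup>+\<tau>. ennreal (D * \<tau> powr (q - 3) * (cmod (u x))\<^sup>2) * (if 0 \<le> \<tau> \<and> \<tau> * cmod (u x) powr (p - 1) \<le> 2 * I then 1 else 0) \<partial>lborel) \<partial>lborel)"
    by (rule lborel_pair.Fubini') measurable
  also have "\<dots> \<le> (\<integral>\<^sup>+x. ennreal (D / (q - 2) * (2 * I) powr (q - 2)) * ennreal (cmod (u x) powr p) \<partial>lborel)"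
  proof (intro nn_integral_mono)
    fix x
    show "(\<integral>\<^sup>+\<tau>. ennreal (D * \<tau> powr (q - 3) * (cmod (u x))\<^sup>2) * (if 0 \<le> \<tau> \<and> \<tau> * cmod (u x) powr (p - 1) \<le> 2 * I then 1 else 0) \<partial>lborel)
       \<le> ennreal (D / (q - 2) * (2 * I) powr (q - 2)) * ennreal (cmod (u x) powr p)"
    proof (cases "u x = 0")
      case False
      define t where "t = cmod (u x)"
      have t: "t > 0" using False by (simp add: t_def)
      define L where "L = 2 * I / t powr (p - 1)"
      have L: "L > 0" using I t by (simp add: L_def)
      have "(\<integral>\<^sup>+\<tau>. ennreal (D * \<tau> powr (q - 3) * t\<^sup>2) * (if 0 \<le> \<tau> \<and> \<tau> * t powr (p - 1) \<le> 2 * I then 1 else 0) \<partial>lborel)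
         = (\<integral>\<^sup>+\<tau>. ennreal (D * t\<^sup>2) * (ennreal (\<tau> powr ((q - 2) - 1)) * indicator {0..L} \<tau>) \<partial>lborel)"
      proof (intro nn_integral_cong)
        fix \<tau> :: real
        have "(\<tau> * t powr (p - 1) \<le> 2 * I) \<longleftrightarrow> \<tau> \<le> L"
          unfolding L_def using t by (simp add: field_simps)
        then show "ennreal (D * \<tau> powr (q - 3) * t\<^sup>2) * (if 0 \<le> \<tau> \<and> \<tau> * t powr (p - 1) \<le> 2 * I then 1 else 0)
          = ennreal (D * t\<^sup>2) * (ennreal (\<tau> powr ((q - 2) - 1)) * indicator {0..L} \<tau>)"
          using D by (auto simp: mult_ac simp flip: ennreal_mult)
      qed
      also have "\<dots> = ennreal (D * t\<^sup>2) * ennreal (L powr (q - 2) / (q - 2))"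
        using q2 L by (subst nn_integral_cmult, simp, subst nn_integral_powr_layer) auto
      also have "\<dots> = ennreal (D / (q - 2) * (2 * I) powr (q - 2)) * ennreal (t powr p)"
      proof -
        \<comment> \<open>Conjugacy of the exponents enters here: (p-1) q = p, hence (p-1)(q-2) = 2
          - p.\<close>
        have ex: "2 - (p - 1) * (q - 2) = p"
          unfolding q using p by (simp add: field_simps)
        have "t\<^sup>2 * L powr (q - 2) = (2 * I) powr (q - 2) * (t powr 2 / t powr ((p - 1) * (q - 2)))"
          unfolding L_def using t I by (simp add: powr_divide powr_powr)
        also have "\<dots> = (2 * I) powr (q - 2) * t powr p"
          unfolding powr_diff[symmetric] ex ..
        finally have "D * t\<^sup>2 * (L powr (q - 2) / (q - 2)) = D / (q - 2) * (2 * I) powr (q - 2) * t powr p"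
          by (simp add: field_simps)
        then show ?thesis using D q2 by (simp flip: ennreal_mult)
      qed
      finally show ?thesis unfolding t_def by simp
    qed simp
  qed
  also have "\<dots> = ennreal (D / (q - 2) * (2 * I) powr (q - 2)) * (\<integral>\<^sup>+x. ennreal (cmod (u x) powr p) \<partial>lborel)"
    by (simp add: nn_integral_cmult)
  also have "\<dots> \<le> ennreal (D / (q - 2) * (2 * I) powr (q - 2)) * ennreal I"
    by (intro mult_left_mono uI) auto
  also have "\<dots> = ennreal (4 * (2 * pi) ^ CARD('m) * q / (q - 2) * 2 powr (q - 2) * I powr (q / p))"
  proof -
    have "q / p = (q - 2) + 1" unfolding q using p by (simp add: field_simps)
    then have "I powr (q / p) = I powr (q - 2) * I" using I by (simp only: powr_add powr_one)
    then have "D / (q - 2) * (2 * I) powr (q - 2) * I = 4 * (2 * pi) ^ CARD('m) * q / (q - 2) * 2 powr (q - 2) * I powr (q / p)"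
      using I by (simp add: D_def powr_mult)
    then show ?thesis using D q2 I by (simp flip: ennreal_mult)
  qed
  finally show ?thesis .
qed

text \<open>The endpoint p = 2 is Plancherel, since the interpolation constant degenerates there.
  The constant depends only on p and the dimension; it is not the sharp one.\<close>

lemma hausdorff_young:
  fixes p q :: real
  assumes p: "1 < p" "p \<le> 2" and q: "q = p / (p - 1)"
  obtains K where "K \<ge> 0" "\<And>(u :: real ^ 'm::finite \<Rightarrow> complex) I. integrable lborel u \<Longrightarrow> I \<ge> 0 \<Longrightarrow>
     (\<integral>\<^sup>+x. ennreal (cmod (u x) powr p) \<partial>lborel) \<le> ennreal I \<Longrightarrow>
     (\<integral>\<^sup>+\<xi>. ennreal (cmod (fourier_int u \<xi>) powr q) \<partial>lborel) \<le> ennreal (K * I powr (q / p))"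
proof (cases "p = 2")
  case True
  then have q2: "q = 2" using q by simp
  show thesis
  proof (rule that[of "(2 * pi) ^ CARD('m)"])
    fix u :: "real ^ 'm \<Rightarrow> complex" and I :: real
    assume u: "integrable lborel u" and I: "I \<ge> 0" and uI: "(\<integral>\<^sup>+x. ennreal (cmod (u x) powr p) \<partial>lborel) \<le> ennreal I"
    have "ennreal ((2 * pi) ^ CARD('m)) * (\<integral>\<^sup>+x. ennreal ((cmod (u x))\<^sup>2) \<partial>lborel) \<le> ennreal ((2 * pi) ^ CARD('m)) * ennreal I"
      using uI True by (intro mult_left_mono) auto
    from order_trans[OF plancherel_bound[OF u] this]
    show "(\<integral>\<^sup>+\<xi>. ennreal (cmod (fourier_int u \<xi>) powr q) \<partial>lborel) \<le> ennreal ((2 * pi) ^ CARD('m) * I powr (q / p))"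
      using I True q2 by (simp add: ennreal_mult)
  qed simp
next
  case False
  then have p2: "p < 2" using p by simp
  have q2: "q > 2" unfolding q using p p2 by (simp add: field_simps)
  show thesis
  proof (rule that[of "4 * (2 * pi) ^ CARD('m) * q / (q - 2) * 2 powr (q - 2)"])
    show "0 \<le> 4 * (2 * pi) ^ CARD('m) * q / (q - 2) * 2 powr (q - 2)" using q2 by simp
    fix u :: "real ^ 'm \<Rightarrow> complex" and I :: real
    assume u: "integrable lborel u" and I: "I \<ge> 0" and uI: "(\<integral>\<^sup>+x. ennreal (cmod (u x) powr p) \<partial>lborel) \<le> ennreal I"
    have [measurable]: "u \<in> borel_measurable borel" using u by auto
    show "(\<integral>\<^sup>+\<xi>. ennreal (cmod (fourier_int u \<xi>) powr q) \<partial>lborel) \<le> ennreal (4 * (2 * pi) ^ CARD('m) * q / (q - 2) * 2 powr (q - 2) * I powr (q / p))"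
    \<comment> \<open>The level bound divides by I, so vanishing I is separate: then u is 0 almost
      everywhere.\<close>
    proof (cases "I = 0")
      case True
      then have "(\<integral>\<^sup>+x. ennreal (cmod (u x) powr p) \<partial>lborel) = 0" using uI by simp
      then have "AE x in lborel. ennreal (cmod (u x) powr p) = 0"
        by (subst (asm) nn_integral_0_iff_AE) auto
      then have "AE x in lborel. u x = 0"
        by (auto simp: ennreal_eq_0_iff)
      then have "fourier_int u \<xi> = 0" for \<xi>
        unfolding fourier_int_def by (intro integral_eq_zero_AE) auto
      then show ?thesis by simp
    next
      case False
      then show ?thesis using hausdorff_young_interpolation[OF p(1) p2 q u _ uI] I by simp
    qed
  qed
qed

subsection \<open>Left multiplication in the Clifford algebra\<close>

lemma sym_diff_cancel [simp]: "sym_diff {j} (sym_diff {j} U) = U"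
  by (auto simp: sym_diff_def)

lemma sym_diff_commute3: "sym_diff {k} (sym_diff {j} U) = sym_diff {j} (sym_diff {k} U)"
  by (auto simp: sym_diff_def)

text \<open>Indexed by the output set \<open>U\<close>: it is the sign with which the component of y
  at \<open>sym_diff {j} U\<close> enters the component of e_j y at \<open>U\<close> (see
  \<open>cl_mult_gen\<close>).\<close>

definition gen_sign :: "'m::{finite,linorder} \<Rightarrow> 'm set \<Rightarrow> complex" where
  "gen_sign j U = cl_sign {j} (sym_diff {j} U)"

text \<open>Elements below j are the same in \<open>U\<close> and in \<open>sym_diff {j} U\<close>.
  The extra sign of e_j e_j = -1 occurs exactly when j belongs to the input set, that is, when j is
  not in \<open>U\<close>.\<close>

lemma gen_sign_eq: "gen_sign j U = (-1) ^ card {t \<in> U. t < j} * (if j \<in> U then 1 else -1)"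
proof -
  have "{(s, t). s \<in> {j} \<and> t \<in> sym_diff {j} U \<and> t < s} = Pair j ` {t \<in> U. t < j}"
    by (auto simp: sym_diff_def)
  then have "card {(s, t). s \<in> {j} \<and> t \<in> sym_diff {j} U \<and> t < s} = card {t \<in> U. t < j}"
    by (simp add: card_image inj_on_def)
  moreover have "card ({j} \<inter> sym_diff {j} U) = (if j \<in> U then 0 else 1)"
    by (auto simp: sym_diff_def)
  ultimately show ?thesis
    unfolding gen_sign_def cl_sign_def by (simp add: power_add)
qed

lemma gen_sign_norm [simp]: "cmod (gen_sign j U) = 1"
  unfolding gen_sign_eq by (simp add: norm_mult norm_power)

lemma gen_sign_square: "gen_sign j U * gen_sign j (sym_diff {j} U) = -1"
proof -
  have "{t \<in> sym_diff {j} U. t < j} = {t \<in> U. t < j}" by (auto simp: sym_diff_def)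
  moreover have "j \<in> sym_diff {j} U \<longleftrightarrow> j \<notin> U" by (auto simp: sym_diff_def)
  ultimately show ?thesis unfolding gen_sign_eq
    by (simp add: power_mult_distrib[symmetric])
qed

text \<open>The relation e_j e_k = - e_k e_j in coordinates. Toggling the smaller index k changes
  the parity of the number of elements below j, while toggling j leaves the number below k as it
  was.\<close>

lemma gen_sign_anticommute_less:
  assumes "k < j"
  shows "gen_sign j U * gen_sign k (sym_diff {j} U) = - (gen_sign k U * gen_sign j (sym_diff {k} U))"
proof -
  have "{t \<in> sym_diff {j} U. t < k} = {t \<in> U. t < k}" using assms by (auto simp: sym_diff_def)
  moreover have "k \<in> sym_diff {j} U \<longleftrightarrow> k \<in> U" "j \<in> sym_diff {k} U \<longleftrightarrow> j \<in> U"
    using assms by (auto simp: sym_diff_def)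
  moreover have "(-1 :: complex) ^ card {t \<in> sym_diff {k} U. t < j} = - ((-1) ^ card {t \<in> U. t < j})"
  proof (cases "k \<in> U")
    case True
    then have e: "{t \<in> U. t < j} = insert k {t \<in> sym_diff {k} U. t < j}"
      using assms by (auto simp: sym_diff_def)
    have "card {t \<in> U. t < j} = Suc (card {t \<in> sym_diff {k} U. t < j})"
      unfolding e by (rule card_insert_disjoint) (use True in \<open>auto simp: sym_diff_def\<close>)
    then show ?thesis by simp
  next
    case False
    then have e: "{t \<in> sym_diff {k} U. t < j} = insert k {t \<in> U. t < j}"
      using assms by (auto simp: sym_diff_def)
    have "card {t \<in> sym_diff {k} U. t < j} = Suc (card {t \<in> U. t < j})"
      unfolding e by (rule card_insert_disjoint) (use False in auto)
    then show ?thesis by simp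
  qed
  ultimately show ?thesis unfolding gen_sign_eq by simp
qed

lemma gen_sign_anticommute:
  assumes "j \<noteq> k"
  shows "gen_sign j U * gen_sign k (sym_diff {j} U) = - (gen_sign k U * gen_sign j (sym_diff {k} U))"
  using assms gen_sign_anticommute_less[of k j U] gen_sign_anticommute_less[of j k U]
  by (cases "k < j") (auto simp: not_less)

lemma cl_mult_gen: "cl_mult (cl_e j) y U = gen_sign j U * y (sym_diff {j} U)"
proof -
  have "cl_mult (cl_e j) y U = (\<Sum>S\<in>UNIV. if S = {j} then cl_sign S (sym_diff S U) * y (sym_diff S U) else 0)"
    unfolding cl_mult_def cl_e_def by (intro sum.cong) auto
  then show ?thesis unfolding gen_sign_def by simp
qed

text \<open>Left multiplication by the vector \<xi> (\<open>cl_mult_vec\<close>), which is what the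
  Dirac operator in the space variables becomes, up to the factor i, under the Fourier
  transform.\<close>

definition dirac_symbol :: "real ^ 'm::{finite,linorder} \<Rightarrow> 'm::{finite,linorder} clif \<Rightarrow> 'm clif" where
  "dirac_symbol \<xi> y U = (\<Sum>j\<in>UNIV. complex_of_real (\<xi> $ j) * cl_mult (cl_e j) y U)"

lemma dirac_symbol_linear:
  "dirac_symbol \<xi> (\<lambda>T. a * y T + b * z T) U = a * dirac_symbol \<xi> y U + b * dirac_symbol \<xi> z U"
  unfolding dirac_symbol_def cl_mult_gen by (simp add: sum_distrib_left sum.distrib algebra_simps)

text \<open>The identity that the square of a vector is -|\<xi>|^2. Adding the double sum to its
  transpose makes the off-diagonal terms cancel in pairs and leaves twice the diagonal.\<close>

lemma dirac_symbol_square: "dirac_symbol \<xi> (dirac_symbol \<xi> y) U = - of_real ((norm \<xi>)\<^sup>2) * y U"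
proof -
  define T where "T j k = complex_of_real (\<xi> $ j) * complex_of_real (\<xi> $ k) *
     (gen_sign j U * gen_sign k (sym_diff {j} U)) * y (sym_diff {k} (sym_diff {j} U))" for j k
  have S: "dirac_symbol \<xi> (dirac_symbol \<xi> y) U = (\<Sum>j\<in>UNIV. \<Sum>k\<in>UNIV. T j k)"
    unfolding dirac_symbol_def cl_mult_gen T_def by (simp add: sum_distrib_left mult_ac)
  have T: "T j k + T k j = (if k = j then - 2 * of_real ((\<xi> $ j)\<^sup>2) * y U else 0)" for j k
  proof (cases "k = j")
    case True
    then show ?thesis unfolding T_def by (simp add: gen_sign_square power2_eq_square)
  next
    case False
    then show ?thesis unfolding T_def
      by (subst gen_sign_anticommute[of j k]) (auto simp: sym_diff_commute3[of k j])
  qed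
  have "(\<Sum>j\<in>UNIV. \<Sum>k\<in>UNIV. T j k) + (\<Sum>j\<in>UNIV. \<Sum>k\<in>UNIV. T j k)
     = (\<Sum>j\<in>UNIV. \<Sum>k\<in>UNIV. T j k) + (\<Sum>j\<in>UNIV. \<Sum>k\<in>UNIV. T k j)"
    by (subst (2) sum.swap) simp
  also have "\<dots> = (\<Sum>j\<in>UNIV. - 2 * of_real ((\<xi> $ j)\<^sup>2) * y U)"
    unfolding sum.distrib[symmetric] T by simp
  also have "\<dots> = - 2 * of_real ((norm \<xi>)\<^sup>2) * y U"
    by (simp add: norm_vec_square sum_distrib_left sum_distrib_right)
  finally have e: "(\<Sum>j\<in>UNIV. \<Sum>k\<in>UNIV. T j k) + (\<Sum>j\<in>UNIV. \<Sum>k\<in>UNIV. T j k) = - 2 * of_real ((norm \<xi>)\<^sup>2) * y U" .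
  have "z = - w" if "z + z = - 2 * w" for z w :: complex
  proof -
    have "z = (z + z) / 2" by simp
    then show ?thesis unfolding that by simp
  qed
  from this[OF e[unfolded mult.assoc]] show ?thesis unfolding S by simp
qed

lemma cl_mult_one: "cl_mult cl_one y U = y U"
proof -
  have "cl_mult cl_one y U = (\<Sum>S\<in>UNIV. if S = {} then cl_sign S (sym_diff S U) * y (sym_diff S U) else 0)"
    unfolding cl_mult_def cl_one_def by (intro sum.cong) auto
  then show ?thesis by (simp add: sym_diff_def cl_sign_def)
qed

lemma cl_mult_vec: "cl_mult (cl_vec \<xi>) y U = dirac_symbol \<xi> y U"
proof -
  have "cl_mult (cl_vec \<xi>) y U = (\<Sum>S\<in>UNIV. \<Sum>j\<in>UNIV. complex_of_real (\<xi> $ j) * (cl_sign S (sym_diff S U) * cl_e j S * y (sym_diff S U)))"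
    unfolding cl_mult_def cl_vec_def
    by (intro sum.cong refl) (simp add: sum_distrib_left sum_distrib_right mult_ac)
  also have "\<dots> = (\<Sum>j\<in>UNIV. \<Sum>S\<in>UNIV. complex_of_real (\<xi> $ j) * (cl_sign S (sym_diff S U) * cl_e j S * y (sym_diff S U)))"
    by (rule sum.swap)
  also have "\<dots> = dirac_symbol \<xi> y U"
    by (simp add: dirac_symbol_def cl_mult_def sum_distrib_left)
  finally show ?thesis .
qed

lemma cl_mult_left_linear:
  "cl_mult (\<lambda>T. a * x T + b * z T) y U = a * cl_mult x y U + b * cl_mult z y U"
  unfolding cl_mult_def by (simp add: sum_distrib_left sum.distrib algebra_simps)

lemma cl_mult_chi:
  "cl_mult (chi s \<xi>) y U = 1/2 * (y U + complex_of_real s * \<i> * dirac_symbol \<xi> y U / complex_of_real (norm \<xi>))"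
proof -
  have "chi s \<xi> = (\<lambda>T. 1/2 * cl_one T + (1/2 * complex_of_real s * \<i> / complex_of_real (norm \<xi>)) * cl_vec \<xi> T)"
    unfolding chi_def by (auto simp: fun_eq_iff algebra_simps)
  then show ?thesis
    by (simp only: cl_mult_left_linear cl_mult_one cl_mult_vec) (simp add: algebra_simps)
qed

lemma cl_mult_chi_linear:
  "cl_mult (chi s \<xi>) (\<lambda>T. a * y T + b * z T) U = a * cl_mult (chi s \<xi>) y U + b * cl_mult (chi s \<xi>) z U"
  unfolding cl_mult_chi dirac_symbol_linear by (simp add: algebra_simps add_divide_distrib)

lemma cl_mult_chi_diff:
  "cl_mult (chi s \<xi>) (\<lambda>T. y T - z T) U = cl_mult (chi s \<xi>) y U - cl_mult (chi s \<xi>) z U"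
  using cl_mult_chi_linear[of s \<xi> 1 y "-1" z U] by simp

lemma cl_mult_chi_sum: "cl_mult (chi 1 \<xi>) y U + cl_mult (chi (-1) \<xi>) y U = y U"
  unfolding cl_mult_chi by (simp add: algebra_simps)

text \<open>The eigenvalue relation behind the two exponentials. Since (i \<xi>)^2 = |\<xi>|^2,
  multiplication by i \<xi> exchanges the two summands of \<open>chi s\<close> up to the factor s
  |\<xi>|. At \<xi> = 0 both sides vanish.\<close>

lemma dirac_symbol_chi:
  assumes s: "s = 1 \<or> s = - 1"
  shows "\<i> * cl_mult (chi s \<xi>) (dirac_symbol \<xi> y) U = of_real (s * norm \<xi>) * cl_mult (chi s \<xi>) y U"
proof (cases "\<xi> = 0")
  case True
  then show ?thesis unfolding cl_mult_chi dirac_symbol_def by simp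
next
  case False
  then have n: "complex_of_real (norm \<xi>) \<noteq> 0" by simp
  have gen: "\<i> * (1/2 * (d + c * \<i> * (- (n\<^sup>2) * z) / n)) = (c * n) * (1/2 * (z + c * \<i> * d / n))"
    if "n \<noteq> 0" and c: "c = 1 \<or> c = -1" for d z n c :: complex
  proof -
    have "c * \<i> * (- (n\<^sup>2) * z) / n = - (c * \<i> * n * z)" using that(1) by (simp add: power2_eq_square)
    moreover have "c * n * (c * \<i> * d / n) = \<i> * d" using that by auto
    moreover have "\<i> * (1/2 * (d + - (c * \<i> * n * z))) = 1/2 * (\<i> * d) + 1/2 * (c * n * z)"
      by (simp add: right_diff_distrib mult_ac)
    moreover have "(c * n) * (1/2 * (z + c * \<i> * d / n)) = 1/2 * (c * n * z) + 1/2 * (c * n * (c * \<i> * d / n))"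
      by (simp add: distrib_left)
    ultimately show ?thesis by (simp only: add.commute)
  qed
  show ?thesis
    using gen[OF n, of "complex_of_real s" "dirac_symbol \<xi> y U" "y U"] s
    unfolding cl_mult_chi dirac_symbol_square of_real_mult of_real_power by auto
qed

text \<open>Complementary projections, by the eigenvalue relation. At \<xi> = 0 the convention x/0 =
  0 turns \<open>chi\<close> into half the identity, which is not idempotent, so that point is
  excluded and later discarded as a null set.\<close>

lemma cl_mult_chi_chi:
  assumes s: "s = 1 \<or> s = - 1" and r: "r = 1 \<or> r = - 1" and \<xi>: "\<xi> \<noteq> 0"
  shows "cl_mult (chi s \<xi>) (cl_mult (chi r \<xi>) y) U = (if s = r then cl_mult (chi s \<xi>) y U else 0)"
proof -
  have n: "complex_of_real (norm \<xi>) \<noteq> 0" using \<xi> by simp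
  have "cl_mult (chi r \<xi>) y = (\<lambda>T. 1/2 * y T + (1/2 * complex_of_real r * \<i> / complex_of_real (norm \<xi>)) * dirac_symbol \<xi> y T)"
    unfolding cl_mult_chi by (auto simp: fun_eq_iff algebra_simps)
  then have "cl_mult (chi s \<xi>) (cl_mult (chi r \<xi>) y) U = 1/2 * cl_mult (chi s \<xi>) y U
     + (1/2 * complex_of_real r / complex_of_real (norm \<xi>)) * (\<i> * cl_mult (chi s \<xi>) (dirac_symbol \<xi> y) U)"
    by (simp only: cl_mult_chi_linear) (simp add: algebra_simps)
  also have "\<dots> = 1/2 * cl_mult (chi s \<xi>) y U + 1/2 * of_real (r * s) * cl_mult (chi s \<xi>) y U"
    unfolding dirac_symbol_chi[OF s] using n by (simp add: field_simps)
  finally show ?thesis using s r by auto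
qed

lemma cl_mult_gen_norm: "cmod (cl_mult (cl_e j) y U) \<le> (\<Sum>T\<in>UNIV. cmod (y T))"
  unfolding cl_mult_gen by (auto simp: norm_mult intro!: member_le_sum)

text \<open>The division by |\<xi>| is compensated by |\<xi>_j| <= |\<xi>|, so the constant is
  uniform in \<xi>: 1 for the identity part and 1 for each of the m generators.\<close>

lemma cl_mult_chi_norm:
  fixes \<xi> :: "real ^ 'm::{finite,linorder}"
  assumes s: "s = 1 \<or> s = - 1"
  shows "cmod (cl_mult (chi s \<xi>) y U) \<le> (1 + real CARD('m)) * (\<Sum>T\<in>UNIV. cmod (y T))"
proof -
  define N where "N = (\<Sum>T\<in>UNIV. cmod (y T))"
  have N: "N \<ge> 0" by (auto simp: N_def intro: sum_nonneg)
  have y: "cmod (y U) \<le> N" unfolding N_def by (rule member_le_sum) auto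
  have "cmod (dirac_symbol \<xi> y U) \<le> (\<Sum>j\<in>(UNIV::'m set). norm \<xi> * N)"
    unfolding dirac_symbol_def
  proof (rule order_trans[OF norm_sum sum_mono])
    fix j :: 'm
    show "cmod (complex_of_real (\<xi> $ j) * cl_mult (cl_e j) y U) \<le> norm \<xi> * N"
      unfolding norm_mult N_def
      by (intro mult_mono cl_mult_gen_norm) (auto simp: component_le_norm_cart)
  qed
  then have d: "cmod (dirac_symbol \<xi> y U) \<le> real CARD('m) * N * norm \<xi>" by (simp add: mult_ac)
  have d': "cmod (complex_of_real s * \<i> * dirac_symbol \<xi> y U / complex_of_real (norm \<xi>)) \<le> real CARD('m) * N"
  proof (cases "\<xi> = 0")
    case False
    then show ?thesis using d s by (auto simp: norm_mult norm_divide divide_le_eq)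
  qed (use N in simp)
  have "cmod (y U + complex_of_real s * \<i> * dirac_symbol \<xi> y U / complex_of_real (norm \<xi>)) \<le> N + real CARD('m) * N"
    by (rule order_trans[OF norm_triangle_ineq add_mono[OF y d']])
  moreover have "0 \<le> N + real CARD('m) * N" using N by simp
  ultimately have "cmod (cl_mult (chi s \<xi>) y U) \<le> N + real CARD('m) * N"
    unfolding cl_mult_chi norm_mult by simp
  then show ?thesis unfolding N_def by (simp add: distrib_right)
qed

lemma cl_mult_e_ker:
  "cl_mult (e_ker x \<xi>) y U = exp (\<i> * complex_of_real (snd x \<bullet> \<xi>)) *
     (of_real (exp (- fst x * norm \<xi>)) * cl_mult (chi 1 \<xi>) y U + of_real (exp (fst x * norm \<xi>)) * cl_mult (chi (-1) \<xi>) y U)"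
proof -
  have "e_ker x \<xi> = (\<lambda>T. exp (\<i> * complex_of_real (snd x \<bullet> \<xi>)) * of_real (exp (- fst x * norm \<xi>)) * chi 1 \<xi> T
     + exp (\<i> * complex_of_real (snd x \<bullet> \<xi>)) * of_real (exp (fst x * norm \<xi>)) * chi (-1) \<xi> T)"
    unfolding e_ker_def e_pm_def by auto
  then show ?thesis by (simp only: cl_mult_left_linear) (simp add: algebra_simps)
qed

lemma cl_norm_L2: "cl_norm y = L2_set (\<lambda>T. cmod (y T)) UNIV"
  by (simp add: cl_norm_def L2_set_def)

lemma cl_norm_ge_component: "cmod (y T) \<le> cl_norm y"
  unfolding cl_norm_L2 by (rule member_le_L2_set) auto

lemma cl_norm_le_sum: "cl_norm y \<le> (\<Sum>T\<in>UNIV. cmod (y T))"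
  unfolding cl_norm_L2 by (rule L2_set_le_sum) auto

lemma cl_norm_nonneg [simp]: "0 \<le> cl_norm y"
  by (simp add: cl_norm_def sum_nonneg)

subsection \<open>Integration by parts against a cutoff\<close>

lemma strip_eq_Times: "strip a = {-a<..<a} \<times> UNIV"
  by (auto simp: strip_def)

lemma directional_derivative:
  fixes F :: "'a::real_normed_vector \<Rightarrow> 'b::real_normed_vector"
  assumes "F differentiable (at (z + h *\<^sub>R v))"
  shows "((\<lambda>h. F (z + h *\<^sub>R v)) has_vector_derivative frechet_derivative F (at (z + h *\<^sub>R v)) v) (at h)"
proof -
  have F: "(F has_derivative frechet_derivative F (at (z + h *\<^sub>R v))) (at (z + h *\<^sub>R v))"
    using assms frechet_derivative_works by blast
  have "((\<lambda>h. z + h *\<^sub>R v) has_derivative (\<lambda>h. h *\<^sub>R v)) (at h)"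
    by (auto intro!: derivative_eq_intros)
  from diff_chain_at[OF this F] show ?thesis
    unfolding has_vector_derivative_def o_def
    using linear_scale[OF has_derivative_linear[OF F]] by simp
qed

text \<open>A box around the ball of radius \<open>R\<close>: differentiation under the integral is
  carried out on boxes, whereas the cutoff is radial.\<close>

definition cube :: "real \<Rightarrow> 'a::euclidean_space set" where
  "cube R = cbox (- (R *\<^sub>R One)) (R *\<^sub>R One)"

lemma in_cube:
  assumes "norm x \<le> R" shows "x \<in> cube R"
proof -
  have "\<bar>x \<bullet> b\<bar> \<le> R" if "b \<in> Basis" for b
    using Basis_le_norm[OF that, of x] assms by simp
  then show ?thesis unfolding cube_def mem_box by (auto simp: abs_le_iff minus_le_iff)
qed

text \<open>A bridge between the Lebesgue integral over the whole space, used for transforms, and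
  the gauge integral over a box, used for Leibniz' rule.\<close>

lemma compact_support_integral:
  fixes u :: "'a::euclidean_space \<Rightarrow> 'b::euclidean_space"
  assumes c: "continuous_on UNIV u" and s: "\<And>x. norm x \<ge> R \<Longrightarrow> u x = 0"
  shows "integrable lborel u" "(\<integral>x. u x \<partial>lborel) = integral (cube R) u"
proof -
  have c': "continuous_on (cube R) u" using c by (rule continuous_on_subset) auto
  have i: "integrable lborel (\<lambda>x. indicator (cube R) x *\<^sub>R u x)"
    unfolding cube_def by (rule borel_integrable_compact) (use c' in \<open>auto simp: cube_def\<close>)
  have e: "(\<lambda>x. indicator (cube R) x *\<^sub>R u x) = u"
  proof
    fix x show "indicator (cube R) x *\<^sub>R u x = u x"
      using s[of x] in_cube[of x R] by (cases "norm x \<le> R") (auto simp: indicator_def)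
  qed
  show "integrable lborel u" using i unfolding e .
  have "set_integrable lborel (cube R) u" unfolding set_integrable_def by (rule i)
  from set_borel_integral_eq_integral(2)[OF this]
  show "(\<integral>x. u x \<partial>lborel) = integral (cube R) u"
    unfolding set_lebesgue_integral_def e .
qed

lemma slice_continuous:
  fixes G :: "real \<times> 'a::euclidean_space \<Rightarrow> complex"
  assumes G: "continuous_on ({-a<..<a} \<times> UNIV) G" and t: "\<bar>t\<bar> < a"
  shows "continuous_on UNIV (\<lambda>x. G (t, x))"
  by (rule continuous_on_compose2[OF G]) (use t in \<open>auto intro!: continuous_intros\<close>)

lemma slice_integral:
  fixes G :: "real \<times> 'a::euclidean_space \<Rightarrow> complex"
  assumes G: "continuous_on ({-a<..<a} \<times> UNIV) G"
    and k: "continuous_on UNIV k" "\<And>x. norm x \<ge> R \<Longrightarrow> k x = 0" and t: "\<bar>t\<bar> < a"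
  shows "integrable lborel (\<lambda>x. k x * G (t, x))"
    and "(\<integral>x. k x * G (t, x) \<partial>lborel) = integral (cube R) (\<lambda>x. k x * G (t, x))"
  by (rule compact_support_integral[of _ R];
      use k slice_continuous[OF G t] in \<open>auto intro!: continuous_intros\<close>)+

lemma slice_integral_continuous:
  fixes G :: "real \<times> 'a::euclidean_space \<Rightarrow> complex"
  assumes G: "continuous_on ({-a<..<a} \<times> UNIV) G"
    and k: "continuous_on UNIV k" "\<And>x. norm x \<ge> R \<Longrightarrow> k x = 0"
  shows "continuous_on {-a<..<a} (\<lambda>t. \<integral>x. k x * G (t, x) \<partial>lborel)"
proof -
  have "continuous_on ({-a<..<a} \<times> cbox (- (R *\<^sub>R One)) (R *\<^sub>R One)) (\<lambda>(t, x). k x * G (t, x))"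
    unfolding case_prod_unfold
    by (intro continuous_on_mult continuous_on_compose2[OF k(1)] continuous_on_compose2[OF G] continuous_intros) auto
  then have "continuous_on {-a<..<a} (\<lambda>t. integral (cube R) (\<lambda>x. k x * G (t, x)))"
    unfolding cube_def by (rule integral_continuous_on_param)
  then show ?thesis
    by (rule continuous_on_eq) (use slice_integral(2)[OF G k] in auto)
qed

text \<open>The factor k confines the integration to a fixed box, so continuity of the derivative is
  enough for Leibniz' rule although the slice itself is unbounded.\<close>

lemma slice_integral_derivative:
  fixes G G' :: "real \<times> 'a::euclidean_space \<Rightarrow> complex"
  assumes G: "continuous_on ({-a<..<a} \<times> UNIV) G" and G': "continuous_on ({-a<..<a} \<times> UNIV) G'"
    and d: "\<And>t x. \<bar>t\<bar> < a \<Longrightarrow> ((\<lambda>t. G (t, x)) has_vector_derivative G' (t, x)) (at t)"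
    and k: "continuous_on UNIV k" "\<And>x. norm x \<ge> R \<Longrightarrow> k x = 0" and t: "\<bar>t\<bar> < a"
  shows "((\<lambda>t. \<integral>x. k x * G (t, x) \<partial>lborel) has_vector_derivative (\<integral>x. k x * G' (t, x) \<partial>lborel)) (at t)"
proof -
  let ?U = "{-a<..<a}"
  have tU: "t \<in> ?U" using t by auto
  have "((\<lambda>t. integral (cbox (- (R *\<^sub>R One)) (R *\<^sub>R One)) (\<lambda>x. k x * G (t, x))) has_vector_derivative
      integral (cbox (- (R *\<^sub>R One)) (R *\<^sub>R One)) (\<lambda>x. k x * G' (t, x))) (at t within ?U)"
  proof (rule leibniz_rule_vector_derivative)
    fix \<tau> x assume "\<tau> \<in> ?U"
    then have "\<bar>\<tau>\<bar> < a" by auto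
    from has_vector_derivative_mult_right[OF d[OF this], of "k x" x]
    show "((\<lambda>\<tau>. k x * G (\<tau>, x)) has_vector_derivative k x * G' (\<tau>, x)) (at \<tau> within ?U)"
      by (rule has_vector_derivative_at_within)
  next
    fix \<tau> assume "\<tau> \<in> ?U"
    then have "\<bar>\<tau>\<bar> < a" by auto
    then show "(\<lambda>x. k x * G (\<tau>, x)) integrable_on cbox (- (R *\<^sub>R One)) (R *\<^sub>R One)"
      by (intro integrable_continuous continuous_on_subset[OF continuous_on_mult[OF k(1) slice_continuous[OF G]]]) auto
  next
    show "continuous_on (?U \<times> cbox (- (R *\<^sub>R One)) (R *\<^sub>R One)) (\<lambda>(\<tau>, x). k x * G' (\<tau>, x))"
      unfolding case_prod_unfold
      by (intro continuous_on_mult continuous_on_compose2[OF k(1)] continuous_on_compose2[OF G'] continuous_intros) auto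
  qed (use tU in auto)
  then have "((\<lambda>t. integral (cube R) (\<lambda>x. k x * G (t, x))) has_vector_derivative (\<integral>x. k x * G' (t, x) \<partial>lborel)) (at t)"
    by (subst slice_integral(2)[OF G' k t]) (use tU in \<open>simp_all add: cube_def at_within_open[OF tU]\<close>)
  then show ?thesis
    by (rule has_vector_derivative_transform_within_open[where S="?U"])
       (use tU slice_integral(2)[OF G k] in auto)
qed

lemma integral_translate:
  fixes u :: "'a::euclidean_space \<Rightarrow> complex"
  assumes [measurable]: "u \<in> borel_measurable borel"
  shows "(\<integral>x. u (y + x) \<partial>lborel) = (\<integral>x. u x \<partial>lborel)"
  by (subst (2) lborel_distr_plus[symmetric, of y]) (simp add: integral_distr)

text \<open>Translation invariance makes the integral of the translates constant; Leibniz' rule identifies its derivative.\<close>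

lemma integral_directional_derivative_0:
  fixes u u' :: "'a::euclidean_space \<Rightarrow> complex"
  assumes c: "continuous_on UNIV u" "continuous_on UNIV u'"
    and s: "\<And>x. norm x \<ge> R \<Longrightarrow> u x = 0" "\<And>x. norm x \<ge> R \<Longrightarrow> u' x = 0"
    and d: "\<And>x h. ((\<lambda>h. u (x + h *\<^sub>R e)) has_vector_derivative u' (x + h *\<^sub>R e)) (at h)"
    and e: "norm e \<le> 1"
  shows "(\<integral>x. u' x \<partial>lborel) = 0"
proof -
  \<comment> \<open>Translates by h e with |h| < 1 and |e| at most 1 stay supported in the ball of
    radius R + 1, hence in this one box.\<close>
  let ?U = "{-1<..<1::real}" and ?B = "cbox (- ((R + 1) *\<^sub>R One)) ((R + 1) *\<^sub>R One) :: 'a set"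
  have ch: "continuous_on UNIV (\<lambda>x. u (x + h *\<^sub>R e))" for h
    by (intro continuous_on_compose2[OF c(1)] continuous_intros) auto
  have "((\<lambda>h. integral ?B (\<lambda>x. u (x + h *\<^sub>R e))) has_vector_derivative integral ?B (\<lambda>x. u' (x + 0 *\<^sub>R e))) (at 0 within ?U)"
  proof (rule leibniz_rule_vector_derivative)
    show "((\<lambda>h. u (x + h *\<^sub>R e)) has_vector_derivative u' (x + h *\<^sub>R e)) (at h within ?U)" for h x
      by (rule has_vector_derivative_at_within[OF d])
    show "(\<lambda>x. u (x + h *\<^sub>R e)) integrable_on ?B" for h
      by (intro integrable_continuous continuous_on_subset[OF ch]) auto
    show "continuous_on (?U \<times> ?B) (\<lambda>(h, x). u' (x + h *\<^sub>R e))"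
      unfolding case_prod_unfold by (intro continuous_on_compose2[OF c(2)] continuous_intros) auto
  qed auto
  then have D: "((\<lambda>h. integral ?B (\<lambda>x. u (x + h *\<^sub>R e))) has_vector_derivative integral ?B u') (at 0)"
    by (subst (asm) at_within_open) auto
  have [measurable]: "u \<in> borel_measurable borel"
    using c(1) by (rule borel_measurable_continuous_onI)
  have const: "integral ?B (\<lambda>x. u (x + h *\<^sub>R e)) = (\<integral>x. u x \<partial>lborel)" if h: "h \<in> ?U" for h
  proof -
    have "u (x + h *\<^sub>R e) = 0" if "norm x \<ge> R + 1" for x
    proof (rule s(1))
      have "norm (h *\<^sub>R e) \<le> 1 * 1" unfolding norm_scaleR using h e by (intro mult_mono) auto
      then show "R \<le> norm (x + h *\<^sub>R e)" using that norm_diff_ineq[of x "h *\<^sub>R e"] by linarith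
    qed
    from compact_support_integral(2)[OF ch this]
    have "integral ?B (\<lambda>x. u (x + h *\<^sub>R e)) = (\<integral>x. u (h *\<^sub>R e + x) \<partial>lborel)"
      unfolding cube_def by (simp add: add.commute)
    then show ?thesis by (simp add: integral_translate)
  qed
  have "((\<lambda>h. integral ?B (\<lambda>x. u (x + h *\<^sub>R e))) has_vector_derivative 0) (at 0)"
    by (rule has_vector_derivative_transform_within_open[where S="?U" and f="\<lambda>_. \<integral>x. u x \<partial>lborel"])
       (use const in auto)
  with D have "integral ?B u' = 0" by (rule vector_derivative_unique_at)
  moreover have "(\<integral>x. u' x \<partial>lborel) = integral ?B u'"
    using compact_support_integral(2)[OF c(2), of "R + 1"] s(2) unfolding cube_def by auto
  ultimately show ?thesis by simp
qed

section \<open>A continuously differentiable cutoff at scale R\<close>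

definition cutoff :: "real \<Rightarrow> 'a::euclidean_space \<Rightarrow> real" where
  "cutoff R x = (max 0 (1 - (norm x)\<^sup>2 / R\<^sup>2))\<^sup>2"

definition cutoff_deriv :: "real \<Rightarrow> 'a::euclidean_space \<Rightarrow> 'a \<Rightarrow> real" where
  "cutoff_deriv R e x = - (4 * max 0 (1 - (norm x)\<^sup>2 / R\<^sup>2) * (x \<bullet> e) / R\<^sup>2)"

text \<open>The reason for squaring in \<open>cutoff\<close>: the positive part has a kink at 0, its
  square is continuously differentiable, which suffices for one integration by parts.\<close>

lemma max_square_derivative: "((\<lambda>s::real. (max 0 s)\<^sup>2) has_real_derivative 2 * max 0 s) (at s)"
proof -
  consider "s > 0" | "s < 0" | "s = 0" by linarith
  then show ?thesis
  proof cases
    case 1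
    have "((\<lambda>s::real. s\<^sup>2) has_real_derivative 2 * max 0 s) (at s)"
      using 1 by (auto intro!: derivative_eq_intros)
    then show ?thesis
      by (rule has_field_derivative_transform_within_open[where S="{0<..}"]) (use 1 in auto)
  next
    case 2
    have "((\<lambda>s::real. 0) has_real_derivative 2 * max 0 s) (at s)"
      using 2 by auto
    then show ?thesis
      by (rule has_field_derivative_transform_within_open[where S="{..<0}"]) (use 2 in auto)
  next
    case 3
    have "((\<lambda>y::real. (max 0 y)\<^sup>2 / y) \<longlongrightarrow> 0) (at 0)"
    proof (rule Lim_null_comparison)
      show "\<forall>\<^sub>F y in at 0. norm ((max 0 y)\<^sup>2 / y) \<le> \<bar>y\<bar>"
        by (intro always_eventually allI) (auto simp: max_def power2_eq_square)
      show "((\<lambda>y::real. \<bar>y\<bar>) \<longlongrightarrow> 0) (at 0)" by (intro tendsto_eq_intros) auto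
    qed
    then show ?thesis using 3 by (simp add: has_field_derivative_iff)
  qed
qed

lemma cutoff_has_derivative:
  fixes x e :: "'a::euclidean_space"
  assumes "R > 0"
  shows "((\<lambda>h. cutoff R (x + h *\<^sub>R e)) has_vector_derivative cutoff_deriv R e (x + h *\<^sub>R e)) (at h)"
proof -
  have eq: "(norm (x + h *\<^sub>R e))\<^sup>2 = x \<bullet> x + 2 * h * (x \<bullet> e) + h\<^sup>2 * (e \<bullet> e)" for h
    unfolding power2_norm_eq_inner by (simp add: inner_add_left inner_add_right inner_commute power2_eq_square algebra_simps)
  have 1: "((\<lambda>h. 1 - (norm (x + h *\<^sub>R e))\<^sup>2 / R\<^sup>2) has_real_derivative - (2 * ((x + h *\<^sub>R e) \<bullet> e) / R\<^sup>2)) (at h)"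
    unfolding eq using assms
    by (auto intro!: derivative_eq_intros simp: inner_add_left field_simps power2_eq_square)
  show ?thesis
    using DERIV_chain2[OF max_square_derivative 1]
    unfolding cutoff_def cutoff_deriv_def has_real_derivative_iff_has_vector_derivative
    by (simp add: field_simps)
qed

lemma cutoff_range: "0 \<le> cutoff R x" "cutoff R x \<le> 1"
  unfolding cutoff_def by (auto intro!: power_le_one)

lemma cutoff_zero: "R > 0 \<Longrightarrow> norm x \<ge> R \<Longrightarrow> cutoff R x = 0"
  unfolding cutoff_def using power_mono[of R "norm x" 2] by (auto simp: field_simps max_def)

lemma cutoff_deriv_zero: "R > 0 \<Longrightarrow> norm x \<ge> R \<Longrightarrow> cutoff_deriv R e x = 0"
  unfolding cutoff_deriv_def using power_mono[of R "norm x" 2] by (auto simp: field_simps max_def)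

lemma continuous_cutoff [continuous_intros]: "R > 0 \<Longrightarrow> continuous_on S (cutoff R)"
  unfolding cutoff_def[abs_def] by (intro continuous_intros) auto

lemma continuous_cutoff_deriv [continuous_intros]: "R > 0 \<Longrightarrow> continuous_on S (cutoff_deriv R e)"
  unfolding cutoff_deriv_def[abs_def] by (intro continuous_intros) auto

lemma cutoff_measurable [measurable]: "cutoff R \<in> borel_measurable borel" "cutoff_deriv R e \<in> borel_measurable borel"
  unfolding cutoff_def[abs_def] cutoff_deriv_def[abs_def] by measurable

text \<open>Inside the ball |x . e| is at most R and the positive part at most 1, which leaves 4 R /
  R^2. This 1/R is the only source of smallness for the error in the evolution equation.\<close>

lemma cutoff_deriv_bound:
  fixes x e :: "'a::euclidean_space"
  assumes R: "R > 0" and e: "norm e \<le> 1"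
  shows "\<bar>cutoff_deriv R e x\<bar> \<le> 4 / R"
proof (cases "norm x \<ge> R")
  case True
  then show ?thesis using R by (simp add: cutoff_deriv_zero)
next
  case False
  have "\<bar>x \<bullet> e\<bar> \<le> norm x * norm e" by (rule Cauchy_Schwarz_ineq2)
  also have "\<dots> \<le> R * 1" using False e R by (intro mult_mono) auto
  finally have "\<bar>x \<bullet> e\<bar> \<le> R" by simp
  then have "max 0 (1 - (norm x)\<^sup>2 / R\<^sup>2) * \<bar>x \<bullet> e\<bar> \<le> 1 * R"
    by (intro mult_mono) auto
  then have "4 * (max 0 (1 - (norm x)\<^sup>2 / R\<^sup>2) * \<bar>x \<bullet> e\<bar>) / R\<^sup>2 \<le> 4 * R / R\<^sup>2"
    by (intro divide_right_mono) auto
  then show ?thesis using R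
    unfolding cutoff_deriv_def by (simp add: abs_mult mult.assoc power2_eq_square)
qed

lemma cutoff_tendsto: "(\<lambda>n. cutoff (real (Suc n)) x) \<longlonglongrightarrow> 1"
proof -
  have "(\<lambda>n. (norm x)\<^sup>2 / (real (Suc n))\<^sup>2) \<longlonglongrightarrow> 0" by real_asymp
  then have "(\<lambda>n. (max 0 (1 - (norm x)\<^sup>2 / (real (Suc n))\<^sup>2))\<^sup>2) \<longlonglongrightarrow> (max 0 (1 - 0))\<^sup>2"
    by (intro tendsto_intros)
  then show ?thesis unfolding cutoff_def by simp
qed

subsection \<open>The evolution equation on the Fourier side\<close>

lemma cl_mult_chi_has_vector_derivative:
  assumes "\<And>T. ((\<lambda>t. y t T) has_vector_derivative y' T) (at t)"
  shows "((\<lambda>t. cl_mult (chi s \<xi>) (y t) U) has_vector_derivative cl_mult (chi s \<xi>) y' U) (at t)"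
  unfolding cl_mult_chi dirac_symbol_def cl_mult_gen
  by (intro has_vector_derivative_mult_right has_vector_derivative_add has_vector_derivative_divide
      has_vector_derivative_sum assms)

section \<open>Truncated slices and their transforms\<close>

locale monogenic_strip =
  fixes a :: real and f :: "real \<times> (real ^ 'm::{finite,linorder}) \<Rightarrow> 'm::{finite,linorder} clif"
  assumes a_pos: "a > 0" and monogenic: "left_monogenic_on (strip a) f"
begin

text \<open>Extending by zero gives a Borel function on the whole product space, as Tonelli and
  measurability of transforms in the height require; f itself is unconstrained outside the
  strip.\<close>

definition F :: "'m set \<Rightarrow> real \<times> (real ^ 'm::{finite,linorder}) \<Rightarrow> complex" where
  "F T z = (if \<bar>fst z\<bar> < a then f z T else 0)"

lemma F_inside: "\<bar>t\<bar> < a \<Longrightarrow> F T (t, x) = f (t, x) T"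
  by (simp add: F_def)

lemma f_differentiable: "\<bar>t\<bar> < a \<Longrightarrow> (\<lambda>z. f z T) differentiable (at (t, x))"
  using monogenic unfolding left_monogenic_on_def strip_def by auto

lemma f_continuous: "continuous_on ({-a<..<a} \<times> UNIV) (\<lambda>z. f z T)"
  by (intro differentiable_imp_continuous_on)
     (auto simp: differentiable_on_def intro!: differentiable_at_withinI f_differentiable)

lemma partial_continuous:
  "continuous_on ({-a<..<a} \<times> UNIV) (\<lambda>z. cl_partial f dir0 z T)"
  "continuous_on ({-a<..<a} \<times> UNIV) (\<lambda>z. cl_partial f (dirj j) z T)"
  using monogenic unfolding left_monogenic_on_def strip_eq_Times by auto

lemma F_measurable [measurable]: "F T \<in> borel_measurable borel"
proof -
  have "F T = (\<lambda>z. indicator (strip a) z *\<^sub>R f z T)"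
    by (auto simp: F_def strip_def indicator_def)
  moreover have "(\<lambda>z. indicator (strip a) z *\<^sub>R f z T) \<in> borel_measurable borel"
    by (rule borel_measurable_continuous_on_indicator) (use f_continuous in \<open>auto simp: strip_eq_Times open_Times\<close>)
  ultimately show ?thesis by simp
qed

lemma F_measurable_pair [measurable (raw)]:
  assumes "g \<in> borel_measurable M" "h \<in> borel_measurable M"
  shows "(\<lambda>x. F T (g x, h x)) \<in> borel_measurable M"
  by (rule measurable_compose[OF borel_measurable_Pair[OF assms] F_measurable])

lemma dirac_equation:
  assumes "\<bar>t\<bar> < a"
  shows "cl_partial f dir0 (t, x) U = - (\<Sum>j\<in>UNIV. cl_mult (cl_e j) (cl_partial f (dirj j) (t, x)) U)"
  using monogenic assms unfolding left_monogenic_on_def strip_def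
  by (simp add: eq_neg_iff_add_eq_0)

lemma f_derivative_time:
  assumes "\<bar>t\<bar> < a"
  shows "((\<lambda>t. f (t, x) T) has_vector_derivative cl_partial f dir0 (t, x) T) (at t)"
  using directional_derivative[of "\<lambda>z. f z T" "(0, x)" t "(1, 0)"] f_differentiable[OF assms]
  by (simp add: cl_partial_def dir0_def)

lemma f_derivative_space:
  assumes "\<bar>t\<bar> < a"
  shows "((\<lambda>h. f (t, x + h *\<^sub>R axis j 1) T) has_vector_derivative cl_partial f (dirj j) (t, x + h *\<^sub>R axis j 1) T) (at h)"
  using directional_derivative[of "\<lambda>z. f z T" "(t, x)" h "(0, axis j 1)"] f_differentiable[OF assms]
  by (simp add: cl_partial_def dirj_def)

text \<open>After truncation every slice is continuous with compact support, so this transform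
  exists at every height, whether or not the slice lies in L^p.\<close>

definition vhat :: "real \<Rightarrow> real \<Rightarrow> real ^ 'm::{finite,linorder} \<Rightarrow> 'm clif" where
  "vhat R t \<xi> T = fourier_int (\<lambda>x. of_real (cutoff R x) * F T (t, x)) \<xi>"

definition rhat :: "real \<Rightarrow> 'm \<Rightarrow> real \<Rightarrow> real ^ 'm::{finite,linorder} \<Rightarrow> 'm clif" where
  "rhat R j t \<xi> T = fourier_int (\<lambda>x. of_real (cutoff_deriv R (axis j 1) x) * F T (t, x)) \<xi>"

text \<open>The transform of f multiplied on the left by the Dirac derivative of the cutoff: what
  truncation adds to the equation.\<close>

definition error_term :: "real \<Rightarrow> real \<Rightarrow> real ^ 'm::{finite,linorder} \<Rightarrow> 'm clif" where
  "error_term R t \<xi> U = (\<Sum>j\<in>UNIV. cl_mult (cl_e j) (rhat R j t \<xi>) U)"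

text \<open>The compactly supported function against which the equation is tested.
  \<open>mode'\<close> keeps the part of its derivative that falls on the cutoff; the part falling
  on the character is a multiple of \<open>mode\<close>.\<close>

definition mode :: "real \<Rightarrow> real ^ 'm::{finite,linorder} \<Rightarrow> real ^ 'm::{finite,linorder} \<Rightarrow> complex" where
  "mode R \<xi> x = exp (- \<i> * complex_of_real (x \<bullet> \<xi>)) * of_real (cutoff R x)"

definition mode' :: "real \<Rightarrow> 'm \<Rightarrow> real ^ 'm::{finite,linorder} \<Rightarrow> real ^ 'm::{finite,linorder} \<Rightarrow> complex" where
  "mode' R j \<xi> x = exp (- \<i> * complex_of_real (x \<bullet> \<xi>)) * of_real (cutoff_deriv R (axis j 1) x)"

lemma mode_continuous: "R > 0 \<Longrightarrow> continuous_on UNIV (mode R \<xi>)" "R > 0 \<Longrightarrow> continuous_on UNIV (mode' R j \<xi>)"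
  unfolding mode_def[abs_def] mode'_def[abs_def] by (intro continuous_intros; simp)+

lemma mode_zero: "R > 0 \<Longrightarrow> norm x \<ge> R \<Longrightarrow> mode R \<xi> x = 0" "R > 0 \<Longrightarrow> norm x \<ge> R \<Longrightarrow> mode' R j \<xi> x = 0"
  by (simp_all add: mode_def mode'_def cutoff_zero cutoff_deriv_zero)

lemma vhat_eq: "\<bar>t\<bar> < a \<Longrightarrow> vhat R t \<xi> T = (\<integral>x. mode R \<xi> x * f (t, x) T \<partial>lborel)"
  unfolding vhat_def fourier_int_def mode_def by (simp add: F_inside mult.assoc)

lemma rhat_eq: "\<bar>t\<bar> < a \<Longrightarrow> rhat R j t \<xi> T = (\<integral>x. mode' R j \<xi> x * f (t, x) T \<partial>lborel)"
  unfolding rhat_def fourier_int_def mode'_def by (simp add: F_inside mult.assoc)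

lemma mode_derivative:
  assumes "R > 0"
  shows "((\<lambda>h. mode R \<xi> (x + h *\<^sub>R axis j 1)) has_vector_derivative
     (mode' R j \<xi> (x + h *\<^sub>R axis j 1) - \<i> * of_real (\<xi> $ j) * mode R \<xi> (x + h *\<^sub>R axis j 1))) (at h)"
proof -
  have e: "((x :: real ^ 'm::{finite,linorder}) + h *\<^sub>R axis j 1) \<bullet> \<xi> = x \<bullet> \<xi> + h * \<xi> $ j" for h
    by (simp add: inner_add_left inner_axis' )
  have 1: "((\<lambda>h. exp (- \<i> * complex_of_real ((x + h *\<^sub>R axis j 1) \<bullet> \<xi>))) has_vector_derivative
     - \<i> * of_real (\<xi> $ j) * exp (- \<i> * complex_of_real ((x + h *\<^sub>R axis j 1) \<bullet> \<xi>))) (at h)"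
  proof -
    have "((\<lambda>h. complex_of_real h) has_vector_derivative 1) (at h)"
      using has_vector_derivative_of_real[of "\<lambda>h. h" 1 "at h"] by (simp add: has_vector_derivative_def has_derivative_ident)
    then have "((\<lambda>h. - \<i> * (complex_of_real (x \<bullet> \<xi>) + of_real h * of_real (\<xi> $ j))) has_vector_derivative - \<i> * (0 + 1 * of_real (\<xi> $ j))) (at h)"
      by (intro has_vector_derivative_mult_right has_vector_derivative_add has_vector_derivative_const has_vector_derivative_mult_left)
    from field_vector_diff_chain_at[OF this DERIV_exp] show ?thesis
      unfolding e by (simp add: o_def mult_ac)
  qed
  have 2: "((\<lambda>h. complex_of_real (cutoff R (x + h *\<^sub>R axis j 1))) has_vector_derivative
     of_real (cutoff_deriv R (axis j 1) (x + h *\<^sub>R axis j 1))) (at h)"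
    by (rule has_vector_derivative_of_real)
       (use cutoff_has_derivative[OF assms] in \<open>simp add: has_real_derivative_iff_has_vector_derivative\<close>)
  from has_vector_derivative_mult[OF 1 2] show ?thesis
    unfolding mode_def mode'_def by (simp add: algebra_simps)
qed

text \<open>The j-th derivative of mode times f integrates to 0. Of its three terms, the one from
  the character carries -i \<xi>_j and the one from the cutoff is \<open>rhat\<close>.\<close>

lemma integration_by_parts:
  assumes R: "R > 0" and t: "\<bar>t\<bar> < a"
  shows "(\<integral>x. mode R \<xi> x * cl_partial f (dirj j) (t, x) T \<partial>lborel) = \<i> * of_real (\<xi> $ j) * vhat R t \<xi> T - rhat R j t \<xi> T"
proof -
  note i1 = slice_integral(1)[OF f_continuous mode_continuous(1)[OF R] mode_zero(1)[OF R] t]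
  note i2 = slice_integral(1)[OF f_continuous mode_continuous(2)[OF R] mode_zero(2)[OF R] t]
  note i3 = slice_integral(1)[OF partial_continuous(2) mode_continuous(1)[OF R] mode_zero(1)[OF R] t]
  define u where "u x = mode R \<xi> x * f (t, x) T" for x
  define u' where "u' x = mode R \<xi> x * cl_partial f (dirj j) (t, x) T + (mode' R j \<xi> x - \<i> * of_real (\<xi> $ j) * mode R \<xi> x) * f (t, x) T" for x
  have "(\<integral>x. u' x \<partial>lborel) = 0"
  proof (rule integral_directional_derivative_0[where u=u and R=R and e="axis j 1"])
    show "continuous_on UNIV u" "continuous_on UNIV u'"
      unfolding u_def u'_def
      by (intro continuous_intros mode_continuous[OF R] slice_continuous[OF f_continuous t] slice_continuous[OF partial_continuous(2) t])+
    show "\<And>x. norm x \<ge> R \<Longrightarrow> u x = 0" "\<And>x. norm x \<ge> R \<Longrightarrow> u' x = 0"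
      using mode_zero[OF R] by (auto simp: u_def u'_def)
    show "((\<lambda>h. u (x + h *\<^sub>R axis j 1)) has_vector_derivative u' (x + h *\<^sub>R axis j 1)) (at h)" for x h
      unfolding u_def u'_def by (rule has_vector_derivative_mult[OF mode_derivative[OF R] f_derivative_space[OF t]])
  qed simp
  also have "(\<integral>x. u' x \<partial>lborel) = (\<integral>x. mode R \<xi> x * cl_partial f (dirj j) (t, x) T \<partial>lborel)
     + (\<integral>x. mode' R j \<xi> x * f (t, x) T - \<i> * of_real (\<xi> $ j) * (mode R \<xi> x * f (t, x) T) \<partial>lborel)"
    unfolding u'_def left_diff_distrib mult.assoc
    by (rule Bochner_Integration.integral_add)
       (use i1 i2 i3 in \<open>auto intro!: Bochner_Integration.integrable_diff simp: mult.assoc\<close>)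
  also have "(\<integral>x. mode' R j \<xi> x * f (t, x) T - \<i> * of_real (\<xi> $ j) * (mode R \<xi> x * f (t, x) T) \<partial>lborel)
     = rhat R j t \<xi> T - \<i> * of_real (\<xi> $ j) * vhat R t \<xi> T"
    unfolding vhat_eq[OF t] rhat_eq[OF t] using i1 i2
    by (subst Bochner_Integration.integral_diff) auto
  finally show ?thesis by (simp add: algebra_simps add_eq_0_iff)
qed

text \<open>The time derivative is replaced by space derivatives through the Dirac equation, and
  these are removed by parts: v' = -i \<xi> v plus the truncation error.\<close>

lemma vhat_derivative:
  assumes R: "R > 0" and t: "\<bar>t\<bar> < a"
  shows "((\<lambda>t. vhat R t \<xi> U) has_vector_derivative
     (- \<i> * dirac_symbol \<xi> (vhat R t \<xi>) U + error_term R t \<xi> U)) (at t)"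
proof -
  note i3 = slice_integral(1)[OF partial_continuous(2) mode_continuous(1)[OF R] mode_zero(1)[OF R] t]
  have "((\<lambda>t. \<integral>x. mode R \<xi> x * f (t, x) U \<partial>lborel) has_vector_derivative
      (\<integral>x. mode R \<xi> x * cl_partial f dir0 (t, x) U \<partial>lborel)) (at t)"
    by (rule slice_integral_derivative[OF f_continuous partial_continuous(1) _ mode_continuous(1)[OF R] mode_zero(1)[OF R] t])
       (rule f_derivative_time)
  then have 1: "((\<lambda>t. vhat R t \<xi> U) has_vector_derivative (\<integral>x. mode R \<xi> x * cl_partial f dir0 (t, x) U \<partial>lborel)) (at t)"
    by (rule has_vector_derivative_transform_within_open[where S="{-a<..<a}"]) (use t in \<open>auto simp: vhat_eq\<close>)
  have "(\<integral>x. mode R \<xi> x * cl_partial f dir0 (t, x) U \<partial>lborel)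
     = (\<integral>x. (\<Sum>j\<in>UNIV. - gen_sign j U * (mode R \<xi> x * cl_partial f (dirj j) (t, x) (sym_diff {j} U))) \<partial>lborel)"
    unfolding dirac_equation[OF t] cl_mult_gen
    by (intro Bochner_Integration.integral_cong) (auto simp: sum_distrib_left sum_negf mult_ac)
  also have "\<dots> = (\<Sum>j\<in>UNIV. - gen_sign j U * (\<integral>x. mode R \<xi> x * cl_partial f (dirj j) (t, x) (sym_diff {j} U) \<partial>lborel))"
    using i3 by (subst Bochner_Integration.integral_sum) auto
  also have "\<dots> = - \<i> * dirac_symbol \<xi> (vhat R t \<xi>) U + error_term R t \<xi> U"
    unfolding integration_by_parts[OF R t] dirac_symbol_def error_term_def cl_mult_gen sum_distrib_left sum.distrib[symmetric]
    by (intro sum.cong) (auto simp: algebra_simps)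
  finally show ?thesis using 1 by simp
qed

text \<open>An integrating factor. The projection onto sign s turns the equation into a scalar one
  with rate -s|\<xi>|, and the factor e^(s t |\<xi>|) leaves only the error.\<close>

lemma propagated_derivative:
  assumes R: "R > 0" and t: "\<bar>t\<bar> < a" and s: "s = 1 \<or> s = - 1"
  shows "((\<lambda>t. of_real (exp (s * t * norm \<xi>)) * cl_mult (chi s \<xi>) (vhat R t \<xi>) U) has_vector_derivative
     of_real (exp (s * t * norm \<xi>)) * cl_mult (chi s \<xi>) (error_term R t \<xi>) U) (at t)"
proof -
  have 1: "((\<lambda>t. cl_mult (chi s \<xi>) (vhat R t \<xi>) U) has_vector_derivative
     cl_mult (chi s \<xi>) (\<lambda>U. - \<i> * dirac_symbol \<xi> (vhat R t \<xi>) U + 1 * error_term R t \<xi> U) U) (at t)"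
    by (rule cl_mult_chi_has_vector_derivative) (use vhat_derivative[OF R t] in simp)
  have 2: "cl_mult (chi s \<xi>) (\<lambda>U. - \<i> * dirac_symbol \<xi> (vhat R t \<xi>) U + 1 * error_term R t \<xi> U) U
     = - of_real (s * norm \<xi>) * cl_mult (chi s \<xi>) (vhat R t \<xi>) U + cl_mult (chi s \<xi>) (error_term R t \<xi>) U"
    unfolding cl_mult_chi_linear using dirac_symbol_chi[OF s, of \<xi> "vhat R t \<xi>" U] by simp
  have "((\<lambda>t. exp (s * t * norm \<xi>)) has_real_derivative s * norm \<xi> * exp (s * t * norm \<xi>)) (at t)"
    by (auto intro!: derivative_eq_intros)
  then have 3: "((\<lambda>t. complex_of_real (exp (s * t * norm \<xi>))) has_vector_derivative of_real (s * norm \<xi> * exp (s * t * norm \<xi>))) (at t)"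
    by (intro has_vector_derivative_of_real) (simp add: has_real_derivative_iff_has_vector_derivative)
  from has_vector_derivative_mult[OF 3 1] show ?thesis
    unfolding 2 by (simp add: algebra_simps)
qed

lemma rhat_continuous: "R > 0 \<Longrightarrow> continuous_on {-a<..<a} (\<lambda>t. rhat R j t \<xi> T)"
  using slice_integral_continuous[OF f_continuous mode_continuous(2) mode_zero(2), of R R j \<xi> T]
  by (rule continuous_on_eq) (auto simp: rhat_eq)

lemma error_term_continuous: "R > 0 \<Longrightarrow> continuous_on {-a<..<a} (\<lambda>t. cl_mult (chi s \<xi>) (error_term R t \<xi>) U)"
  unfolding cl_mult_chi dirac_symbol_def error_term_def cl_mult_gen divide_inverse
  by (intro continuous_on_mult continuous_on_add continuous_on_sum continuous_on_const rhat_continuous)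

definition error_size :: "real \<Rightarrow> real \<Rightarrow> real ^ 'm::{finite,linorder} \<Rightarrow> real" where
  "error_size R t \<xi> = (\<Sum>j\<in>UNIV. \<Sum>T\<in>UNIV. cmod (rhat R j t \<xi> T))"

lemma error_size_nonneg: "0 \<le> error_size R t \<xi>"
  by (auto simp: error_size_def intro!: sum_nonneg)

text \<open>The factor 1 + m bounds the projections, and \<open>CARD('m set)\<close> = 2^m counts
  the Clifford components summed over.\<close>

definition Kc :: real where "Kc = (1 + real CARD('m)) * real CARD('m set)"

lemma Kc_nonneg: "0 \<le> Kc" by (simp add: Kc_def)

lemma error_term_bound:
  assumes s: "s = 1 \<or> s = - 1" and t: "\<bar>t\<bar> < a"
  shows "cmod (of_real (exp (s * t * norm \<xi>)) * cl_mult (chi s \<xi>) (error_term R t \<xi>) U)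
     \<le> Kc * exp (a * norm \<xi>) * error_size R t \<xi>"
proof -
  have "cmod (error_term R t \<xi> V) \<le> error_size R t \<xi>" for V
    unfolding error_term_def error_size_def by (intro order_trans[OF norm_sum sum_mono] cl_mult_gen_norm)
  then have "(\<Sum>V\<in>(UNIV::'m set set). cmod (error_term R t \<xi> V)) \<le> real CARD('m set) * error_size R t \<xi>"
    by (intro sum_bounded_above) auto
  then have "(1 + real CARD('m)) * (\<Sum>V\<in>UNIV. cmod (error_term R t \<xi> V)) \<le> Kc * error_size R t \<xi>"
    unfolding Kc_def mult.assoc by (intro mult_left_mono) auto
  with cl_mult_chi_norm[OF s, of \<xi> "error_term R t \<xi>" U]
  have 1: "cmod (cl_mult (chi s \<xi>) (error_term R t \<xi>) U) \<le> Kc * error_size R t \<xi>" by linarith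
  have "s * t \<le> a" using s t by auto
  then have "exp (s * t * norm \<xi>) \<le> exp (a * norm \<xi>)" by (simp add: mult_right_mono)
  then have "exp (s * t * norm \<xi>) * cmod (cl_mult (chi s \<xi>) (error_term R t \<xi>) U) \<le> exp (a * norm \<xi>) * (Kc * error_size R t \<xi>)"
    using 1 by (intro mult_mono) auto
  then show ?thesis by (simp add: norm_mult mult_ac)
qed

text \<open>The fundamental theorem of calculus for the propagated projection. The bound is enlarged
  to the whole interval (-a, a), so that one function of \<xi> and R controls all pairs of heights,
  both signs and all components.\<close>

lemma propagated_difference_le:
  assumes R: "R > 0" and c: "\<bar>c\<bar> < a" and t: "\<bar>t\<bar> < a" and le: "c \<le> t" and s: "s = 1 \<or> s = - 1"
  shows "ennreal (cmod (of_real (exp (s * t * norm \<xi>)) * cl_mult (chi s \<xi>) (vhat R t \<xi>) U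
      - of_real (exp (s * c * norm \<xi>)) * cl_mult (chi s \<xi>) (vhat R c \<xi>) U))
    \<le> (\<integral>\<^sup>+\<tau>. ennreal (Kc * exp (a * norm \<xi>) * error_size R \<tau> \<xi>) * indicator {-a<..<a} \<tau> \<partial>lborel)"
proof -
  define G where "G \<tau> = of_real (exp (s * \<tau> * norm \<xi>)) * cl_mult (chi s \<xi>) (error_term R \<tau> \<xi>) U" for \<tau>
  have sub: "{c..t} \<subseteq> {-a<..<a}" using c t by auto
  have G: "continuous_on {c..t} G"
    unfolding G_def by (intro continuous_intros continuous_on_subset[OF error_term_continuous[OF R] sub])
  have int: "(G has_integral (of_real (exp (s * t * norm \<xi>)) * cl_mult (chi s \<xi>) (vhat R t \<xi>) U
      - of_real (exp (s * c * norm \<xi>)) * cl_mult (chi s \<xi>) (vhat R c \<xi>) U)) {c..t}"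
    unfolding G_def
  proof (rule fundamental_theorem_of_calculus[OF le])
    fix \<tau> assume "\<tau> \<in> {c..t}"
    then have "\<bar>\<tau>\<bar> < a" using c t by auto
    from propagated_derivative[OF R this s]
    show "((\<lambda>t. of_real (exp (s * t * norm \<xi>)) * cl_mult (chi s \<xi>) (vhat R t \<xi>) U) has_vector_derivative
     of_real (exp (s * \<tau> * norm \<xi>)) * cl_mult (chi s \<xi>) (error_term R \<tau> \<xi>) U) (at \<tau> within {c..t})"
      by (rule has_vector_derivative_at_within)
  qed
  have nG: "(\<lambda>\<tau>. cmod (G \<tau>)) integrable_on {c..t}"
    using G by (intro integrable_continuous_real continuous_intros)
  have "cmod (of_real (exp (s * t * norm \<xi>)) * cl_mult (chi s \<xi>) (vhat R t \<xi>) U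
      - of_real (exp (s * c * norm \<xi>)) * cl_mult (chi s \<xi>) (vhat R c \<xi>) U) \<le> integral {c..t} (\<lambda>\<tau>. cmod (G \<tau>))"
    unfolding integral_unique[OF int, symmetric]
    by (rule Henstock_Kurzweil_Integration.integral_norm_bound_integral) (use int nG in auto)
  then have "ennreal (cmod (of_real (exp (s * t * norm \<xi>)) * cl_mult (chi s \<xi>) (vhat R t \<xi>) U
      - of_real (exp (s * c * norm \<xi>)) * cl_mult (chi s \<xi>) (vhat R c \<xi>) U)) \<le> ennreal (integral {c..t} (\<lambda>\<tau>. cmod (G \<tau>)))"
    by (rule ennreal_leI)
  also have "\<dots> = (\<integral>\<^sup>+\<tau>. ennreal (cmod (G \<tau>)) * indicator {c..t} \<tau> \<partial>lborel)"
    by (rule nn_integral_has_integral_lebesgue'[symmetric]) (use nG in auto)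
  also have "\<dots> \<le> (\<integral>\<^sup>+\<tau>. ennreal (Kc * exp (a * norm \<xi>) * error_size R \<tau> \<xi>) * indicator {-a<..<a} \<tau> \<partial>lborel)"
  proof (rule nn_integral_mono)
    fix \<tau>
    show "ennreal (cmod (G \<tau>)) * indicator {c..t} \<tau> \<le> ennreal (Kc * exp (a * norm \<xi>) * error_size R \<tau> \<xi>) * indicator {-a<..<a} \<tau>"
    proof (cases "\<tau> \<in> {c..t}")
      case True
      then have "\<tau> \<in> {-a<..<a}" using sub by auto
      then show ?thesis using error_term_bound[OF s, of \<tau> \<xi> R U] True unfolding G_def by (auto intro!: ennreal_leI)
    qed simp
  qed
  finally show ?thesis .
qed

lemma propagated_difference:
  assumes R: "R > 0" and c: "\<bar>c\<bar> < a" and t: "\<bar>t\<bar> < a" and s: "s = 1 \<or> s = - 1"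
  shows "ennreal (cmod (of_real (exp (s * t * norm \<xi>)) * cl_mult (chi s \<xi>) (vhat R t \<xi>) U
      - of_real (exp (s * c * norm \<xi>)) * cl_mult (chi s \<xi>) (vhat R c \<xi>) U))
    \<le> (\<integral>\<^sup>+\<tau>. ennreal (Kc * exp (a * norm \<xi>) * error_size R \<tau> \<xi>) * indicator {-a<..<a} \<tau> \<partial>lborel)"
proof (cases "c \<le> t")
  case True
  then show ?thesis by (rule propagated_difference_le[OF R c t _ s])
next
  case False
  then show ?thesis
    using propagated_difference_le[OF R t c _ s, of \<xi> U] by (simp add: norm_minus_commute)
qed

end

subsection \<open>Slices of a monogenic function\<close>

lemma ennreal_tendsto_0I:
  fixes X :: "nat \<Rightarrow> ennreal"
  assumes "\<And>n. X n \<le> ennreal (b n)" "b \<longlonglongrightarrow> 0"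
  shows "X \<longlonglongrightarrow> 0"
proof (rule tendsto_sandwich[OF _ _ tendsto_const])
  show "(\<lambda>n. ennreal (b n)) \<longlonglongrightarrow> 0" using tendsto_ennrealI[OF assms(2)] by simp
qed (use assms in auto)

text \<open>An almost everywhere convergent subsequence supplies the candidate, and Fatou along that
  subsequence shows that the whole sequence converges to it in L^1.\<close>

lemma L1_complete:
  fixes s :: "nat \<Rightarrow> 'a \<Rightarrow> complex"
  assumes s: "\<And>n. integrable M (s n)"
    and cauchy: "\<And>e. e > 0 \<Longrightarrow> \<exists>N. \<forall>i\<ge>N. \<forall>j\<ge>N. (\<integral>\<^sup>+x. ennreal (cmod (s i x - s j x)) \<partial>M) < ennreal e"
  obtains l where "l \<in> borel_measurable M" "(\<lambda>n. \<integral>\<^sup>+x. ennreal (cmod (s n x - l x)) \<partial>M) \<longlonglongrightarrow> 0"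
proof -
  have [measurable]: "s n \<in> borel_measurable M" for n using s by auto
  have eq: "(\<integral>\<^sup>+x. ennreal (cmod (s i x - s j x)) \<partial>M) = ennreal (LINT x|M. norm (s i x - s j x))" for i j
    using s by (intro nn_integral_eq_integral) auto
  obtain r where r: "strict_mono r" "AE x in M. Cauchy (\<lambda>i. s (r i) x)"
  proof (rule cauchy_L1_AE_cauchy_subseq[of M s])
    fix e :: real assume e: "e > 0"
    then obtain N where "\<forall>i\<ge>N. \<forall>j\<ge>N. (\<integral>\<^sup>+x. ennreal (cmod (s i x - s j x)) \<partial>M) < ennreal e"
      using cauchy by blast
    then show "\<exists>N. \<forall>i\<ge>N. \<forall>j\<ge>N. LINT x|M. norm (s i x - s j x) < e"
      unfolding eq using e by (auto simp: ennreal_less_iff)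
  qed (use s in auto)
  \<comment> \<open>\<open>lim\<close> makes the candidate a measurable function defined everywhere;
    its value matters only where the subsequence converges.\<close>
  define l where "l x = lim (\<lambda>i. s (r i) x)" for x
  have [measurable]: "l \<in> borel_measurable M" unfolding l_def by measurable
  have lim: "AE x in M. (\<lambda>i. s (r i) x) \<longlonglongrightarrow> l x"
    using r(2) by eventually_elim (auto simp: l_def Cauchy_convergent_iff convergent_LIMSEQ_iff)
  have "(\<lambda>n. \<integral>\<^sup>+x. ennreal (cmod (s n x - l x)) \<partial>M) \<longlonglongrightarrow> 0"
  proof (rule tendsto_zero_ennreal)
    fix e :: real assume e: "e > 0"
    obtain N where N: "\<And>i j. i \<ge> N \<Longrightarrow> j \<ge> N \<Longrightarrow> (\<integral>\<^sup>+x. ennreal (cmod (s i x - s j x)) \<partial>M) < ennreal (e / 2)"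
      using cauchy[of "e / 2"] e by auto
    have "(\<integral>\<^sup>+x. ennreal (cmod (s n x - l x)) \<partial>M) < ennreal e" if n: "n \<ge> N" for n
    proof -
      have "(\<integral>\<^sup>+x. ennreal (cmod (s n x - l x)) \<partial>M) = (\<integral>\<^sup>+x. liminf (\<lambda>i. ennreal (cmod (s n x - s (r i) x))) \<partial>M)"
      proof (rule nn_integral_cong_AE)
        show "AE x in M. ennreal (cmod (s n x - l x)) = liminf (\<lambda>i. ennreal (cmod (s n x - s (r i) x)))"
          using lim
        proof eventually_elim
          case (elim x)
          then have "(\<lambda>i. ennreal (cmod (s n x - s (r i) x))) \<longlonglongrightarrow> ennreal (cmod (s n x - l x))"
            by (intro tendsto_ennrealI tendsto_intros)
          then show ?case using lim_imp_Liminf[OF sequentially_bot] by fastforce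
        qed
      qed
      also have "\<dots> \<le> liminf (\<lambda>i. \<integral>\<^sup>+x. ennreal (cmod (s n x - s (r i) x)) \<partial>M)"
        by (rule nn_integral_liminf) measurable
      also have "\<dots> \<le> ennreal (e / 2)"
      proof (rule Liminf_le)
        show "\<forall>\<^sub>F i in sequentially. (\<integral>\<^sup>+x. ennreal (cmod (s n x - s (r i) x)) \<partial>M) \<le> ennreal (e / 2)"
          unfolding eventually_sequentially
        proof (intro exI[of _ N] allI impI)
          fix i assume "i \<ge> N"
          then have "r i \<ge> N" using seq_suble[OF r(1), of i] by simp
          from N[OF n this] show "(\<integral>\<^sup>+x. ennreal (cmod (s n x - s (r i) x)) \<partial>M) \<le> ennreal (e / 2)"
            by simp
        qed
      qed simp
      also have "\<dots> < ennreal e" using e by (simp add: ennreal_less_iff)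
      finally show ?thesis .
    qed
    then show "\<forall>\<^sub>F n in sequentially. (\<integral>\<^sup>+x. ennreal (cmod (s n x - l x)) \<partial>M) < ennreal e"
      unfolding eventually_sequentially by auto
  qed
  then show thesis using that \<open>l \<in> borel_measurable M\<close> by blast
qed

lemma nn_integral_tendsto_0_AE_subseq:
  fixes \<phi> :: "nat \<Rightarrow> 'a \<Rightarrow> real"
  assumes [measurable]: "\<And>n. \<phi> n \<in> borel_measurable M" and nn: "\<And>n x. 0 \<le> \<phi> n x"
    and lim: "(\<lambda>n. \<integral>\<^sup>+x. ennreal (\<phi> n x) \<partial>M) \<longlonglongrightarrow> 0"
  obtains r where "strict_mono (r :: nat \<Rightarrow> nat)" "AE x in M. (\<lambda>n. \<phi> (r n) x) \<longlonglongrightarrow> 0"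
proof -
  have "\<forall>\<^sub>F n in sequentially. (\<integral>\<^sup>+x. ennreal (\<phi> n x) \<partial>M) < 1"
    using order_tendstoD(2)[OF lim, of 1] by simp
  then obtain N where N: "\<And>n. n \<ge> N \<Longrightarrow> (\<integral>\<^sup>+x. ennreal (\<phi> n x) \<partial>M) < 1"
    unfolding eventually_sequentially by blast
  \<comment> \<open>Finitely many integrals may be infinite; past the index N all are below 1, so
    the shifted functions are integrable.\<close>
  define \<psi> where "\<psi> n = \<phi> (n + N)" for n
  have i: "integrable M (\<psi> n)" for n
    unfolding \<psi>_def using N[of "n + N"] nn by (intro integrableI_nonneg) (auto intro: less_trans)
  have eq: "ennreal (\<integral>x. norm (\<psi> n x) \<partial>M) = (\<integral>\<^sup>+x. ennreal (\<phi> (n + N) x) \<partial>M)" for n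
    using nn_integral_eq_integral[OF i[of n]] nn by (simp add: \<psi>_def)
  have "(\<lambda>n. ennreal (\<integral>x. norm (\<psi> n x) \<partial>M)) \<longlonglongrightarrow> ennreal 0"
    unfolding eq using LIMSEQ_ignore_initial_segment[OF lim, of N] by simp
  then have "(\<lambda>n. \<integral>x. norm (\<psi> n x) \<partial>M) \<longlonglongrightarrow> 0"
    by (subst (asm) tendsto_ennreal_iff) (auto intro!: always_eventually)
  from tendsto_L1_AE_subseq[OF i this] obtain r :: "nat \<Rightarrow> nat"
    where r: "strict_mono r" "AE x in M. (\<lambda>n. \<psi> (r n) x) \<longlonglongrightarrow> 0" by blast
  show thesis
    by (rule that[of "\<lambda>n. r n + N"]) (use r in \<open>auto simp: \<psi>_def strict_mono_def\<close>)
qed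

lemma cl_mult_chi_measurable:
  assumes [measurable]: "\<And>T. (\<lambda>\<xi>. y \<xi> T) \<in> borel_measurable borel"
  shows "(\<lambda>\<xi> :: real ^ 'm::{finite,linorder}. cl_mult (chi s \<xi>) (y \<xi>) U) \<in> borel_measurable borel"
  unfolding cl_mult_chi dirac_symbol_def cl_mult_gen by measurable

lemma cl_norm_measurable [measurable (raw)]:
  assumes [measurable]: "\<And>T. (\<lambda>x. y x T) \<in> borel_measurable M"
  shows "(\<lambda>x. cl_norm (y x)) \<in> borel_measurable M"
  unfolding cl_norm_def by measurable

section \<open>Good heights and the limit of the truncated transforms\<close>

locale monogenic_Ap = monogenic_strip a f
  for a :: real and f :: "real \<times> (real ^ 'm::{finite,linorder}) \<Rightarrow> 'm::{finite,linorder} clif" +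
  fixes p :: real
  assumes p: "1 \<le> p" "p \<le> 2" and Ap_finite: "Ap_int a p f < \<infinity>"
begin

text \<open>The p-th power of the L^p norm of a slice, kept extended-valued because nothing excludes
  infinite values at exceptional heights.\<close>

definition N :: "real \<Rightarrow> ennreal" where
  "N t = (\<integral>\<^sup>+x. ennreal (cl_norm (\<lambda>T. F T (t, x)) powr p) \<partial>lborel)"

definition good :: "real \<Rightarrow> bool" where "good t \<longleftrightarrow> \<bar>t\<bar> < a \<and> N t < \<infinity>"

lemma N_measurable [measurable]: "N \<in> borel_measurable borel"
  unfolding N_def[abs_def] by measurable

lemma N_outside: "\<not> \<bar>t\<bar> < a \<Longrightarrow> N t = 0"
  unfolding N_def F_def using p by (simp add: cl_norm_def)

lemma Ap_int_eq: "Ap_int a p f = (\<integral>\<^sup>+t. N t \<partial>lborel)"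
proof -
  have "Ap_int a p f = (\<integral>\<^sup>+z. ennreal (cl_norm (\<lambda>T. F T z) powr p) \<partial>lborel)"
    unfolding Ap_int_def
    by (intro nn_integral_cong) (use p in \<open>auto simp: F_def strip_def indicator_def cl_norm_def\<close>)
  also have "\<dots> = (\<integral>\<^sup>+z. ennreal (cl_norm (\<lambda>T. F T z) powr p) \<partial>(lborel \<Otimes>\<^sub>M lborel))"
    by (simp add: lborel_prod)
  also have "\<dots> = (\<integral>\<^sup>+t. N t \<partial>lborel)"
    unfolding N_def by (rule lborel.nn_integral_fst[symmetric]) (simp add: lborel_prod)
  finally show ?thesis .
qed

lemma AE_good: "AE t in lborel. \<bar>t\<bar> < a \<longrightarrow> good t"
proof -
  have "AE t in lborel. N t \<noteq> \<infinity>"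
    by (rule nn_integral_noteq_infinite) (use Ap_finite in \<open>auto simp: Ap_int_eq\<close>)
  then show ?thesis by eventually_elim (auto simp: good_def top.not_eq_extremum)
qed

text \<open>A set of full measure is dense. This provides the base height c, heights arbitrarily
  near the boundary, and sequences of good heights converging to a given one.\<close>

lemma good_between:
  assumes "u < w" "- a \<le> u" "w \<le> a"
  obtains t where "u < t" "t < w" "good t"
proof -
  have "\<exists>t\<in>{u<..<w}. good t"
  proof (rule ccontr)
    assume "\<not> ?thesis"
    then have "\<forall>t\<in>{u<..<w}. \<bar>t\<bar> < a \<and> \<not> good t" using assms by auto
    with AE_good have "AE t in lborel. t \<notin> {u<..<w}" by (auto elim!: eventually_mono)
    then have "emeasure lborel {u<..<w} = 0"
      by (subst (asm) AE_iff_measurable[of "{u<..<w}"]) auto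
    then show False using assms by simp
  qed
  then show thesis using that by auto
qed

lemma component_power_le: "(\<integral>\<^sup>+x. ennreal (cmod (F T (t, x)) powr p) \<partial>lborel) \<le> N t"
  unfolding N_def using p
  by (intro nn_integral_mono ennreal_leI powr_mono2 cl_norm_ge_component[of "\<lambda>T. F T (t, x)" T for x]) auto

lemma slice_integrable:
  assumes R: "R > 0" and t: "\<bar>t\<bar> < a"
  shows "integrable lborel (\<lambda>x. of_real (cutoff R x) * F T (t, x))"
    and "integrable lborel (\<lambda>x. of_real (cutoff_deriv R (axis j 1) x) * F T (t, x))"
proof -
  have 1: "integrable lborel (\<lambda>x. of_real (cutoff R x) * f (t, x) T)"
    by (rule slice_integral(1)[OF f_continuous _ _ t, of _ R])
       (use R in \<open>auto simp: cutoff_zero intro!: continuous_intros\<close>)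
  have 2: "integrable lborel (\<lambda>x. of_real (cutoff_deriv R (axis j 1) x) * f (t, x) T)"
    by (rule slice_integral(1)[OF f_continuous _ _ t, of _ R])
       (use R in \<open>auto simp: cutoff_deriv_zero intro!: continuous_intros\<close>)
  show "integrable lborel (\<lambda>x. of_real (cutoff R x) * F T (t, x))"
    "integrable lborel (\<lambda>x. of_real (cutoff_deriv R (axis j 1) x) * F T (t, x))"
    using 1 2 t by (simp_all add: F_inside)
qed

lemma vhat_measurable [measurable]: "(\<lambda>\<xi>. vhat R t \<xi> T) \<in> borel_measurable borel"
  unfolding vhat_def by measurable

text \<open>The weight has exponent a + 1: a part e^(-a|\<xi>|) cancels the growth of the
  propagation factor, and the remaining e^(-|\<xi>|) is what the weighted bound for transforms
  needs.\<close>

definition error_total :: "real \<Rightarrow> ennreal" where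
  "error_total R = (\<integral>\<^sup>+\<xi>. (\<integral>\<^sup>+\<tau>. ennreal (Kc * exp (a * norm (\<xi> :: real ^ 'm::{finite,linorder})) * error_size R \<tau> \<xi>) * indicator {-a<..<a} \<tau> \<partial>lborel)
     * ennreal (exp (- (a + 1) * norm \<xi>)) \<partial>lborel)"

text \<open>The weighted bound applied to the derivative of the cutoff times a component of the
  slice, whose p-th power mass is at most (4/R)^p times that of the slice. The parameter \<kappa> is
  left open, to be tied to R afterwards.\<close>

lemma error_slice_bound:
  obtains C where "C \<ge> 0" "\<And>R t \<kappa>. R > 0 \<Longrightarrow> \<bar>t\<bar> < a \<Longrightarrow> \<kappa> \<ge> 1 \<Longrightarrow>
    (\<integral>\<^sup>+\<xi>. ennreal (error_size R t \<xi> * exp (- 1 * norm \<xi>)) \<partial>lborel) \<le> ennreal C * (ennreal (\<kappa> * (4 / R) powr p) * N t + ennreal (1 / \<kappa>))"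
proof -
  obtain C where C: "C \<ge> 0" "\<And>\<kappa> (u :: real ^ 'm::{finite,linorder} \<Rightarrow> complex). \<kappa> \<ge> 1 \<Longrightarrow> integrable lborel u \<Longrightarrow>
     (\<integral>\<^sup>+\<xi>. ennreal (cmod (fourier_int u \<xi>) * exp (- 1 * norm \<xi>)) \<partial>lborel)
     \<le> ennreal C * (ennreal \<kappa> * (\<integral>\<^sup>+x. ennreal (cmod (u x) powr p) \<partial>lborel) + ennreal (1 / \<kappa>))"
    using fourier_weighted_bound[OF p, of 1] by auto
  show thesis
  \<comment> \<open>One contribution for each of the m directions and each of the 2^m
    components.\<close>
  proof (rule that[of "real CARD('m) * real CARD('m set) * C"])
    show "0 \<le> real CARD('m) * real CARD('m set) * C" using C by simp
    fix R t \<kappa> :: real assume R: "R > 0" and t: "\<bar>t\<bar> < a" and \<kappa>: "\<kappa> \<ge> 1"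
    define B where "B = ennreal C * (ennreal (\<kappa> * (4 / R) powr p) * N t + ennreal (1 / \<kappa>))"
    have each: "(\<integral>\<^sup>+\<xi>. ennreal (cmod (rhat R j t \<xi> T) * exp (- 1 * norm \<xi>)) \<partial>lborel) \<le> B" for j T
    proof -
      have "(\<integral>\<^sup>+x. ennreal (cmod (of_real (cutoff_deriv R (axis j 1) x) * F T (t, x)) powr p) \<partial>lborel)
         \<le> (\<integral>\<^sup>+x. ennreal ((4 / R) powr p) * ennreal (cmod (F T (t, x)) powr p) \<partial>lborel)"
      proof (intro nn_integral_mono)
        fix x
        have "cmod (of_real (cutoff_deriv R (axis j 1) x) * F T (t, x)) powr p = \<bar>cutoff_deriv R (axis j 1) x\<bar> powr p * cmod (F T (t, x)) powr p"
          by (simp add: norm_mult powr_mult)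
        also have "\<dots> \<le> (4 / R) powr p * cmod (F T (t, x)) powr p"
          using p R cutoff_deriv_bound[OF R, of "axis j 1" x] by (intro mult_right_mono powr_mono2) auto
        finally show "ennreal (cmod (of_real (cutoff_deriv R (axis j 1) x) * F T (t, x)) powr p) \<le> ennreal ((4 / R) powr p) * ennreal (cmod (F T (t, x)) powr p)"
          by (simp add: ennreal_leI flip: ennreal_mult)
      qed
      also have "\<dots> = ennreal ((4 / R) powr p) * (\<integral>\<^sup>+x. ennreal (cmod (F T (t, x)) powr p) \<partial>lborel)"
        by (rule nn_integral_cmult) measurable
      also have "\<dots> \<le> ennreal ((4 / R) powr p) * N t"
        by (intro mult_left_mono component_power_le) auto
      finally have "ennreal \<kappa> * (\<integral>\<^sup>+x. ennreal (cmod (of_real (cutoff_deriv R (axis j 1) x) * F T (t, x)) powr p) \<partial>lborel)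
         \<le> ennreal \<kappa> * (ennreal ((4 / R) powr p) * N t)" by (intro mult_left_mono) auto
      also have "\<dots> = ennreal (\<kappa> * (4 / R) powr p) * N t"
        using \<kappa> by (simp add: ennreal_mult mult.assoc)
      finally show ?thesis
        unfolding B_def rhat_def
        by (intro order_trans[OF C(2)[OF \<kappa> slice_integrable(2)[OF R t]]] mult_left_mono add_right_mono) auto
    qed
    have "(\<integral>\<^sup>+\<xi>. ennreal (error_size R t \<xi> * exp (- 1 * norm \<xi>)) \<partial>lborel)
       = (\<integral>\<^sup>+\<xi>. (\<Sum>j\<in>UNIV. \<Sum>T\<in>UNIV. ennreal (cmod (rhat R j t \<xi> T) * exp (- 1 * norm \<xi>))) \<partial>lborel)"
      unfolding error_size_def sum_distrib_right by (intro nn_integral_cong) (simp add: sum_ennreal sum_nonneg)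
    also have "\<dots> = (\<Sum>j\<in>UNIV. \<Sum>T\<in>UNIV. \<integral>\<^sup>+\<xi>. ennreal (cmod (rhat R j t \<xi> T) * exp (- 1 * norm \<xi>)) \<partial>lborel)"
      unfolding rhat_def by (subst nn_integral_sum, simp, subst nn_integral_sum) simp_all
    also have "\<dots> \<le> (\<Sum>j\<in>(UNIV::'m set). \<Sum>T\<in>(UNIV::'m set set). B)"
      by (intro sum_mono each)
    also have "\<dots> = ennreal (real CARD('m) * real CARD('m set) * C) * (ennreal (\<kappa> * (4 / R) powr p) * N t + ennreal (1 / \<kappa>))"
      unfolding B_def using C(1) by (simp add: ennreal_mult ennreal_of_nat_eq_real_of_nat mult.assoc)
    finally show "(\<integral>\<^sup>+\<xi>. ennreal (error_size R t \<xi> * exp (- 1 * norm \<xi>)) \<partial>lborel) \<le> ennreal (real CARD('m) * real CARD('m set) * C) * (ennreal (\<kappa> * (4 / R) powr p) * N t + ennreal (1 / \<kappa>))" .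
  qed
qed

text \<open>Tonelli puts the height integral outside, where the slice masses add up to the finite
  full norm; the term 1/\<kappa> is integrated only over the bounded interval of heights.\<close>

lemma error_total_tendsto: "(\<lambda>n. error_total (real (Suc n))) \<longlonglongrightarrow> 0"
proof -
  obtain C where C: "C \<ge> 0" "\<And>R t \<kappa>. R > 0 \<Longrightarrow> \<bar>t\<bar> < a \<Longrightarrow> \<kappa> \<ge> 1 \<Longrightarrow>
    (\<integral>\<^sup>+\<xi>. ennreal (error_size R t \<xi> * exp (- 1 * norm \<xi>)) \<partial>lborel) \<le> ennreal C * (ennreal (\<kappa> * (4 / R) powr p) * N t + ennreal (1 / \<kappa>))"
    using error_slice_bound by blast
  define A where "A = enn2real (Ap_int a p f)"
  have A: "(\<integral>\<^sup>+t. N t \<partial>lborel) = ennreal A" "A \<ge> 0"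
    unfolding A_def using Ap_finite by (auto simp: Ap_int_eq)
  have bound: "error_total R \<le> ennreal (Kc * C * (\<kappa> * (4 / R) powr p * A + 1 / \<kappa> * (2 * a)))" if R: "R > 0" and \<kappa>: "\<kappa> \<ge> 1" for R \<kappa>
  proof -
    have "error_total R = (\<integral>\<^sup>+\<xi>. (\<integral>\<^sup>+\<tau>. ennreal (Kc * (error_size R \<tau> \<xi> * exp (- 1 * norm (\<xi> :: real ^ 'm::{finite,linorder})))) * indicator {-a<..<a} \<tau> \<partial>lborel) \<partial>lborel)"
      unfolding error_total_def
    proof (intro nn_integral_cong)
      fix \<xi> :: "real ^ 'm::{finite,linorder}"
      have "exp (a * norm \<xi>) * exp (- (a + 1) * norm \<xi>) = exp (- 1 * norm \<xi>)"
        by (simp add: algebra_simps flip: exp_add)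
      then have e: "Kc * exp (a * norm \<xi>) * error_size R \<tau> \<xi> * exp (- (a + 1) * norm \<xi>) = Kc * (error_size R \<tau> \<xi> * exp (- 1 * norm \<xi>))" for \<tau>
        by (metis (no_types, lifting) mult.assoc mult.commute)
      have "(\<integral>\<^sup>+\<tau>. ennreal (Kc * exp (a * norm \<xi>) * error_size R \<tau> \<xi>) * indicator {-a<..<a} \<tau> \<partial>lborel) * ennreal (exp (- (a + 1) * norm \<xi>))
        = (\<integral>\<^sup>+\<tau>. ennreal (Kc * exp (a * norm \<xi>) * error_size R \<tau> \<xi>) * indicator {-a<..<a} \<tau> * ennreal (exp (- (a + 1) * norm \<xi>)) \<partial>lborel)"
        by (rule nn_integral_multc[symmetric]) (use measurable_Pair2'[of \<xi> borel borel] in \<open>simp add: error_size_def rhat_def fourier_int_def\<close>)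
      also have "\<dots> = (\<integral>\<^sup>+\<tau>. ennreal (Kc * (error_size R \<tau> \<xi> * exp (- 1 * norm \<xi>))) * indicator {-a<..<a} \<tau> \<partial>lborel)"
        unfolding e[symmetric] using Kc_nonneg error_size_nonneg
        by (intro nn_integral_cong) (simp add: ennreal_mult' mult_ac)
      finally show "(\<integral>\<^sup>+\<tau>. ennreal (Kc * exp (a * norm \<xi>) * error_size R \<tau> \<xi>) * indicator {-a<..<a} \<tau> \<partial>lborel) * ennreal (exp (- (a + 1) * norm \<xi>))
        = (\<integral>\<^sup>+\<tau>. ennreal (Kc * (error_size R \<tau> \<xi> * exp (- 1 * norm \<xi>))) * indicator {-a<..<a} \<tau> \<partial>lborel)" .
    qed
    also have "\<dots> = (\<integral>\<^sup>+\<tau>. (\<integral>\<^sup>+\<xi>. ennreal (Kc * (error_size R \<tau> \<xi> * exp (- 1 * norm (\<xi> :: real ^ 'm::{finite,linorder})))) * indicator {-a<..<a} \<tau> \<partial>lborel) \<partial>lborel)"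
      by (rule lborel_pair.Fubini') (simp add: error_size_def rhat_def fourier_int_def)
    also have "\<dots> \<le> (\<integral>\<^sup>+\<tau>. ennreal Kc * (ennreal C * (ennreal (\<kappa> * (4 / R) powr p) * N \<tau> + ennreal (1 / \<kappa>) * indicator {-a<..<a} \<tau>)) \<partial>lborel)"
    proof (rule nn_integral_mono)
      fix \<tau>
      show "(\<integral>\<^sup>+\<xi>. ennreal (Kc * (error_size R \<tau> \<xi> * exp (- 1 * norm (\<xi> :: real ^ 'm::{finite,linorder})))) * indicator {-a<..<a} \<tau> \<partial>lborel)
        \<le> ennreal Kc * (ennreal C * (ennreal (\<kappa> * (4 / R) powr p) * N \<tau> + ennreal (1 / \<kappa>) * indicator {-a<..<a} \<tau>))"
      proof (cases "\<tau> \<in> {-a<..<a}")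
        case True
        then have \<tau>: "\<bar>\<tau>\<bar> < a" by auto
        have "(\<integral>\<^sup>+\<xi>. ennreal (Kc * (error_size R \<tau> \<xi> * exp (- 1 * norm (\<xi> :: real ^ 'm::{finite,linorder})))) * indicator {-a<..<a} \<tau> \<partial>lborel)
          = (\<integral>\<^sup>+\<xi>. ennreal Kc * ennreal (error_size R \<tau> \<xi> * exp (- 1 * norm \<xi>)) \<partial>lborel)"
          using True Kc_nonneg error_size_nonneg by (simp add: ennreal_mult')
        also have "\<dots> = ennreal Kc * (\<integral>\<^sup>+\<xi>. ennreal (error_size R \<tau> \<xi> * exp (- 1 * norm \<xi>)) \<partial>lborel)"
          by (rule nn_integral_cmult) (simp add: error_size_def rhat_def)
        also have "\<dots> \<le> ennreal Kc * (ennreal C * (ennreal (\<kappa> * (4 / R) powr p) * N \<tau> + ennreal (1 / \<kappa>)))"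
          by (intro mult_left_mono C(2)[OF R \<tau> \<kappa>]) auto
        finally show ?thesis using True by simp
      qed simp
    qed
    also have "\<dots> = ennreal Kc * (ennreal C * (ennreal (\<kappa> * (4 / R) powr p) * ennreal A + ennreal (1 / \<kappa>) * ennreal (2 * a)))"
      using a_pos by (simp add: nn_integral_cmult nn_integral_add A(1))
    also have "\<dots> = ennreal (Kc * C * (\<kappa> * (4 / R) powr p * A + 1 / \<kappa> * (2 * a)))"
    proof -
      have "ennreal b1 * (ennreal b2 * (ennreal b3 * ennreal b4 + ennreal b5 * ennreal b6)) = ennreal (b1 * b2 * (b3 * b4 + b5 * b6))"
        if "0 \<le> b1" "0 \<le> b2" "0 \<le> b3" "0 \<le> b4" "0 \<le> b5" "0 \<le> b6" for b1 b2 b3 b4 b5 b6 :: real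
        using that by (simp add: ennreal_mult ennreal_plus mult.assoc)
      from this show ?thesis
        by (rule) (use Kc_nonneg C(1) A(2) \<kappa> a_pos in auto)
    qed
    finally show ?thesis .
  qed
  \<comment> \<open>The choice \<kappa> = sqrt R balances both terms: \<kappa> (4/R)^p is at most
    4^p / sqrt R because p is at least 1, and 1/\<kappa> is 1 / sqrt R.\<close>
  have "error_total (real (Suc n)) \<le> ennreal (Kc * C * (sqrt (real (Suc n)) * (4 powr p * (1 / real (Suc n))) * A + 1 / sqrt (real (Suc n)) * (2 * a)))" for n
  proof (rule order_trans[OF bound[of "real (Suc n)" "sqrt (real (Suc n))"]])
    have "real (Suc n) powr 1 \<le> real (Suc n) powr p" using p by (intro powr_mono) auto
    then have "(1 / real (Suc n)) powr p \<le> 1 / real (Suc n)"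
      by (simp add: powr_divide divide_simps)
    then have "4 powr p * (1 / real (Suc n)) powr p \<le> 4 powr p * (1 / real (Suc n))"
      by (intro mult_left_mono) auto
    then have "(4 / real (Suc n)) powr p \<le> 4 powr p * (1 / real (Suc n))"
      by (simp add: powr_divide)
    then show "ennreal (Kc * C * (sqrt (real (Suc n)) * (4 / real (Suc n)) powr p * A + 1 / sqrt (real (Suc n)) * (2 * a)))
      \<le> ennreal (Kc * C * (sqrt (real (Suc n)) * (4 powr p * (1 / real (Suc n))) * A + 1 / sqrt (real (Suc n)) * (2 * a)))"
      using Kc_nonneg C(1) A(2) a_pos by (intro ennreal_leI mult_left_mono add_right_mono mult_right_mono) auto
  qed auto
  then show ?thesis
  proof (rule ennreal_tendsto_0I)
    have "(\<lambda>n. sqrt (real (Suc n)) * (4 powr p * (1 / real (Suc n)))) \<longlonglongrightarrow> 0" "(\<lambda>n. 1 / sqrt (real (Suc n))) \<longlonglongrightarrow> 0"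
      by real_asymp+
    then have "(\<lambda>n. Kc * C * (sqrt (real (Suc n)) * (4 powr p * (1 / real (Suc n))) * A + 1 / sqrt (real (Suc n)) * (2 * a))) \<longlonglongrightarrow> Kc * C * (0 * A + 0 * (2 * a))"
      by (intro tendsto_intros)
    then show "(\<lambda>n. Kc * C * (sqrt (real (Suc n)) * (4 powr p * (1 / real (Suc n))) * A + 1 / sqrt (real (Suc n)) * (2 * a))) \<longlonglongrightarrow> 0"
      by simp
  qed
qed


definition tail :: "'m set \<Rightarrow> real \<Rightarrow> nat \<Rightarrow> ennreal" where
  "tail T t n = (\<integral>\<^sup>+x. ennreal ((1 - cutoff (real (Suc n)) x) * cmod (F T (t, x)) powr p) \<partial>lborel)"

lemma tail_tendsto:
  assumes "good t" shows "tail T t \<longlonglongrightarrow> 0"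
proof -
  have "(\<lambda>n. \<integral>\<^sup>+x. ennreal ((1 - cutoff (real (Suc n)) x) * cmod (F T (t, x)) powr p) \<partial>lborel) \<longlonglongrightarrow> (\<integral>\<^sup>+x. 0 \<partial>(lborel :: (real ^ 'm::{finite,linorder}) measure))"
  proof (rule nn_integral_dominated_convergence[where w="\<lambda>x. ennreal (cmod (F T (t, x)) powr p)"])
    show "AE x in lborel. ennreal ((1 - cutoff (real (Suc n)) x) * cmod (F T (t, x)) powr p) \<le> ennreal (cmod (F T (t, x)) powr p)" for n
      using cutoff_range by (intro always_eventually allI ennreal_leI mult_left_le_one_le) auto
    show "(\<integral>\<^sup>+x. ennreal (cmod (F T (t, x)) powr p) \<partial>lborel) < \<infinity>"
      using component_power_le[of T t] assms by (auto simp: good_def intro: le_less_trans)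
    show "AE x in lborel. (\<lambda>n. ennreal ((1 - cutoff (real (Suc n)) x) * cmod (F T (t, x)) powr p)) \<longlonglongrightarrow> 0"
    proof (intro always_eventually allI)
      fix x
      have "(\<lambda>n. (1 - cutoff (real (Suc n)) x) * cmod (F T (t, x)) powr p) \<longlonglongrightarrow> (1 - 1) * cmod (F T (t, x)) powr p"
        by (intro tendsto_intros cutoff_tendsto)
      from tendsto_ennrealI[OF this] show "(\<lambda>n. ennreal ((1 - cutoff (real (Suc n)) x) * cmod (F T (t, x)) powr p)) \<longlonglongrightarrow> 0"
        by simp
    qed
  qed measurable
  then show ?thesis by (simp add: tail_def[abs_def])
qed

text \<open>A difference of two cutoffs is at most 1, and p is at least 1, so its p-th power is at
  most the difference itself, hence at most the sum of the two defects. This is why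
  \<open>tail\<close> contains 1 - cutoff to the first power.\<close>

lemma cutoff_difference_power:
  assumes "0 \<le> z"
  shows "(\<bar>cutoff R x - cutoff R' x\<bar> * z) powr p \<le> (1 - cutoff R x) * z powr p + (1 - cutoff R' x) * z powr p"
proof -
  define d where "d = \<bar>cutoff R x - cutoff R' x\<bar>"
  have d: "0 \<le> d" "d \<le> 1" "d \<le> (1 - cutoff R x) + (1 - cutoff R' x)"
    unfolding d_def using cutoff_range[of R x] cutoff_range[of R' x] by auto
  have "d powr p \<le> d powr 1" using d p by (intro powr_mono') auto
  then have "d powr p \<le> (1 - cutoff R x) + (1 - cutoff R' x)" using d by simp
  then have "d powr p * z powr p \<le> ((1 - cutoff R x) + (1 - cutoff R' x)) * z powr p"
    by (intro mult_right_mono) auto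
  then show ?thesis using d assms unfolding d_def[symmetric] by (simp add: powr_mult algebra_simps)
qed

lemma weighted_difference_bound:
  assumes \<beta>: "\<beta> > 0"
  obtains C where "C \<ge> 0" "\<And>\<kappa> t T i j. \<kappa> \<ge> 1 \<Longrightarrow> \<bar>t\<bar> < a \<Longrightarrow>
    (\<integral>\<^sup>+\<xi>. ennreal (cmod (vhat (real (Suc i)) t \<xi> T - vhat (real (Suc j)) t \<xi> T) * exp (- \<beta> * norm \<xi>)) \<partial>lborel)
      \<le> ennreal C * (ennreal \<kappa> * (tail T t i + tail T t j) + ennreal (1 / \<kappa>))"
proof -
  obtain C where C: "C \<ge> 0" "\<And>\<kappa> (u :: real ^ 'm::{finite,linorder} \<Rightarrow> complex). \<kappa> \<ge> 1 \<Longrightarrow> integrable lborel u \<Longrightarrow>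
     (\<integral>\<^sup>+\<xi>. ennreal (cmod (fourier_int u \<xi>) * exp (- \<beta> * norm \<xi>)) \<partial>lborel)
     \<le> ennreal C * (ennreal \<kappa> * (\<integral>\<^sup>+x. ennreal (cmod (u x) powr p) \<partial>lborel) + ennreal (1 / \<kappa>))"
    using fourier_weighted_bound[OF p \<beta>] by auto
  show thesis
  proof (rule that[OF C(1)])
    fix \<kappa> t :: real and T i j assume \<kappa>: "\<kappa> \<ge> 1" and t: "\<bar>t\<bar> < a"
    define u where "u x = of_real (cutoff (real (Suc i)) x) * F T (t, x) - of_real (cutoff (real (Suc j)) x) * F T (t, x)" for x
    have iu: "integrable lborel u"
      unfolding u_def by (intro Bochner_Integration.integrable_diff slice_integrable t) auto
    have fu: "vhat (real (Suc i)) t \<xi> T - vhat (real (Suc j)) t \<xi> T = fourier_int u \<xi>" for \<xi>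
      unfolding vhat_def u_def by (rule fourier_int_diff[symmetric]; intro slice_integrable t; simp)
    have "(\<integral>\<^sup>+x. ennreal (cmod (u x) powr p) \<partial>lborel)
       \<le> (\<integral>\<^sup>+x. ennreal ((1 - cutoff (real (Suc i)) x) * cmod (F T (t, x)) powr p) + ennreal ((1 - cutoff (real (Suc j)) x) * cmod (F T (t, x)) powr p) \<partial>lborel)"
    proof (intro nn_integral_mono)
      fix x
      have "u x = of_real (cutoff (real (Suc i)) x - cutoff (real (Suc j)) x) * F T (t, x)"
        unfolding u_def by (simp add: algebra_simps)
      then have "cmod (u x) = \<bar>cutoff (real (Suc i)) x - cutoff (real (Suc j)) x\<bar> * cmod (F T (t, x))"
        by (simp only: norm_mult norm_of_real)
      then have "cmod (u x) powr p \<le> (1 - cutoff (real (Suc i)) x) * cmod (F T (t, x)) powr p + (1 - cutoff (real (Suc j)) x) * cmod (F T (t, x)) powr p"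
        by (simp only:) (rule cutoff_difference_power, rule norm_ge_zero)
      then show "ennreal (cmod (u x) powr p) \<le> ennreal ((1 - cutoff (real (Suc i)) x) * cmod (F T (t, x)) powr p) + ennreal ((1 - cutoff (real (Suc j)) x) * cmod (F T (t, x)) powr p)"
      proof -
        have nn: "0 \<le> (1 - cutoff R x) * cmod (F T (t, x)) powr p" for R
          using cutoff_range(2)[of R x] by simp
        show ?thesis unfolding ennreal_plus[OF nn nn, symmetric] by (rule ennreal_leI) fact
      qed
    qed
    also have "\<dots> = tail T t i + tail T t j"
      unfolding tail_def by (rule nn_integral_add) measurable
    finally have "ennreal \<kappa> * (\<integral>\<^sup>+x. ennreal (cmod (u x) powr p) \<partial>lborel) \<le> ennreal \<kappa> * (tail T t i + tail T t j)"
      by (intro mult_left_mono) auto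
    then show "(\<integral>\<^sup>+\<xi>. ennreal (cmod (vhat (real (Suc i)) t \<xi> T - vhat (real (Suc j)) t \<xi> T) * exp (- \<beta> * norm \<xi>)) \<partial>lborel)
      \<le> ennreal C * (ennreal \<kappa> * (tail T t i + tail T t j) + ennreal (1 / \<kappa>))"
      unfolding fu by (rule order_trans[OF C(2)[OF \<kappa> iu] mult_left_mono[OF add_right_mono]]) auto
  qed
qed

lemma vhat_weighted_integrable:
  assumes "R > 0" "\<bar>t\<bar> < a" "\<beta> > 0"
  shows "integrable lborel (\<lambda>\<xi>. vhat R t \<xi> T * of_real (exp (- \<beta> * norm \<xi>)))"
proof (rule Bochner_Integration.integrable_bound)
  define B where "B = (\<integral>x. cmod (of_real (cutoff R x) * F T (t, x)) \<partial>lborel)"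
  show "integrable lborel (\<lambda>\<xi>::real ^ 'm::{finite,linorder}. B * exp (- \<beta> * norm \<xi>))"
    using integrable_exp_norm[OF assms(3)] by auto
  show "AE \<xi> in lborel. norm (vhat R t \<xi> T * of_real (exp (- \<beta> * norm \<xi>))) \<le> norm (B * exp (- \<beta> * norm \<xi>))"
  proof (intro always_eventually allI)
    fix \<xi> :: "real ^ 'm::{finite,linorder}"
    have "cmod (vhat R t \<xi> T) \<le> \<bar>B\<bar>"
      using fourier_int_bound[OF slice_integrable(1)[OF assms(1,2)], of T \<xi>] unfolding vhat_def B_def by linarith
    then show "norm (vhat R t \<xi> T * of_real (exp (- \<beta> * norm \<xi>))) \<le> norm (B * exp (- \<beta> * norm \<xi>))"
      by (simp add: norm_mult abs_mult mult_right_mono)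
  qed
qed measurable

text \<open>The transform of an L^p slice, without appeal to an extension theorem: the truncated
  transforms are Cauchy in L^1 with weight e^(-|\<xi>|). First \<kappa> is made large, then the
  tails small relative to it.\<close>

lemma vhat_limit:
  assumes c: "good c"
  obtains y where "y \<in> borel_measurable borel"
    "(\<lambda>n. \<integral>\<^sup>+\<xi>. ennreal (cmod (vhat (real (Suc n)) c \<xi> T - y \<xi>) * exp (- 1 * norm \<xi>)) \<partial>lborel) \<longlonglongrightarrow> 0"
proof -
  have ca: "\<bar>c\<bar> < a" using c by (simp add: good_def)
  obtain C where C: "C \<ge> 0" "\<And>\<kappa> t T i j. \<kappa> \<ge> 1 \<Longrightarrow> \<bar>t\<bar> < a \<Longrightarrow>
    (\<integral>\<^sup>+\<xi>. ennreal (cmod (vhat (real (Suc i)) t \<xi> T - vhat (real (Suc j)) t \<xi> T) * exp (- 1 * norm \<xi>)) \<partial>lborel)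
      \<le> ennreal C * (ennreal \<kappa> * (tail T t i + tail T t j) + ennreal (1 / \<kappa>))"
    using weighted_difference_bound[of 1] by auto
  define s where "s n \<xi> = vhat (real (Suc n)) c \<xi> T * of_real (exp (- 1 * norm \<xi>))" for n \<xi>
  have sd: "cmod (s i \<xi> - s j \<xi>) = cmod (vhat (real (Suc i)) c \<xi> T - vhat (real (Suc j)) c \<xi> T) * exp (- 1 * norm \<xi>)" for i j \<xi>
    unfolding s_def left_diff_distrib[symmetric] by (simp add: norm_mult)
  obtain l where l: "l \<in> borel_measurable lborel" "(\<lambda>n. \<integral>\<^sup>+\<xi>. ennreal (cmod (s n \<xi> - l \<xi>)) \<partial>lborel) \<longlonglongrightarrow> 0"
  proof (rule L1_complete[of lborel s])
    show "integrable lborel (s n)" for n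
      unfolding s_def by (rule vhat_weighted_integrable) (use ca in auto)
    fix e :: real assume e: "e > 0"
    \<comment> \<open>Chosen so that C/\<kappa> = C e/(e + 2 C), which is below e/2.\<close>
    define \<kappa> where "\<kappa> = 1 + 2 * C / e"
    have \<kappa>: "\<kappa> \<ge> 1" using C(1) e by (simp add: \<kappa>_def)
    have k2: "C * (1 / \<kappa>) < e / 2"
      using C(1) e \<kappa> by (simp add: \<kappa>_def divide_simps)
    \<comment> \<open>Each tail is allowed d, so that 2 C \<kappa> d stays below e/2; the added 1
      avoids division by zero when C = 0.\<close>
    define d where "d = e / (8 * (C * \<kappa> + 1))"
    have d: "d > 0" using C(1) \<kappa> e by (simp add: d_def add_nonneg_pos)
    have "C * \<kappa> * (2 * d) < e / 2"
    proof -
      have "C * \<kappa> + 1 > 0" using C(1) \<kappa> by (simp add: add_nonneg_pos)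
      then have "d * (8 * (C * \<kappa> + 1)) = e" unfolding d_def by simp
      then show ?thesis using d e by (simp add: algebra_simps)
    qed
    moreover have "C * (\<kappa> * (d + d) + 1 / \<kappa>) = C * \<kappa> * (2 * d) + C * (1 / \<kappa>)"
      by (simp only: distrib_left mult_2 mult.assoc)
    ultimately have total: "C * (\<kappa> * (d + d) + 1 / \<kappa>) < e" using k2 by linarith
    from order_tendstoD(2)[OF tail_tendsto[OF c, of T], of "ennreal d"] d
    obtain M where M: "\<And>n. n \<ge> M \<Longrightarrow> tail T c n < ennreal d"
      by (auto simp: eventually_sequentially)
    show "\<exists>N. \<forall>i\<ge>N. \<forall>j\<ge>N. (\<integral>\<^sup>+\<xi>. ennreal (cmod (s i \<xi> - s j \<xi>)) \<partial>lborel) < ennreal e"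
    proof (intro exI[of _ M] allI impI)
      fix i j assume ij: "i \<ge> M" "j \<ge> M"
      have "(\<integral>\<^sup>+\<xi>. ennreal (cmod (s i \<xi> - s j \<xi>)) \<partial>lborel) \<le> ennreal C * (ennreal \<kappa> * (tail T c i + tail T c j) + ennreal (1 / \<kappa>))"
        unfolding sd by (rule C(2)[OF \<kappa> ca])
      also have "\<dots> \<le> ennreal C * (ennreal \<kappa> * (ennreal d + ennreal d) + ennreal (1 / \<kappa>))"
        by (rule mult_left_mono[OF add_right_mono[OF mult_left_mono[OF add_mono[OF less_imp_le[OF M[OF ij(1)]] less_imp_le[OF M[OF ij(2)]]]]]]) simp_all
      also have "\<dots> = ennreal (C * (\<kappa> * (d + d) + 1 / \<kappa>))"
      proof -
        have "ennreal b1 * (ennreal b2 * (ennreal b3 + ennreal b4) + ennreal b5) = ennreal (b1 * (b2 * (b3 + b4) + b5))"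
          if "0 \<le> b1" "0 \<le> b2" "0 \<le> b3" "0 \<le> b4" "0 \<le> b5" for b1 b2 b3 b4 b5 :: real
          using that by (simp add: ennreal_mult ennreal_plus)
        from this show ?thesis by rule (use C(1) \<kappa> d in auto)
      qed
      also have "\<dots> < ennreal e" using total e by (simp add: ennreal_lessI)
      finally show "(\<integral>\<^sup>+\<xi>. ennreal (cmod (s i \<xi> - s j \<xi>)) \<partial>lborel) < ennreal e" .
    qed
  qed
  \<comment> \<open>The L^1 limit belongs to the weighted functions; this removes the weight
    again.\<close>
  define y where "y \<xi> = l \<xi> * of_real (exp (1 * norm \<xi>))" for \<xi>
  have [measurable]: "l \<in> borel_measurable borel" using l(1) by simp
  have "cmod (s n \<xi> - l \<xi>) = cmod (vhat (real (Suc n)) c \<xi> T - y \<xi>) * exp (- 1 * norm \<xi>)" for n \<xi>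
  proof -
    have "l \<xi> = y \<xi> * of_real (exp (- 1 * norm \<xi>))"
      unfolding y_def mult.assoc by (simp flip: of_real_mult exp_add)
    then have "s n \<xi> - l \<xi> = (vhat (real (Suc n)) c \<xi> T - y \<xi>) * of_real (exp (- 1 * norm \<xi>))"
      unfolding s_def by (simp only: left_diff_distrib)
    then show ?thesis by (simp only: norm_mult norm_of_real abs_exp_cancel)
  qed
  then have "(\<lambda>n. \<integral>\<^sup>+\<xi>. ennreal (cmod (vhat (real (Suc n)) c \<xi> T - y \<xi>) * exp (- 1 * norm \<xi>)) \<partial>lborel) \<longlonglongrightarrow> 0"
    using l(2) by simp
  moreover have "y \<in> borel_measurable borel" unfolding y_def by measurable
  ultimately show thesis using that by blast
qed

end

text \<open>The Fourier transform of the slice at height \<open>t\<close>, in terms of the one at height 0.\<close>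

definition evolve :: "(real ^ 'm::{finite,linorder} \<Rightarrow> 'm::{finite,linorder} clif) \<Rightarrow> real \<Rightarrow> real ^ 'm::{finite,linorder} \<Rightarrow> 'm clif" where
  "evolve g t \<xi> U = of_real (exp (- t * norm \<xi>)) * cl_mult (chi 1 \<xi>) (g \<xi>) U
     + of_real (exp (t * norm \<xi>)) * cl_mult (chi (-1) \<xi>) (g \<xi>) U"

lemma evolve_measurable:
  assumes "\<And>T. (\<lambda>\<xi>. g \<xi> T) \<in> borel_measurable borel"
  shows "(\<lambda>\<xi>. evolve g t \<xi> U) \<in> borel_measurable borel"
proof -
  have [measurable]: "(\<lambda>\<xi>. cl_mult (chi s \<xi>) (g \<xi>) U) \<in> borel_measurable borel" for s
    by (rule cl_mult_chi_measurable) (rule assms)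
  show ?thesis unfolding evolve_def by measurable
qed

text \<open>Pointwise algebra in \<xi>: v and w are truncated transforms at heights t and c, y is
  the limit at c, and g is y carried back to height 0. The error splits into the drift from c to t,
  multiplied by at most e^(a|\<xi>|), and the truncation error at c, multiplied by at most
  e^(2a|\<xi>|); the weight e^(-(2a+1)|\<xi>|) absorbs both.\<close>

lemma propagate_estimate:
  fixes \<xi> :: "real ^ 'm::{finite,linorder}" and y v w :: "'m::{finite,linorder} clif"
  assumes \<xi>: "\<xi> \<noteq> 0" and t: "\<bar>t\<bar> \<le> a" and c: "\<bar>c\<bar> \<le> a"
    and g: "\<And>U. g \<xi> U = of_real (exp (c * norm \<xi>)) * cl_mult (chi 1 \<xi>) y U + of_real (exp (- c * norm \<xi>)) * cl_mult (chi (-1) \<xi>) y U"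
    and b: "\<And>s U. s = 1 \<or> s = - 1 \<Longrightarrow> cmod (of_real (exp (s * t * norm \<xi>)) * cl_mult (chi s \<xi>) v U
      - of_real (exp (s * c * norm \<xi>)) * cl_mult (chi s \<xi>) w U) \<le> B"
  shows "cmod (v U - evolve g t \<xi> U) * exp (- (2 * a + 1) * norm \<xi>)
    \<le> 2 * (B * exp (- (a + 1) * norm \<xi>)) + 2 * (1 + real CARD('m)) * (\<Sum>T\<in>UNIV. cmod (w T - y T) * exp (- 1 * norm \<xi>))"
proof -
  define n where "n = norm \<xi>"
  have n: "n \<ge> 0" by (simp add: n_def)
  define S where "S = (\<Sum>T\<in>UNIV. cmod (w T - y T))"
  define P where "P s z = cl_mult (chi s \<xi>) z U" for s z
  have g': "g \<xi> = (\<lambda>U. of_real (exp (c * norm \<xi>)) * cl_mult (chi 1 \<xi>) y U + of_real (exp (- c * norm \<xi>)) * cl_mult (chi (-1) \<xi>) y U)"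
    using g by auto
  have Pg: "P s (g \<xi>) = of_real (exp (s * c * n)) * P s y" if s: "s = 1 \<or> s = - 1" for s
    unfolding P_def g' cl_mult_chi_linear using s cl_mult_chi_chi[OF s _ \<xi>, of 1 y U] cl_mult_chi_chi[OF s _ \<xi>, of "-1" y U]
    by (auto simp: n_def)
  \<comment> \<open>In propagated form, w is inserted between v and y: the bracket is controlled by
    the evolution equation, the second term by convergence at c. The quantity itself is the
    propagated v minus the projection of g.\<close>
  define D where "D s = (of_real (exp (s * t * n)) * P s v - of_real (exp (s * c * n)) * P s w) + of_real (exp (s * c * n)) * (P s w - P s y)" for s :: real
  have e0: "of_real (exp (- (s * t * n))) * D s = P s v - of_real (exp (- (s * t * n))) * P s (g \<xi>)" if s: "s = 1 \<or> s = - 1" for s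
  proof -
    have "complex_of_real (exp (- (s * t * n))) * of_real (exp (s * t * n)) = 1"
      by (simp flip: of_real_mult exp_add)
    then show ?thesis unfolding D_def Pg[OF s] by (simp add: algebra_simps)
  qed
  have Dle: "cmod (D s) \<le> B + exp (a * n) * ((1 + real CARD('m)) * S)" if s: "s = 1 \<or> s = - 1" for s
  proof -
    have "cmod (of_real (exp (s * c * n)) * (P s w - P s y)) \<le> exp (a * n) * ((1 + real CARD('m)) * S)"
    proof -
      have "s * c \<le> a" using s c by auto
      then have "exp (s * c * n) \<le> exp (a * n)" using n by (simp add: mult_right_mono)
      moreover have "cmod (P s w - P s y) \<le> (1 + real CARD('m)) * S"
        unfolding P_def S_def cl_mult_chi_diff[symmetric] by (rule cl_mult_chi_norm[OF s])
      ultimately show ?thesis unfolding norm_mult by (intro mult_mono) auto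
    qed
    with b[OF s, of U] show ?thesis
      unfolding D_def P_def n_def by (intro order_trans[OF norm_triangle_ineq add_mono]) auto
  qed
  have "v U = P 1 v + P (-1) v" unfolding P_def by (rule cl_mult_chi_sum[symmetric])
  then have eq: "v U - evolve g t \<xi> U = of_real (exp (- (1 * t * n))) * D 1 + of_real (exp (- (- 1 * t * n))) * D (- 1)"
    unfolding evolve_def e0[OF disjI1[OF refl]] e0[OF disjI2[OF refl]] by (simp add: P_def n_def)
  have each: "cmod (of_real (exp (- (s * t * n))) * D s) \<le> exp (a * n) * (B + exp (a * n) * ((1 + real CARD('m)) * S))" if s: "s = 1 \<or> s = - 1" for s
  proof -
    have "- (s * t) \<le> a" using s t by auto
    then have "- (s * t) * n \<le> a * n" using n by (rule mult_right_mono)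
    then have "exp (- (s * t * n)) \<le> exp (a * n)" by simp
    then show ?thesis unfolding norm_mult using Dle[OF s] by (intro mult_mono) auto
  qed
  have "cmod (v U - evolve g t \<xi> U) \<le> 2 * (exp (a * n) * (B + exp (a * n) * ((1 + real CARD('m)) * S)))"
    unfolding eq using each[of 1] each[of "-1"] norm_triangle_ineq[of "of_real (exp (- (1 * t * n))) * D 1" "of_real (exp (- (- 1 * t * n))) * D (- 1)"]
    by simp
  then have "cmod (v U - evolve g t \<xi> U) * exp (- (2 * a + 1) * n) \<le> 2 * (exp (a * n) * (B + exp (a * n) * ((1 + real CARD('m)) * S))) * exp (- (2 * a + 1) * n)"
    by (intro mult_right_mono) auto
  also have "\<dots> = 2 * (B * (exp (a * n) * exp (- (2 * a + 1) * n))) + 2 * (1 + real CARD('m)) * (S * (exp (a * n) * exp (a * n) * exp (- (2 * a + 1) * n)))"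
    by (simp add: algebra_simps)
  also have "exp (a * n) * exp (- (2 * a + 1) * n) = exp (- (a + 1) * n)"
    by (simp add: algebra_simps flip: exp_add)
  also have "exp (a * n) * exp (a * n) * exp (- (2 * a + 1) * n) = exp (- 1 * n)"
    by (simp add: algebra_simps flip: exp_add)
  finally show ?thesis unfolding n_def S_def sum_distrib_right .
qed

context monogenic_Ap
begin

text \<open>Convergence is known at one good height c, and the evolution equation transports it to
  every t in the strip, good or not, because its error tends to 0 independently of t.\<close>

lemma evolve_limit_exists:
  obtains g where "\<And>T. (\<lambda>\<xi>. g \<xi> T) \<in> borel_measurable borel"
    "\<And>t U. \<bar>t\<bar> < a \<Longrightarrow> (\<lambda>n. \<integral>\<^sup>+\<xi>. ennreal (cmod (vhat (real (Suc n)) t \<xi> U - evolve g t \<xi> U) * exp (- (2 * a + 1) * norm \<xi>)) \<partial>lborel) \<longlonglongrightarrow> 0"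
proof -
  obtain c where c: "good c" using good_between[of "-a" a] a_pos by auto
  then have ca: "\<bar>c\<bar> < a" by (simp add: good_def)
  have "\<exists>y. y \<in> borel_measurable borel \<and>
    (\<lambda>n. \<integral>\<^sup>+\<xi>. ennreal (cmod (vhat (real (Suc n)) c \<xi> T - y \<xi>) * exp (- 1 * norm \<xi>)) \<partial>lborel) \<longlonglongrightarrow> 0" for T
    by (rule vhat_limit[OF c, of T]) blast
  then obtain y0 where y0: "\<And>T. y0 T \<in> borel_measurable borel"
    "\<And>T. (\<lambda>n. \<integral>\<^sup>+\<xi>. ennreal (cmod (vhat (real (Suc n)) c \<xi> T - y0 T \<xi>) * exp (- 1 * norm \<xi>)) \<partial>lborel) \<longlonglongrightarrow> 0"
    using choice[of "\<lambda>T y. y \<in> borel_measurable borel \<and>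
    (\<lambda>n. \<integral>\<^sup>+\<xi>. ennreal (cmod (vhat (real (Suc n)) c \<xi> T - y \<xi>) * exp (- 1 * norm \<xi>)) \<partial>lborel) \<longlonglongrightarrow> 0"]
    by blast
  define y where "y \<xi> T = y0 T \<xi>" for \<xi> T
  have [measurable]: "(\<lambda>\<xi>. y \<xi> T) \<in> borel_measurable borel" for T unfolding y_def using y0(1) by simp
  \<comment> \<open>Inverts \<open>evolve\<close> at height c: each projection of y is multiplied by
    the inverse of its propagation factor.\<close>
  define g where "g \<xi> U = of_real (exp (c * norm \<xi>)) * cl_mult (chi 1 \<xi>) (y \<xi>) U + of_real (exp (- c * norm \<xi>)) * cl_mult (chi (-1) \<xi>) (y \<xi>) U" for \<xi> U
  have [measurable]: "(\<lambda>\<xi>. cl_mult (chi s \<xi>) (y \<xi>) U) \<in> borel_measurable borel" for s U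
    by (rule cl_mult_chi_measurable) measurable
  have gm: "(\<lambda>\<xi>. g \<xi> T) \<in> borel_measurable borel" for T unfolding g_def by measurable
  have em[measurable]: "(\<lambda>\<xi>. evolve g t \<xi> U) \<in> borel_measurable borel" for t U
    by (rule evolve_measurable[OF gm])
  show thesis
  proof (rule that[of g, OF gm])
    fix t U assume t: "\<bar>t\<bar> < a"
    define K where "K = 2 * (1 + real CARD('m))"
    define E where "E R \<xi> = (\<integral>\<^sup>+\<tau>. ennreal (Kc * exp (a * norm \<xi>) * error_size R \<tau> \<xi>) * indicator {-a<..<a} \<tau> \<partial>lborel)" for R and \<xi> :: "real ^ 'm::{finite,linorder}"
    have [measurable]: "E R \<in> borel_measurable borel" for R
      unfolding E_def error_size_def rhat_def fourier_int_def by measurable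
    define X where "X n = (\<integral>\<^sup>+\<xi>. ennreal (cmod (vhat (real (Suc n)) t \<xi> U - evolve g t \<xi> U) * exp (- (2 * a + 1) * norm \<xi>)) \<partial>lborel)" for n
    define Y where "Y n T = (\<integral>\<^sup>+\<xi>. ennreal (cmod (vhat (real (Suc n)) c \<xi> T - y \<xi> T) * exp (- 1 * norm \<xi>)) \<partial>lborel)" for n T
    have "X n \<le> 2 * error_total (real (Suc n)) + ennreal K * (\<Sum>T\<in>UNIV. Y n T)" for n
    proof -
      define R where "R = real (Suc n)"
      have R: "R > 0" by (simp add: R_def)
      have "X n \<le> (\<integral>\<^sup>+\<xi>. 2 * (E R \<xi> * ennreal (exp (- (a + 1) * norm \<xi>))) + ennreal K * (\<Sum>T\<in>UNIV. ennreal (cmod (vhat R c \<xi> T - y \<xi> T) * exp (- 1 * norm \<xi>))) \<partial>lborel)"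
        unfolding X_def R_def[symmetric]
      proof (rule nn_integral_mono_AE)
        have "AE \<xi> in lborel. \<xi> \<noteq> (0 :: real ^ 'm::{finite,linorder})" by (rule AE_lborel_singleton)
        then show "AE \<xi> in lborel. ennreal (cmod (vhat R t \<xi> U - evolve g t \<xi> U) * exp (- (2 * a + 1) * norm \<xi>))
          \<le> 2 * (E R \<xi> * ennreal (exp (- (a + 1) * norm \<xi>))) + ennreal K * (\<Sum>T\<in>UNIV. ennreal (cmod (vhat R c \<xi> T - y \<xi> T) * exp (- 1 * norm \<xi>)))"
        proof eventually_elim
          case (elim \<xi>)
          show ?case
          \<comment> \<open>Nothing has been shown about finiteness of the error at an individual
            frequency; where it is infinite, so is the right side.\<close>
          proof (cases "E R \<xi> = \<top>")
            case True
            then have "2 * (E R \<xi> * ennreal (exp (- (a + 1) * norm \<xi>))) = \<top>"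
              by (simp add: ennreal_top_mult ennreal_mult_top)
            then show ?thesis by simp
          next
            case False
            define B where "B = enn2real (E R \<xi>)"
            have EB: "E R \<xi> = ennreal B" "B \<ge> 0" using False by (auto simp: B_def top.not_eq_extremum)
            have b: "cmod (of_real (exp (s * t * norm \<xi>)) * cl_mult (chi s \<xi>) (vhat R t \<xi>) V
              - of_real (exp (s * c * norm \<xi>)) * cl_mult (chi s \<xi>) (vhat R c \<xi>) V) \<le> B" if s: "s = 1 \<or> s = - 1" for s V
              using propagated_difference[OF R ca t s, of \<xi> V] EB unfolding E_def[symmetric] by (simp add: ennreal_le_iff)
            have "cmod (vhat R t \<xi> U - evolve g t \<xi> U) * exp (- (2 * a + 1) * norm \<xi>)
              \<le> 2 * (B * exp (- (a + 1) * norm \<xi>)) + K * (\<Sum>T\<in>UNIV. cmod (vhat R c \<xi> T - y \<xi> T) * exp (- 1 * norm \<xi>))"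
              unfolding K_def
              by (rule propagate_estimate[where c=c]) (use elim t ca b in \<open>auto simp: g_def\<close>)
            then have "ennreal (cmod (vhat R t \<xi> U - evolve g t \<xi> U) * exp (- (2 * a + 1) * norm \<xi>))
              \<le> ennreal (2 * (B * exp (- (a + 1) * norm \<xi>)) + K * (\<Sum>T\<in>UNIV. cmod (vhat R c \<xi> T - y \<xi> T) * exp (- 1 * norm \<xi>)))"
              by (rule ennreal_leI)
            also have "\<dots> = 2 * (E R \<xi> * ennreal (exp (- (a + 1) * norm \<xi>))) + ennreal K * (\<Sum>T\<in>UNIV. ennreal (cmod (vhat R c \<xi> T - y \<xi> T) * exp (- 1 * norm \<xi>)))"
            proof -
              have gen: "ennreal (2 * (b1 * b2) + K * b3) = 2 * (ennreal b1 * ennreal b2) + ennreal K * ennreal b3"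
                if "0 \<le> b1" "0 \<le> b2" "0 \<le> b3" for b1 b2 b3 :: real
                using that by (simp add: ennreal_plus ennreal_mult K_def ennreal_numeral)
              show ?thesis unfolding EB(1)
                by (subst gen) (auto simp: EB(2) sum_nonneg sum_ennreal)
            qed
            finally show ?thesis .
          qed
        qed
      qed
      also have "\<dots> = 2 * (\<integral>\<^sup>+\<xi>. E R \<xi> * ennreal (exp (- (a + 1) * norm \<xi>)) \<partial>lborel) + ennreal K * (\<Sum>T\<in>UNIV. \<integral>\<^sup>+\<xi>. ennreal (cmod (vhat R c \<xi> T - y \<xi> T) * exp (- 1 * norm \<xi>)) \<partial>lborel)"
        by (subst nn_integral_add, simp, simp, subst nn_integral_cmult, simp, subst nn_integral_cmult, simp, subst nn_integral_sum) simp_all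
      also have "\<dots> = 2 * error_total R + ennreal K * (\<Sum>T\<in>UNIV. Y n T)"
        unfolding error_total_def E_def Y_def R_def ..
      finally show ?thesis unfolding R_def .
    qed
    moreover have "(\<lambda>n. 2 * error_total (real (Suc n)) + ennreal K * (\<Sum>T\<in>UNIV. Y n T)) \<longlonglongrightarrow> 2 * 0 + ennreal K * (\<Sum>T\<in>(UNIV::'m set set). 0)"
      by (intro tendsto_add ennreal_tendsto_cmult tendsto_sum error_total_tendsto)
         (use y0(2) in \<open>auto simp: Y_def y_def\<close>)
    ultimately have "X \<longlonglongrightarrow> 0"
      by (intro tendsto_sandwich[OF _ _ tendsto_const[of 0], of X]) auto
    then show "(\<lambda>n. \<integral>\<^sup>+\<xi>. ennreal (cmod (vhat (real (Suc n)) t \<xi> U - evolve g t \<xi> U) * exp (- (2 * a + 1) * norm \<xi>)) \<partial>lborel) \<longlonglongrightarrow> 0"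
      unfolding X_def .
  qed
qed

end

subsection \<open>Fourier inversion on the slices\<close>

lemma ennreal_squeeze_0:
  fixes X Y :: "nat \<Rightarrow> ennreal"
  assumes "\<And>n. X n \<le> Y n" "Y \<longlonglongrightarrow> 0" shows "X \<longlonglongrightarrow> 0"
  by (rule tendsto_sandwich[OF _ _ tendsto_const assms(2)]) (auto intro!: always_eventually assms(1))

lemma le_one_plus_powr:
  fixes z p :: real assumes "1 \<le> p" "0 \<le> z" shows "z \<le> 1 + z powr p"
proof (cases "z \<ge> 1")
  case True
  then show ?thesis using powr_mono[OF assms(1) True] by simp
next
  case False
  then show ?thesis using powr_ge_zero[of z p] by linarith
qed

lemma chi_evolve:
  assumes s: "s = 1 \<or> s = - 1" and \<xi>: "\<xi> \<noteq> 0"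
  shows "cl_mult (chi s \<xi>) (evolve g t \<xi>) U = of_real (exp (- s * t * norm \<xi>)) * cl_mult (chi s \<xi>) (g \<xi>) U"
proof -
  have "evolve g t \<xi> = (\<lambda>U. of_real (exp (- t * norm \<xi>)) * cl_mult (chi 1 \<xi>) (g \<xi>) U
     + of_real (exp (t * norm \<xi>)) * cl_mult (chi (-1) \<xi>) (g \<xi>) U)"
    by (auto simp: evolve_def)
  then show ?thesis
    using s cl_mult_chi_chi[OF s _ \<xi>, of 1 "g \<xi>" U] cl_mult_chi_chi[OF s _ \<xi>, of "-1" "g \<xi>" U]
    by (auto simp: cl_mult_chi_linear)
qed

lemma nn_integral_Fatou_bound:
  fixes u :: "nat \<Rightarrow> 'a \<Rightarrow> real"
  assumes [measurable]: "\<And>n. u n \<in> borel_measurable M"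
    and lim: "AE x in M. (\<lambda>n. u n x) \<longlonglongrightarrow> l x" and bound: "\<And>n. (\<integral>\<^sup>+x. ennreal (u n x) \<partial>M) \<le> B"
  shows "(\<integral>\<^sup>+x. ennreal (l x) \<partial>M) \<le> B"
proof -
  have "(\<integral>\<^sup>+x. ennreal (l x) \<partial>M) = (\<integral>\<^sup>+x. liminf (\<lambda>n. ennreal (u n x)) \<partial>M)"
  proof (rule nn_integral_cong_AE)
    show "AE x in M. ennreal (l x) = liminf (\<lambda>n. ennreal (u n x))"
      using lim
    proof eventually_elim
      case (elim x)
      from tendsto_ennrealI[OF elim] show ?case using lim_imp_Liminf[OF sequentially_bot] by fastforce
    qed
  qed
  also have "\<dots> \<le> liminf (\<lambda>n. \<integral>\<^sup>+x. ennreal (u n x) \<partial>M)"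
    by (rule nn_integral_liminf) measurable
  also have "\<dots> \<le> B"
    by (intro Liminf_le always_eventually allI bound) simp
  finally show ?thesis .
qed

section \<open>Bounds and inversion for the limiting spectrum\<close>

context monogenic_Ap
begin

text \<open>A property rather than a fixed function, because for p = 1 the function obtained from
  the limit must still be changed on a null set.\<close>

definition spectrum :: "(real ^ 'm::{finite,linorder} \<Rightarrow> 'm clif) \<Rightarrow> bool" where
  "spectrum g \<longleftrightarrow> (\<forall>T. (\<lambda>\<xi>. g \<xi> T) \<in> borel_measurable borel) \<and>
    (\<forall>t U. \<bar>t\<bar> < a \<longrightarrow> (\<lambda>n. \<integral>\<^sup>+\<xi>. ennreal (cmod (vhat (real (Suc n)) t \<xi> U - evolve g t \<xi> U) * exp (- (2 * a + 1) * norm \<xi>)) \<partial>lborel) \<longlonglongrightarrow> 0)"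

lemma spectrum_evolve_measurable: "spectrum g \<Longrightarrow> (\<lambda>\<xi>. evolve g t \<xi> U) \<in> borel_measurable borel"
  by (rule evolve_measurable) (simp add: spectrum_def)

text \<open>The weight is positive, so it disappears in pointwise convergence. Through this lemma,
  estimates uniform in the truncation pass to \<open>evolve g t\<close>.\<close>

lemma spectrum_subseq:
  assumes g: "spectrum g" and t: "\<bar>t\<bar> < a"
  obtains r where "strict_mono (r :: nat \<Rightarrow> nat)" "AE \<xi> in lborel. (\<lambda>n. vhat (real (Suc (r n))) t \<xi> U) \<longlonglongrightarrow> evolve g t \<xi> U"
proof -
  have [measurable]: "(\<lambda>\<xi>. evolve g t \<xi> U) \<in> borel_measurable borel" by (rule spectrum_evolve_measurable[OF g])
  obtain r :: "nat \<Rightarrow> nat" where r: "strict_mono r"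
    "AE \<xi> in lborel. (\<lambda>n. cmod (vhat (real (Suc (r n))) t \<xi> U - evolve g t \<xi> U) * exp (- (2 * a + 1) * norm \<xi>)) \<longlonglongrightarrow> 0"
    by (rule nn_integral_tendsto_0_AE_subseq[of "\<lambda>n \<xi>. cmod (vhat (real (Suc n)) t \<xi> U - evolve g t \<xi> U) * exp (- (2 * a + 1) * norm \<xi>)" lborel])
       (use g t in \<open>auto simp: spectrum_def\<close>)
  from r(2) have "AE \<xi> in lborel. (\<lambda>n. vhat (real (Suc (r n))) t \<xi> U) \<longlonglongrightarrow> evolve g t \<xi> U"
  proof eventually_elim
    case (elim \<xi>)
    from tendsto_mult_right[OF elim, of "exp ((2 * a + 1) * norm \<xi>)"]
    have "(\<lambda>n. cmod (vhat (real (Suc (r n))) t \<xi> U - evolve g t \<xi> U)) \<longlonglongrightarrow> 0"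
      by (simp add: mult.assoc algebra_simps flip: exp_add)
    then show ?case by (simp add: tendsto_norm_zero_iff LIM_zero_iff)
  qed
  with r(1) show thesis by (rule that)
qed

lemma cut_power_le:
  "(\<integral>\<^sup>+x. ennreal (cmod (of_real (cutoff R x) * F T (t, x)) powr p) \<partial>lborel) \<le> N t"
proof (rule order_trans[OF _ component_power_le[of T]], intro nn_integral_mono ennreal_leI powr_mono2)
  fix x
  show "cmod (of_real (cutoff R x) * F T (t, x)) \<le> cmod (F T (t, x))"
    using cutoff_range[of R x] by (simp add: norm_mult mult_left_le_one_le)
qed (use p in auto)

lemma good_N: "good t \<Longrightarrow> N t = ennreal (enn2real (N t))"
  by (simp add: good_def)

text \<open>At a good height the weighted bound for truncated slices is uniform in R for each fixed
  \<delta>, so Fatou improves the exponent 2a + 1 of the defining convergence to any positive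
  \<delta>.\<close>

lemma evolve_weighted_integrable:
  assumes g: "spectrum g" and t: "good t" and \<delta>: "\<delta> > 0"
  shows "integrable lborel (\<lambda>\<xi>. evolve g t \<xi> U * of_real (exp (- \<delta> * norm \<xi>)))"
proof -
  have ta: "\<bar>t\<bar> < a" using t by (simp add: good_def)
  have [measurable]: "(\<lambda>\<xi>. evolve g t \<xi> U) \<in> borel_measurable borel" by (rule spectrum_evolve_measurable[OF g])
  obtain C where C: "C \<ge> 0" "\<And>\<kappa> (u :: real ^ 'm::{finite,linorder} \<Rightarrow> complex). \<kappa> \<ge> 1 \<Longrightarrow> integrable lborel u \<Longrightarrow>
     (\<integral>\<^sup>+\<xi>. ennreal (cmod (fourier_int u \<xi>) * exp (- \<delta> * norm \<xi>)) \<partial>lborel)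
     \<le> ennreal C * (ennreal \<kappa> * (\<integral>\<^sup>+x. ennreal (cmod (u x) powr p) \<partial>lborel) + ennreal (1 / \<kappa>))"
    using fourier_weighted_bound[OF p \<delta>] by auto
  obtain r where r: "strict_mono (r :: nat \<Rightarrow> nat)" "AE \<xi> in lborel. (\<lambda>n. vhat (real (Suc (r n))) t \<xi> U) \<longlonglongrightarrow> evolve g t \<xi> U"
    by (rule spectrum_subseq[OF g ta])
  have "(\<integral>\<^sup>+\<xi>. ennreal (cmod (evolve g t \<xi> U) * exp (- \<delta> * norm \<xi>)) \<partial>lborel) \<le> ennreal C * (N t + 1)"
  proof (rule nn_integral_Fatou_bound[where u="\<lambda>n \<xi>. cmod (vhat (real (Suc (r n))) t \<xi> U) * exp (- \<delta> * norm \<xi>)"])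
    show "AE \<xi> in lborel. (\<lambda>n. cmod (vhat (real (Suc (r n))) t \<xi> U) * exp (- \<delta> * norm \<xi>)) \<longlonglongrightarrow> cmod (evolve g t \<xi> U) * exp (- \<delta> * norm \<xi>)"
      using r(2) by eventually_elim (intro tendsto_intros)
    fix n
    have "(\<integral>\<^sup>+\<xi>. ennreal (cmod (vhat (real (Suc (r n))) t \<xi> U) * exp (- \<delta> * norm \<xi>)) \<partial>lborel)
       \<le> ennreal C * (ennreal 1 * (\<integral>\<^sup>+x. ennreal (cmod (of_real (cutoff (real (Suc (r n))) x) * F U (t, x)) powr p) \<partial>lborel) + ennreal (1 / 1))"
      unfolding vhat_def by (rule C(2)) (use slice_integrable(1) ta in auto)
    also have "\<dots> \<le> ennreal C * (N t + 1)"
      using cut_power_le[of "real (Suc (r n))" U t] by (intro mult_left_mono) auto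
    finally show "(\<integral>\<^sup>+\<xi>. ennreal (cmod (vhat (real (Suc (r n))) t \<xi> U) * exp (- \<delta> * norm \<xi>)) \<partial>lborel) \<le> ennreal C * (N t + 1)" .
  qed measurable
  also have "\<dots> < \<infinity>" using t by (auto simp: good_def ennreal_mult_less_top less_top)
  finally show ?thesis
    by (intro integrableI_bounded) (auto simp: norm_mult)
qed

text \<open>The Hausdorff-Young constant enters through the hypothesis \<open>K\<close>, so that it
  can be fixed before f is introduced. Truncation does not increase the L^p mass, and Fatou
  concludes.\<close>

lemma evolve_hausdorff_young:
  assumes g: "spectrum g" and t: "good t"
    and K: "\<And>(u :: real ^ 'm::{finite,linorder} \<Rightarrow> complex) I. integrable lborel u \<Longrightarrow> I \<ge> 0 \<Longrightarrow>
     (\<integral>\<^sup>+x. ennreal (cmod (u x) powr p) \<partial>lborel) \<le> ennreal I \<Longrightarrow>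
     (\<integral>\<^sup>+\<xi>. ennreal (cmod (fourier_int u \<xi>) powr q) \<partial>lborel) \<le> ennreal (K * I powr (q / p))" and q: "q > 0"
  shows "(\<integral>\<^sup>+\<xi>. ennreal (cmod (evolve g t \<xi> U) powr q) \<partial>lborel) \<le> ennreal (K * enn2real (N t) powr (q / p))"
proof -
  have ta: "\<bar>t\<bar> < a" using t by (simp add: good_def)
  obtain r where r: "strict_mono (r :: nat \<Rightarrow> nat)" "AE \<xi> in lborel. (\<lambda>n. vhat (real (Suc (r n))) t \<xi> U) \<longlonglongrightarrow> evolve g t \<xi> U"
    by (rule spectrum_subseq[OF g ta])
  show ?thesis
  proof (rule nn_integral_Fatou_bound[where u="\<lambda>n \<xi>. cmod (vhat (real (Suc (r n))) t \<xi> U) powr q"])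
    show "AE \<xi> in lborel. (\<lambda>n. cmod (vhat (real (Suc (r n))) t \<xi> U) powr q) \<longlonglongrightarrow> cmod (evolve g t \<xi> U) powr q"
      using r(2)
    proof eventually_elim
      case (elim \<xi>)
      show ?case by (rule tendsto_powr2[OF tendsto_norm[OF elim] tendsto_const]) (use q in auto)
    qed
    show "(\<integral>\<^sup>+\<xi>. ennreal (cmod (vhat (real (Suc (r n))) t \<xi> U) powr q) \<partial>lborel) \<le> ennreal (K * enn2real (N t) powr (q / p))" for n
      unfolding vhat_def
      by (rule K) (use slice_integrable(1) ta cut_power_le[of _ U t] good_N[OF t] in auto)
  qed measurable
qed

lemma evolve_bounded:
  assumes g: "spectrum g" and t: "good t" and p1: "p = 1"
  shows "AE \<xi> in lborel. cmod (evolve g t \<xi> U) \<le> enn2real (N t)"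
proof -
  have ta: "\<bar>t\<bar> < a" using t by (simp add: good_def)
  obtain r where r: "strict_mono (r :: nat \<Rightarrow> nat)" "AE \<xi> in lborel. (\<lambda>n. vhat (real (Suc (r n))) t \<xi> U) \<longlonglongrightarrow> evolve g t \<xi> U"
    by (rule spectrum_subseq[OF g ta])
  have le: "cmod (vhat R t \<xi> U) \<le> enn2real (N t)" if R: "R > 0" for R \<xi>
  proof -
    have "ennreal (cmod (vhat R t \<xi> U)) \<le> ennreal (\<integral>x. cmod (of_real (cutoff R x) * F U (t, x)) \<partial>lborel)"
      unfolding vhat_def by (intro ennreal_leI fourier_int_bound slice_integrable R ta)
    also have "\<dots> = (\<integral>\<^sup>+x. ennreal (cmod (of_real (cutoff R x) * F U (t, x)) powr p) \<partial>lborel)"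
      using slice_integrable(1)[OF R ta, of U] p1 by (subst nn_integral_eq_integral[symmetric]) auto
    also have "\<dots> \<le> ennreal (enn2real (N t))" using cut_power_le good_N[OF t] by simp
    finally show ?thesis by (simp add: ennreal_le_iff)
  qed
  from r(2) show ?thesis
  proof eventually_elim
    case (elim \<xi>)
    show ?case by (rule tendsto_upperbound[OF tendsto_norm[OF elim]]) (auto intro!: always_eventually le)
  qed
qed

text \<open>The projection with sign s grows by e^(-s t|\<xi>|) under evolution to height t. Taking
  a good t so near the boundary that -s t > b, the claimed function is e^(-\<delta>|\<xi>|) times a
  projection of \<open>evolve g t\<close>, with \<delta> = -s t - b.\<close>

lemma chi_weighted_integrable:
  assumes g: "spectrum g" and b: "\<bar>b\<bar> < a" and s: "s = 1 \<or> s = - 1"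
  shows "integrable lborel (\<lambda>\<xi>. of_real (exp (b * norm \<xi>)) * cl_mult (chi s \<xi>) (g \<xi>) U)"
proof -
  obtain t where t: "good t" "b < - s * t"
  proof (cases "s = 1")
    case True
    have "- a < - b" "- b \<le> a" using b by auto
    from good_between[OF this(1) order_refl this(2)] obtain t where "- a < t" "t < - b" "good t" by blast
    then show thesis using that[of t] True by simp
  next
    case False
    have "b < a" "- a \<le> b" using b by auto
    from good_between[OF this order_refl] obtain t where "b < t" "t < a" "good t" by blast
    then show thesis using that[of t] False s by simp
  qed
  define \<delta> where "\<delta> = - s * t - b"
  have \<delta>: "\<delta> > 0" using t by (simp add: \<delta>_def)
  have [measurable]: "(\<lambda>\<xi>. g \<xi> T) \<in> borel_measurable borel" for T using g by (simp add: spectrum_def)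
  have [measurable]: "(\<lambda>\<xi>. cl_mult (chi s \<xi>) (g \<xi>) U) \<in> borel_measurable borel"
    by (rule cl_mult_chi_measurable) measurable
  have i: "integrable lborel (\<lambda>\<xi>. (1 + real CARD('m)) * (\<Sum>T\<in>UNIV. cmod (evolve g t \<xi> T * of_real (exp (- \<delta> * norm \<xi>)))))"
    by (intro integrable_mult_right Bochner_Integration.integrable_sum integrable_norm evolve_weighted_integrable g t \<delta>)
  show ?thesis
  proof (rule Bochner_Integration.integrable_bound[OF i])
    have "AE \<xi> in lborel. \<xi> \<noteq> (0 :: real ^ 'm::{finite,linorder})" by (rule AE_lborel_singleton)
    then show "AE \<xi> in lborel. norm (of_real (exp (b * norm \<xi>)) * cl_mult (chi s \<xi>) (g \<xi>) U)
      \<le> norm ((1 + real CARD('m)) * (\<Sum>T\<in>UNIV. cmod (evolve g t \<xi> T * of_real (exp (- \<delta> * norm \<xi>)))))"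
    proof eventually_elim
      case (elim \<xi>)
      have e: "exp (b * norm \<xi>) = exp (- \<delta> * norm \<xi>) * exp (- s * t * norm \<xi>)"
        unfolding \<delta>_def by (simp add: algebra_simps flip: exp_add)
      have "cmod (of_real (exp (b * norm \<xi>)) * cl_mult (chi s \<xi>) (g \<xi>) U) = exp (- \<delta> * norm \<xi>) * cmod (cl_mult (chi s \<xi>) (evolve g t \<xi>) U)"
        unfolding chi_evolve[OF s elim] e by (simp add: norm_mult mult.assoc)
      also have "\<dots> \<le> exp (- \<delta> * norm \<xi>) * ((1 + real CARD('m)) * (\<Sum>T\<in>UNIV. cmod (evolve g t \<xi> T)))"
        by (intro mult_left_mono cl_mult_chi_norm[OF s]) auto
      also have "\<dots> = (1 + real CARD('m)) * (\<Sum>T\<in>UNIV. cmod (evolve g t \<xi> T * of_real (exp (- \<delta> * norm \<xi>))))"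
        by (simp add: norm_mult sum_distrib_right mult_ac flip: sum_distrib_right)
      also have "\<dots> \<le> norm ((1 + real CARD('m)) * (\<Sum>T\<in>UNIV. cmod (evolve g t \<xi> T * of_real (exp (- \<delta> * norm \<xi>)))))"
        unfolding real_norm_def by (rule abs_ge_self)
      finally show ?case .
    qed
  qed measurable
qed

lemma evolve_integrable:
  assumes g: "spectrum g" and t: "\<bar>t\<bar> < a"
  shows "integrable lborel (\<lambda>\<xi>. evolve g t \<xi> U)"
  unfolding evolve_def
  using chi_weighted_integrable[OF g, of "-t" 1 U] chi_weighted_integrable[OF g, of t "-1" U] t
  by (intro Bochner_Integration.integrable_add) auto

text \<open>The multiplication formula pairs a truncated slice with a modulated Gaussian, whose
  transform is the kernel centred at y. Then R tends to infinity: on the left by the weighted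
  convergence in \<open>spectrum\<close>, on the right by dominated convergence.\<close>

lemma gauss_regularized_inversion:
  assumes g: "spectrum g" and t: "good t" and s: "s > 0"
  shows "(\<integral>\<xi>. evolve g t \<xi> U * (exp (\<i> * complex_of_real (\<xi> \<bullet> y)) * of_real (exp (- (s\<^sup>2 * (norm \<xi>)\<^sup>2) / 2))) \<partial>lborel)
    = (2 * pi) ^ CARD('m) * (\<integral>x. of_real (gauss_kernel s (y - x)) * F U (t, x) \<partial>lborel)"
proof -
  have ta: "\<bar>t\<bar> < a" using t by (simp add: good_def)
  have [measurable]: "(\<lambda>\<xi>. evolve g t \<xi> U) \<in> borel_measurable borel" by (rule spectrum_evolve_measurable[OF g])
  define \<psi> where "\<psi> \<xi> = exp (\<i> * complex_of_real (\<xi> \<bullet> y)) * of_real (exp (- (s\<^sup>2 * (norm \<xi>)\<^sup>2) / 2))" for \<xi> :: "real ^ 'm::{finite,linorder}"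
  have [measurable]: "\<psi> \<in> borel_measurable borel" unfolding \<psi>_def by measurable
  have \<psi>n: "cmod (\<psi> \<xi>) = exp (- (s\<^sup>2 * (norm \<xi>)\<^sup>2) / 2)" for \<xi> unfolding \<psi>_def by (simp add: norm_mult)
  have \<psi>: "integrable lborel \<psi>"
    using gauss_vec(1)[OF s, of "- y"] unfolding \<psi>_def by simp
  have f\<psi>: "fourier_int \<psi> x = of_real ((2 * pi) ^ CARD('m) * gauss_kernel s (y - x))" for x
  proof -
    have "exp (- \<i> * complex_of_real (\<xi> \<bullet> x)) * \<psi> \<xi> = exp (- \<i> * complex_of_real (\<xi> \<bullet> (x - y))) * of_real (exp (- (s\<^sup>2 * (norm \<xi>)\<^sup>2) / 2))" for \<xi>
    proof -
      have "exp (- \<i> * complex_of_real (\<xi> \<bullet> (x - y))) = exp (- \<i> * complex_of_real (\<xi> \<bullet> x)) * exp (\<i> * complex_of_real (\<xi> \<bullet> y))"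
        unfolding exp_add[symmetric] by (simp add: inner_diff_right algebra_simps)
      then show ?thesis unfolding \<psi>_def by (simp only: mult.assoc)
    qed
    then have "fourier_int \<psi> x = fourier_int (\<lambda>\<xi>. of_real (exp (- (s\<^sup>2 * (norm \<xi>)\<^sup>2) / 2))) (x - y)"
      unfolding fourier_int_def by simp
    then show ?thesis unfolding gauss_vec(2)[OF s] by (simp add: gauss_kernel_def norm_minus_commute)
  qed
  have eq: "(\<integral>\<xi>. vhat (real (Suc n)) t \<xi> U * \<psi> \<xi> \<partial>lborel)
     = (\<integral>x. of_real (cutoff (real (Suc n)) x) * F U (t, x) * of_real ((2 * pi) ^ CARD('m) * gauss_kernel s (y - x)) \<partial>lborel)" for n
    unfolding vhat_def by (subst fourier_int_multiplication[OF slice_integrable(1)[OF _ ta] \<psi>]) (auto simp: f\<psi>)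
  define b where "b = 2 * a + 1"
  \<comment> \<open>From completing the square: s^2 n^2 / 2 is at least b n - b^2/(2 s^2). Hence the
    Gaussian is dominated by the weight of exponent b = 2a + 1.\<close>
  define M where "M = exp (b\<^sup>2 / (2 * s\<^sup>2))"
  have M: "cmod (\<psi> \<xi>) \<le> M * exp (- b * norm \<xi>)" for \<xi>
  proof -
    have "0 \<le> (s * norm \<xi> - b / s)\<^sup>2" by simp
    also have "\<dots> = s\<^sup>2 * (norm \<xi>)\<^sup>2 - 2 * (b * norm \<xi>) + b\<^sup>2 / s\<^sup>2"
      using s by (simp add: power2_diff power_mult_distrib power_divide)
    finally have "- (s\<^sup>2 * (norm \<xi>)\<^sup>2) / 2 \<le> b\<^sup>2 / (2 * s\<^sup>2) + - b * norm \<xi>"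
      by (simp add: field_simps)
    then show ?thesis unfolding \<psi>n M_def by (simp only: exp_add[symmetric] exp_le_cancel_iff)
  qed
  have L: "(\<lambda>n. \<integral>\<xi>. vhat (real (Suc n)) t \<xi> U * \<psi> \<xi> \<partial>lborel) \<longlonglongrightarrow> (\<integral>\<xi>. evolve g t \<xi> U * \<psi> \<xi> \<partial>lborel)"
  proof (rule LIM_zero_cancel, rule tendsto_norm_zero_cancel)
    have iv: "integrable lborel (\<lambda>\<xi>. vhat (real (Suc n)) t \<xi> U * \<psi> \<xi>)" for n
    proof (rule Bochner_Integration.integrable_bound)
      show "integrable lborel (\<lambda>\<xi>. of_real M * (vhat (real (Suc n)) t \<xi> U * of_real (exp (- b * norm \<xi>))))"
        by (intro integrable_mult_right vhat_weighted_integrable) (use ta a_pos in \<open>auto simp: b_def\<close>)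
      show "AE \<xi> in lborel. norm (vhat (real (Suc n)) t \<xi> U * \<psi> \<xi>) \<le> norm (of_real M * (vhat (real (Suc n)) t \<xi> U * of_real (exp (- b * norm \<xi>))))"
      proof (intro always_eventually allI)
        fix \<xi>
        have "M > 0" by (simp add: M_def)
        have "cmod (vhat (real (Suc n)) t \<xi> U) * cmod (\<psi> \<xi>) \<le> cmod (vhat (real (Suc n)) t \<xi> U) * (M * exp (- b * norm \<xi>))"
          by (intro mult_left_mono M) auto
        then show "norm (vhat (real (Suc n)) t \<xi> U * \<psi> \<xi>) \<le> norm (of_real M * (vhat (real (Suc n)) t \<xi> U * of_real (exp (- b * norm \<xi>))))"
          using \<open>M > 0\<close> by (simp add: norm_mult mult_ac)
      qed
    qed measurable
    have ie: "integrable lborel (\<lambda>\<xi>. evolve g t \<xi> U * \<psi> \<xi>)"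
      by (rule Bochner_Integration.integrable_bound[OF evolve_integrable[OF g ta, of U]])
         (auto simp: norm_mult \<psi>n intro!: always_eventually mult_left_le)
    have le: "ennreal (cmod ((\<integral>\<xi>. vhat (real (Suc n)) t \<xi> U * \<psi> \<xi> \<partial>lborel) - (\<integral>\<xi>. evolve g t \<xi> U * \<psi> \<xi> \<partial>lborel)))
      \<le> ennreal M * (\<integral>\<^sup>+\<xi>. ennreal (cmod (vhat (real (Suc n)) t \<xi> U - evolve g t \<xi> U) * exp (- b * norm \<xi>)) \<partial>lborel)" for n
    proof -
      have "(\<integral>\<xi>. vhat (real (Suc n)) t \<xi> U * \<psi> \<xi> \<partial>lborel) - (\<integral>\<xi>. evolve g t \<xi> U * \<psi> \<xi> \<partial>lborel)
         = (\<integral>\<xi>. vhat (real (Suc n)) t \<xi> U * \<psi> \<xi> - evolve g t \<xi> U * \<psi> \<xi> \<partial>lborel)"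
        using iv ie by (rule Bochner_Integration.integral_diff[symmetric])
      also have "ennreal (cmod \<dots>) \<le> (\<integral>\<^sup>+\<xi>. ennreal (cmod (vhat (real (Suc n)) t \<xi> U * \<psi> \<xi> - evolve g t \<xi> U * \<psi> \<xi>)) \<partial>lborel)"
        using iv ie by (intro integral_norm_bound_ennreal Bochner_Integration.integrable_diff)
      also have "\<dots> \<le> (\<integral>\<^sup>+\<xi>. ennreal M * ennreal (cmod (vhat (real (Suc n)) t \<xi> U - evolve g t \<xi> U) * exp (- b * norm \<xi>)) \<partial>lborel)"
      proof (intro nn_integral_mono)
        fix \<xi>
        have "cmod (vhat (real (Suc n)) t \<xi> U - evolve g t \<xi> U) * cmod (\<psi> \<xi>) \<le> cmod (vhat (real (Suc n)) t \<xi> U - evolve g t \<xi> U) * (M * exp (- b * norm \<xi>))"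
          by (intro mult_left_mono M) auto
        then have "cmod (vhat (real (Suc n)) t \<xi> U * \<psi> \<xi> - evolve g t \<xi> U * \<psi> \<xi>) \<le> M * (cmod (vhat (real (Suc n)) t \<xi> U - evolve g t \<xi> U) * exp (- b * norm \<xi>))"
          unfolding left_diff_distrib[symmetric] norm_mult by (simp only: mult_ac)
        then show "ennreal (cmod (vhat (real (Suc n)) t \<xi> U * \<psi> \<xi> - evolve g t \<xi> U * \<psi> \<xi>)) \<le> ennreal M * ennreal (cmod (vhat (real (Suc n)) t \<xi> U - evolve g t \<xi> U) * exp (- b * norm \<xi>))"
          by (subst ennreal_mult[symmetric]) (auto simp: M_def intro: ennreal_leI)
      qed
      also have "\<dots> = ennreal M * (\<integral>\<^sup>+\<xi>. ennreal (cmod (vhat (real (Suc n)) t \<xi> U - evolve g t \<xi> U) * exp (- b * norm \<xi>)) \<partial>lborel)"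
        by (rule nn_integral_cmult) measurable
      finally show ?thesis .
    qed
    have "(\<lambda>n. ennreal M * (\<integral>\<^sup>+\<xi>. ennreal (cmod (vhat (real (Suc n)) t \<xi> U - evolve g t \<xi> U) * exp (- b * norm \<xi>)) \<partial>lborel)) \<longlonglongrightarrow> ennreal M * 0"
      by (intro ennreal_tendsto_cmult) (use g ta in \<open>auto simp: spectrum_def b_def\<close>)
    then have lim0: "(\<lambda>n. ennreal M * (\<integral>\<^sup>+\<xi>. ennreal (cmod (vhat (real (Suc n)) t \<xi> U - evolve g t \<xi> U) * exp (- b * norm \<xi>)) \<partial>lborel)) \<longlonglongrightarrow> 0"
      by simp
    have "(\<lambda>n. ennreal (cmod ((\<integral>\<xi>. vhat (real (Suc n)) t \<xi> U * \<psi> \<xi> \<partial>lborel) - (\<integral>\<xi>. evolve g t \<xi> U * \<psi> \<xi> \<partial>lborel)))) \<longlonglongrightarrow> ennreal 0"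
      using ennreal_squeeze_0[OF le lim0] by simp
    then show "(\<lambda>n. norm ((\<integral>\<xi>. vhat (real (Suc n)) t \<xi> U * \<psi> \<xi> \<partial>lborel) - (\<integral>\<xi>. evolve g t \<xi> U * \<psi> \<xi> \<partial>lborel))) \<longlonglongrightarrow> 0"
      by (subst (asm) tendsto_ennreal_iff) auto
  qed
  have D: "(\<lambda>n. \<integral>x. of_real (cutoff (real (Suc n)) x) * F U (t, x) * of_real ((2 * pi) ^ CARD('m) * gauss_kernel s (y - x)) \<partial>lborel)
     \<longlonglongrightarrow> (\<integral>x. 1 * F U (t, x) * of_real ((2 * pi) ^ CARD('m) * gauss_kernel s (y - x)) \<partial>lborel)"
  proof (rule integral_dominated_convergence)
    \<comment> \<open>The supremum of the kernel. From |F| <= 1 + |F|^p, the term 1 is paired with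
      the integrable kernel, and the integrable |F|^p with the bound \<open>B\<close>.\<close>
    define B where "B = (1 / (sqrt (2 * pi) * s)) ^ CARD('m)"
    have fp: "integrable lborel (\<lambda>x. cmod (F U (t, x)) powr p)"
      using component_power_le[of U t] t by (intro integrableI_bounded) (auto simp: good_def intro: le_less_trans)
    have gi: "integrable lborel (\<lambda>x::real^'m::{finite,linorder}. gauss_kernel s (y - x))"
      by (subst integrable_reflect_iff) (auto intro: gauss_kernel_integral s)
    show "integrable lborel (\<lambda>x. (2 * pi) ^ CARD('m) * (gauss_kernel s (y - x) + B * cmod (F U (t, x)) powr p))"
      using fp gi by auto
    show "AE x in lborel. norm (of_real (cutoff (real (Suc n)) x) * F U (t, x) * of_real ((2 * pi) ^ CARD('m) * gauss_kernel s (y - x)))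
       \<le> (2 * pi) ^ CARD('m) * (gauss_kernel s (y - x) + B * cmod (F U (t, x)) powr p)" for n
    proof (intro always_eventually allI)
      fix x
      define z where "z = cmod (F U (t, x))"
      have z: "z \<ge> 0" by (simp add: z_def)
      have z1: "z \<le> 1 + z powr p" by (rule le_one_plus_powr[OF p(1) z])
      have g0: "gauss_kernel s (y - x) \<ge> 0" by (rule gauss_kernel_nonneg[OF s])
      have gB: "gauss_kernel s (y - x) \<le> B" unfolding gauss_kernel_def B_def using s by (intro mult_left_le) auto
      have "cutoff (real (Suc n)) x * z * gauss_kernel s (y - x) \<le> 1 * (1 + z powr p) * gauss_kernel s (y - x)"
        using cutoff_range[of "real (Suc n)" x] z z1 g0 by (intro mult_mono) auto
      also have "\<dots> \<le> gauss_kernel s (y - x) + B * z powr p"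
        using mult_right_mono[OF gB, of "z powr p"] by (simp add: algebra_simps)
      finally have "(2 * pi) ^ CARD('m) * (cutoff (real (Suc n)) x * z * gauss_kernel s (y - x)) \<le> (2 * pi) ^ CARD('m) * (gauss_kernel s (y - x) + B * z powr p)"
        by (intro mult_left_mono) auto
      then show "norm (of_real (cutoff (real (Suc n)) x) * F U (t, x) * of_real ((2 * pi) ^ CARD('m) * gauss_kernel s (y - x)))
       \<le> (2 * pi) ^ CARD('m) * (gauss_kernel s (y - x) + B * cmod (F U (t, x)) powr p)"
        using cutoff_range[of "real (Suc n)" x] g0 unfolding z_def norm_mult norm_of_real abs_mult
        by (simp add: abs_of_nonneg mult_ac)
    qed
    show "AE x in lborel. (\<lambda>n. of_real (cutoff (real (Suc n)) x) * F U (t, x) * of_real ((2 * pi) ^ CARD('m) * gauss_kernel s (y - x)))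
      \<longlonglongrightarrow> 1 * F U (t, x) * of_real ((2 * pi) ^ CARD('m) * gauss_kernel s (y - x))"
    proof -
      have "(\<lambda>n. complex_of_real (cutoff (real (Suc n)) x)) \<longlonglongrightarrow> of_real 1" for x :: "real ^ 'm::{finite,linorder}"
        by (intro tendsto_of_real cutoff_tendsto)
      then show ?thesis by (intro always_eventually allI tendsto_mult tendsto_const) simp
    qed
  qed measurable
  have "(\<integral>\<xi>. evolve g t \<xi> U * \<psi> \<xi> \<partial>lborel) = (\<integral>x. 1 * F U (t, x) * of_real ((2 * pi) ^ CARD('m) * gauss_kernel s (y - x)) \<partial>lborel)"
    using L D unfolding eq by (rule LIMSEQ_unique)
  also have "\<dots> = (2 * pi) ^ CARD('m) * (\<integral>x. of_real (gauss_kernel s (y - x)) * F U (t, x) \<partial>lborel)"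
    by (simp add: mult_ac flip: integral_mult_right_zero)
  finally show ?thesis unfolding \<psi>_def .
qed

text \<open>Let the Gaussian parameter tend to 0: the left side is dominated by |evolve g t|, and on
  the right the kernel recovers f at a point of continuity.\<close>

lemma inversion_good:
  assumes g: "spectrum g" and t: "good t"
  shows "(\<integral>\<xi>. exp (\<i> * complex_of_real (\<xi> \<bullet> y)) * evolve g t \<xi> U \<partial>lborel) = (2 * pi) ^ CARD('m) * f (t, y) U"
proof -
  have ta: "\<bar>t\<bar> < a" using t by (simp add: good_def)
  have [measurable]: "(\<lambda>\<xi>. evolve g t \<xi> U) \<in> borel_measurable borel" by (rule spectrum_evolve_measurable[OF g])
  define G where "G k \<xi> = exp (- ((1 / real (Suc k))\<^sup>2 * (norm \<xi>)\<^sup>2) / 2)" for k and \<xi> :: "real ^ 'm::{finite,linorder}"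
  have "(\<lambda>k. \<integral>\<xi>. evolve g t \<xi> U * (exp (\<i> * complex_of_real (\<xi> \<bullet> y)) * of_real (G k \<xi>)) \<partial>lborel)
    \<longlonglongrightarrow> (\<integral>\<xi>. evolve g t \<xi> U * (exp (\<i> * complex_of_real (\<xi> \<bullet> y)) * of_real 1) \<partial>lborel)"
  proof (rule integral_dominated_convergence)
    show "integrable lborel (\<lambda>\<xi>. cmod (evolve g t \<xi> U))" using evolve_integrable[OF g ta] by auto
    show "AE \<xi> in lborel. (\<lambda>k. evolve g t \<xi> U * (exp (\<i> * complex_of_real (\<xi> \<bullet> y)) * of_real (G k \<xi>))) \<longlonglongrightarrow> evolve g t \<xi> U * (exp (\<i> * complex_of_real (\<xi> \<bullet> y)) * of_real 1)"
    proof (intro always_eventually allI tendsto_mult tendsto_const tendsto_of_real)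
      fix \<xi> :: "real ^ 'm::{finite,linorder}"
      have "(\<lambda>k. G k \<xi>) \<longlonglongrightarrow> exp (- (0\<^sup>2 * (norm \<xi>)\<^sup>2) / 2)"
        unfolding G_def by (intro tendsto_intros LIMSEQ_Suc lim_1_over_n) auto
      then show "(\<lambda>k. G k \<xi>) \<longlonglongrightarrow> 1" by simp
    qed
    show "AE \<xi> in lborel. norm (evolve g t \<xi> U * (exp (\<i> * complex_of_real (\<xi> \<bullet> y)) * of_real (G k \<xi>))) \<le> cmod (evolve g t \<xi> U)" for k
      by (intro always_eventually allI) (auto simp: norm_mult G_def intro!: mult_left_le)
  qed (auto simp: G_def)
  moreover have "(\<integral>\<xi>. evolve g t \<xi> U * (exp (\<i> * complex_of_real (\<xi> \<bullet> y)) * of_real (G k \<xi>)) \<partial>lborel)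
    = (2 * pi) ^ CARD('m) * (\<integral>x. of_real (gauss_kernel (1 / real (Suc k)) (y - x)) * F U (t, x) \<partial>lborel)" for k
    unfolding G_def by (rule gauss_regularized_inversion[OF g t]) simp
  moreover have "(\<lambda>k. (2 * pi) ^ CARD('m) * (\<integral>x. of_real (gauss_kernel (1 / real (Suc k)) (y - x)) * F U (t, x) \<partial>lborel)) \<longlonglongrightarrow> (2 * pi) ^ CARD('m) * F U (t, y)"
  proof (intro tendsto_mult tendsto_const gauss_kernel_approx[where b="\<lambda>x. cmod (F U (t, x)) powr p" and M=1])
    show "integrable lborel (\<lambda>x. cmod (F U (t, x)) powr p)"
      using component_power_le[of U t] t by (intro integrableI_bounded) (auto simp: good_def intro: le_less_trans)
    show "cmod (F U (t, x)) \<le> 1 + cmod (F U (t, x)) powr p" for x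
      by (rule le_one_plus_powr[OF p(1) norm_ge_zero])
    have "continuous_on UNIV (\<lambda>x. F U (t, x))"
      using slice_continuous[OF f_continuous ta] ta by (simp add: F_inside)
    then show "isCont (\<lambda>x. F U (t, x)) y" by (simp add: continuous_on_eq_continuous_at)
  qed auto
  ultimately have "(\<integral>\<xi>. evolve g t \<xi> U * (exp (\<i> * complex_of_real (\<xi> \<bullet> y)) * of_real 1) \<partial>lborel) = (2 * pi) ^ CARD('m) * F U (t, y)"
    by (simp add: LIMSEQ_unique)
  then show ?thesis using ta by (simp add: F_inside mult.commute)
qed

text \<open>A general height is approached through good ones. The left side passes to the limit by
  the exponential decay of the projections of g, the right side by continuity of f. Height 0 is
  covered as well.\<close>

lemma inversion:
  assumes g: "spectrum g" and t: "\<bar>t\<bar> < a"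
  shows "(\<integral>\<xi>. exp (\<i> * complex_of_real (\<xi> \<bullet> y)) * evolve g t \<xi> U \<partial>lborel) = (2 * pi) ^ CARD('m) * f (t, y) U"
proof -
  \<comment> \<open>Halfway between |t| and a: room for the approximating heights, while
    e^(b|\<xi>|) still leaves both projections integrable.\<close>
  define b where "b = (\<bar>t\<bar> + a) / 2"
  have b: "\<bar>t\<bar> < b" "b < a" using t by (auto simp: b_def)
  have "\<exists>\<tau>. good \<tau> \<and> t < \<tau> \<and> \<tau> < t + (b - \<bar>t\<bar>) / real (Suc k)" for k
  proof -
    have "(b - \<bar>t\<bar>) / real (Suc k) > 0" using b by simp
    moreover have "(b - \<bar>t\<bar>) / real (Suc k) \<le> b - \<bar>t\<bar>" using b by (simp add: divide_le_eq mult_le_cancel_left1)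
    ultimately have "t < t + (b - \<bar>t\<bar>) / real (Suc k)" "- a \<le> t" "t + (b - \<bar>t\<bar>) / real (Suc k) \<le> a"
      using b by auto
    from good_between[OF this] show ?thesis by blast
  qed
  then obtain \<tau> where \<tau>: "\<And>k. good (\<tau> k)" "\<And>k. t < \<tau> k" "\<And>k. \<tau> k < t + (b - \<bar>t\<bar>) / real (Suc k)"
    by metis
  have \<tau>b: "\<bar>\<tau> k\<bar> \<le> b" for k
  proof -
    have "(b - \<bar>t\<bar>) / real (Suc k) \<le> b - \<bar>t\<bar>" using b by (simp add: divide_le_eq mult_le_cancel_left1)
    then show ?thesis using \<tau>(2)[of k] \<tau>(3)[of k] b by linarith
  qed
  have lim: "\<tau> \<longlonglongrightarrow> t"
  proof (rule tendsto_sandwich[OF _ _ tendsto_const[of t]])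
    have "(\<lambda>k. t + (b - \<bar>t\<bar>) / real (Suc k)) \<longlonglongrightarrow> t + 0" by (intro tendsto_intros) real_asymp
    then show "(\<lambda>k. t + (b - \<bar>t\<bar>) / real (Suc k)) \<longlonglongrightarrow> t" by simp
  qed (use \<tau> in \<open>auto intro!: always_eventually less_imp_le\<close>)
  have gm: "(\<lambda>\<xi>. g \<xi> T) \<in> borel_measurable borel" for T using g by (simp add: spectrum_def)
  have [measurable]: "(\<lambda>\<xi>. evolve g t \<xi> U) \<in> borel_measurable borel" for t by (rule spectrum_evolve_measurable[OF g])
  have "(\<lambda>k. \<integral>\<xi>. exp (\<i> * complex_of_real (\<xi> \<bullet> y)) * evolve g (\<tau> k) \<xi> U \<partial>lborel) \<longlonglongrightarrow> (\<integral>\<xi>. exp (\<i> * complex_of_real (\<xi> \<bullet> y)) * evolve g t \<xi> U \<partial>lborel)"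
  proof (rule integral_dominated_convergence)
    let ?w = "\<lambda>\<xi>. cmod (of_real (exp (b * norm \<xi>)) * cl_mult (chi 1 \<xi>) (g \<xi>) U) + cmod (of_real (exp (b * norm \<xi>)) * cl_mult (chi (-1) \<xi>) (g \<xi>) U)"
    show "integrable lborel ?w"
      by (intro Bochner_Integration.integrable_add integrable_norm chi_weighted_integrable g) (use b t in auto)
    show "AE \<xi> in lborel. norm (exp (\<i> * complex_of_real (\<xi> \<bullet> y)) * evolve g (\<tau> k) \<xi> U) \<le> ?w \<xi>" for k
    proof (intro always_eventually allI)
      fix \<xi> :: "real ^ 'm::{finite,linorder}"
      have "- \<tau> k \<le> b" "\<tau> k \<le> b" using \<tau>b[of k] by auto
      then have e: "exp (- \<tau> k * norm \<xi>) \<le> exp (b * norm \<xi>)" "exp (\<tau> k * norm \<xi>) \<le> exp (b * norm \<xi>)"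
        unfolding exp_le_cancel_iff by (intro mult_right_mono; simp)+
      have "cmod (evolve g (\<tau> k) \<xi> U) \<le> exp (- \<tau> k * norm \<xi>) * cmod (cl_mult (chi 1 \<xi>) (g \<xi>) U) + exp (\<tau> k * norm \<xi>) * cmod (cl_mult (chi (-1) \<xi>) (g \<xi>) U)"
        unfolding evolve_def by (rule order_trans[OF norm_triangle_ineq]) (simp add: norm_mult)
      also have "\<dots> \<le> ?w \<xi>"
        unfolding norm_mult norm_of_real abs_exp_cancel by (intro add_mono mult_right_mono e) auto
      finally show "norm (exp (\<i> * complex_of_real (\<xi> \<bullet> y)) * evolve g (\<tau> k) \<xi> U) \<le> ?w \<xi>"
        by (simp add: norm_mult)
    qed
    show "AE \<xi> in lborel. (\<lambda>k. exp (\<i> * complex_of_real (\<xi> \<bullet> y)) * evolve g (\<tau> k) \<xi> U) \<longlonglongrightarrow> exp (\<i> * complex_of_real (\<xi> \<bullet> y)) * evolve g t \<xi> U"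
      unfolding evolve_def by (intro always_eventually allI tendsto_intros lim)
  qed measurable
  moreover have "(\<lambda>k. (2 * pi) ^ CARD('m) * f (\<tau> k, y) U) \<longlonglongrightarrow> (2 * pi) ^ CARD('m) * f (t, y) U"
  proof (intro tendsto_mult tendsto_const)
    have "isCont (\<lambda>z. f z U) (t, y)"
      using f_differentiable[OF t] by (rule differentiable_imp_continuous_within)
    moreover have "(\<lambda>k. (\<tau> k, y)) \<longlonglongrightarrow> (t, y)" by (intro tendsto_intros lim)
    ultimately show "(\<lambda>k. f (\<tau> k, y) U) \<longlonglongrightarrow> f (t, y) U" by (rule isCont_tendsto_compose)
  qed
  ultimately show ?thesis
    unfolding inversion_good[OF g \<tau>(1)] by (rule LIMSEQ_unique)
qed

end

subsection \<open>Estimates on the strip\<close>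

text \<open>A continuous test function need not have an integrable transform, so Fubini is not
  directly available. Both transforms are square integrable by Plancherel, which allows the Gaussian
  to be removed from the damped identity.\<close>

lemma fourier_parseval_test:
  fixes u \<phi> :: "real ^ 'm::finite \<Rightarrow> complex"
  assumes u: "integrable lborel u" and u2: "(\<integral>\<^sup>+x. ennreal ((cmod (u x))\<^sup>2) \<partial>lborel) < \<infinity>"
    and \<phi>: "continuous_on UNIV \<phi>" and R: "\<And>x. norm x \<ge> R \<Longrightarrow> \<phi> x = 0"
  shows "(\<integral>\<xi>. fourier_int u (- \<xi>) * fourier_int \<phi> \<xi> \<partial>lborel) = (2 * pi) ^ CARD('m) * (\<integral>x. u x * \<phi> x \<partial>lborel)"
proof -
  have i\<phi>: "integrable lborel \<phi>" by (rule compact_support_integral(1)[OF \<phi> R])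
  have [measurable]: "u \<in> borel_measurable borel" "\<phi> \<in> borel_measurable borel" using u i\<phi> by auto
  have \<phi>2: "(\<integral>\<^sup>+x. ennreal ((cmod (\<phi> x))\<^sup>2) \<partial>lborel) < \<infinity>"
  proof -
    have "integrable lborel (\<lambda>x. (cmod (\<phi> x))\<^sup>2)"
      by (rule compact_support_integral(1)[where R=R]) (use \<phi> R in \<open>auto intro!: continuous_intros\<close>)
    then show ?thesis by (simp add: integrable_iff_bounded)
  qed
  have L2: "integrable lborel (\<lambda>\<xi>. (cmod (fourier_int v \<xi>))\<^sup>2)"
    if v: "integrable lborel v" "(\<integral>\<^sup>+x. ennreal ((cmod (v x))\<^sup>2) \<partial>lborel) < \<infinity>" for v :: "real ^ 'm \<Rightarrow> complex"
  proof (rule integrableI_bounded)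
    have [measurable]: "v \<in> borel_measurable borel" using v by auto
    show "(\<lambda>\<xi>. (cmod (fourier_int v \<xi>))\<^sup>2) \<in> borel_measurable lborel" by measurable
    show "(\<integral>\<^sup>+\<xi>. ennreal (norm ((cmod (fourier_int v \<xi>))\<^sup>2)) \<partial>lborel) < \<infinity>"
      using order_le_less_trans[OF plancherel_bound[OF v(1)]] v(2) by (auto simp: ennreal_mult_less_top less_top)
  qed
  obtain M where M: "\<And>x. cmod (\<phi> x) \<le> M"
  proof -
    have "compact (\<phi> ` cball 0 R)" by (intro compact_continuous_image continuous_on_subset[OF \<phi>]) auto
    then have "bounded (\<phi> ` cball 0 R)" by (rule compact_imp_bounded)
    then obtain B where "\<forall>z\<in>\<phi> ` cball 0 R. norm z \<le> B" by (auto simp only: bounded_iff)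
    then have B: "cmod (\<phi> x) \<le> B" if "norm x \<le> R" for x using that by auto
    have "cmod (\<phi> x) \<le> max 0 B" for x
    proof (cases "norm x \<le> R")
      case True then show ?thesis by (intro max.coboundedI2 B)
    next
      case False then show ?thesis using R[of x] by simp
    qed
    then show thesis by (rule that)
  qed
  define G where "G k \<xi> = exp (- ((1 / real (Suc k))\<^sup>2 * (norm \<xi>)\<^sup>2) / 2)" for k and \<xi> :: "real ^ 'm"
  have [measurable]: "G k \<in> borel_measurable borel" for k unfolding G_def by measurable
  have eq: "(\<integral>\<xi>. fourier_int u (- \<xi>) * (fourier_int \<phi> \<xi> * of_real (G k \<xi>)) \<partial>lborel)
     = (2 * pi) ^ CARD('m) * (\<integral>x. u x * (\<integral>y. of_real (gauss_kernel (1 / real (Suc k)) (x - y)) * \<phi> y \<partial>lborel) \<partial>lborel)" for k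
  proof -
    have "(\<integral>\<xi>. fourier_int u (0 - \<xi>) * (fourier_int \<phi> (- (0 - \<xi>)) * of_real (G k (0 - \<xi>))) \<partial>lborel)
       = (\<integral>\<xi>. fourier_int u \<xi> * (fourier_int \<phi> (- \<xi>) * of_real (G k \<xi>)) \<partial>lborel)"
      by (rule integral_reflect) measurable
    then have "(\<integral>\<xi>. fourier_int u (- \<xi>) * (fourier_int \<phi> \<xi> * of_real (G k \<xi>)) \<partial>lborel)
       = (\<integral>\<xi>. fourier_int u \<xi> * (fourier_int \<phi> (- \<xi>) * of_real (G k \<xi>)) \<partial>lborel)"
      by (simp add: G_def)
    also have "\<dots> = (2 * pi) ^ CARD('m) * (\<integral>x. u x * (\<integral>y. of_real (gauss_kernel (1 / real (Suc k)) (x - y)) * \<phi> y \<partial>lborel) \<partial>lborel)"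
      unfolding G_def by (rule fourier_int_gauss_bilinear[OF u i\<phi>]) simp
    finally show ?thesis .
  qed
  have "(\<lambda>k. \<integral>\<xi>. fourier_int u (- \<xi>) * (fourier_int \<phi> \<xi> * of_real (G k \<xi>)) \<partial>lborel)
     \<longlonglongrightarrow> (\<integral>\<xi>. fourier_int u (- \<xi>) * (fourier_int \<phi> \<xi> * of_real 1) \<partial>lborel)"
  proof (rule integral_dominated_convergence)
    have "integrable lborel (\<lambda>\<xi>. (cmod (fourier_int u (0 - \<xi>)))\<^sup>2)"
      by (subst integrable_reflect_iff) (use L2[OF u u2] in auto)
    then show "integrable lborel (\<lambda>\<xi>. (cmod (fourier_int u (- \<xi>)))\<^sup>2 + (cmod (fourier_int \<phi> \<xi>))\<^sup>2)"
      using L2[OF i\<phi> \<phi>2] by simp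
    show "AE \<xi> in lborel. norm (fourier_int u (- \<xi>) * (fourier_int \<phi> \<xi> * of_real (G k \<xi>))) \<le> (cmod (fourier_int u (- \<xi>)))\<^sup>2 + (cmod (fourier_int \<phi> \<xi>))\<^sup>2" for k
    proof (intro always_eventually allI)
      fix \<xi>
      \<comment> \<open>The product of two square integrable functions is dominated by the sum of
        their squares.\<close>
      define A B where "A = cmod (fourier_int u (- \<xi>))" and "B = cmod (fourier_int \<phi> \<xi>)"
      have AB: "A \<ge> 0" "B \<ge> 0" by (auto simp: A_def B_def)
      have "G k \<xi> \<le> 1" by (simp add: G_def)
      then have "A * (B * G k \<xi>) \<le> A * (B * 1)" using AB by (intro mult_left_mono) auto
      also have "\<dots> \<le> A\<^sup>2 + B\<^sup>2" using sum_squares_bound[of A B] mult_nonneg_nonneg[OF AB] by linarith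
      finally show "norm (fourier_int u (- \<xi>) * (fourier_int \<phi> \<xi> * of_real (G k \<xi>))) \<le> (cmod (fourier_int u (- \<xi>)))\<^sup>2 + (cmod (fourier_int \<phi> \<xi>))\<^sup>2"
        unfolding A_def B_def by (simp add: norm_mult G_def)
    qed
    show "AE \<xi> in lborel. (\<lambda>k. fourier_int u (- \<xi>) * (fourier_int \<phi> \<xi> * of_real (G k \<xi>))) \<longlonglongrightarrow> fourier_int u (- \<xi>) * (fourier_int \<phi> \<xi> * of_real 1)"
    proof (intro always_eventually allI tendsto_mult tendsto_const tendsto_of_real)
      fix \<xi> :: "real ^ 'm"
      have "(\<lambda>k. G k \<xi>) \<longlonglongrightarrow> exp (- (0\<^sup>2 * (norm \<xi>)\<^sup>2) / 2)"
        unfolding G_def by (intro tendsto_intros LIMSEQ_Suc lim_1_over_n) auto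
      then show "(\<lambda>k. G k \<xi>) \<longlonglongrightarrow> 1" by simp
    qed
  qed measurable
  moreover have "(\<lambda>k. (2 * pi) ^ CARD('m) * (\<integral>x. u x * (\<integral>y. of_real (gauss_kernel (1 / real (Suc k)) (x - y)) * \<phi> y \<partial>lborel) \<partial>lborel))
     \<longlonglongrightarrow> (2 * pi) ^ CARD('m) * (\<integral>x. u x * \<phi> x \<partial>lborel)"
  proof (intro tendsto_mult tendsto_const integral_dominated_convergence)
    show "integrable lborel (\<lambda>x. cmod (u x) * M)" using u by auto
    show "AE x in lborel. (\<lambda>k. u x * (\<integral>y. of_real (gauss_kernel (1 / real (Suc k)) (x - y)) * \<phi> y \<partial>lborel)) \<longlonglongrightarrow> u x * \<phi> x"
    proof (intro always_eventually allI tendsto_mult tendsto_const gauss_kernel_approx[where b="\<lambda>_. 0" and M=M])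
      show "isCont \<phi> x" for x using \<phi> by (simp add: continuous_on_eq_continuous_at)
    qed (use M in auto)
    show "AE x in lborel. norm (u x * (\<integral>y. of_real (gauss_kernel (1 / real (Suc k)) (x - y)) * \<phi> y \<partial>lborel)) \<le> cmod (u x) * M" for k
    proof (intro always_eventually allI)
      fix x
      define s where "s = 1 / real (Suc k)"
      have s: "s > 0" by (simp add: s_def)
      have gi: "integrable lborel (\<lambda>y::real^'m. gauss_kernel s (x - y))"
        by (subst integrable_reflect_iff) (auto intro: gauss_kernel_integral s)
      have g1: "(\<integral>y. gauss_kernel s (x - y :: real^'m) \<partial>lborel) = 1"
        by (subst integral_reflect) (auto intro: gauss_kernel_integral s)
      have b: "cmod (of_real (gauss_kernel s (x - y)) * \<phi> y) \<le> gauss_kernel s (x - y) * M" for y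
        using M[of y] gauss_kernel_nonneg[OF s, of "x - y"] by (simp add: norm_mult mult_left_mono)
      have "cmod (\<integral>y. of_real (gauss_kernel s (x - y)) * \<phi> y \<partial>lborel) \<le> (\<integral>y. gauss_kernel s (x - y) * M \<partial>lborel)"
      proof (rule Bochner_Integration.integral_norm_bound_integral)
        show "integrable lborel (\<lambda>y. complex_of_real (gauss_kernel s (x - y)) * \<phi> y)"
          by (rule Bochner_Integration.integrable_bound[of lborel "\<lambda>y. gauss_kernel s (x - y) * M"])
             (use gi b in \<open>auto intro!: always_eventually order_trans[OF b abs_ge_self]\<close>)
      qed (use gi b in auto)
      then have "cmod (\<integral>y. of_real (gauss_kernel s (x - y)) * \<phi> y \<partial>lborel) \<le> M" using g1 by simp
      then show "norm (u x * (\<integral>y. of_real (gauss_kernel (1 / real (Suc k)) (x - y)) * \<phi> y \<partial>lborel)) \<le> cmod (u x) * M"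
        unfolding s_def norm_mult by (intro mult_left_mono) auto
    qed
  qed measurable
  ultimately have "(\<integral>\<xi>. fourier_int u (- \<xi>) * (fourier_int \<phi> \<xi> * of_real 1) \<partial>lborel) = (2 * pi) ^ CARD('m) * (\<integral>x. u x * \<phi> x \<partial>lborel)"
    unfolding eq by (rule LIMSEQ_unique)
  then show ?thesis by simp
qed

section \<open>Jensen's inequality and elementary estimates\<close>

lemma powr_tangent:
  fixes x y r :: real
  assumes "r \<ge> 1" "x \<ge> 0" "y > 0"
  shows "y powr r + r * y powr (r - 1) * (x - y) \<le> x powr r"
proof -
  have y: "y powr r = y powr (r - 1) * y" using assms by (simp add: powr_diff)
  show ?thesis
  proof (cases "x = 0")
    case True
    have "y powr (r - 1) * y \<le> r * (y powr (r - 1) * y)"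
      using assms mult_right_mono[of 1 r "y powr (r - 1) * y"] by simp
    then show ?thesis using True assms unfolding y by (simp add: mult.assoc)
  next
    case False
    then have x: "x > 0" using assms by simp
    define z where "z = x / y"
    have z: "z > 0" using x assms by (simp add: z_def)
    \<comment> \<open>Young's inequality with second factor 1 is Bernoulli's inequality for z = x/y,
      that is, the tangent at 1; scaling moves it to y.\<close>
    have "(z powr r) powr (1 / r) * 1 powr (1 - 1 / r) \<le> (1 / r) * z powr r + (1 - 1 / r) * 1"
      by (rule Youngs_inequality_0) (use assms z in auto)
    then have "z \<le> (1 / r) * z powr r + (1 - 1 / r)" using assms z by (simp add: powr_powr)
    then have "r * z \<le> r * ((1 / r) * z powr r + (1 - 1 / r))" using assms by (intro mult_left_mono) auto
    also have "\<dots> = z powr r + (r - 1)" using assms by (simp add: distrib_left right_diff_distrib)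
    finally have "1 + r * (z - 1) \<le> z powr r" by (simp add: algebra_simps)
    then have "y powr r * (1 + r * (z - 1)) \<le> y powr r * z powr r" by (intro mult_left_mono) auto
    also have "y powr r * z powr r = x powr r" using assms x by (simp add: z_def powr_divide)
    also have "y powr r * (1 + r * (z - 1)) = y powr r + r * y powr (r - 1) * (x - y)"
      using assms unfolding y z_def by (simp add: field_simps)
    finally show ?thesis .
  qed
qed

text \<open>Jensen for the r-th power, the probability measure (w/A) dM and the function k A / w,
  whose mean is the integral of k. The density must not vanish where k is nonzero.\<close>

lemma weighted_power_mean:
  fixes k w :: "'a \<Rightarrow> real"
  assumes k: "integrable M k" "\<And>x. k x \<ge> 0" and w: "integrable M w" "\<And>x. w x > 0 \<or> w x = 0 \<and> k x = 0"
    and A: "A = (\<integral>x. w x \<partial>M)" "A > 0" and r: "r \<ge> 1" and pos: "(\<integral>x. k x \<partial>M) > 0"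
  shows "ennreal ((\<integral>x. k x \<partial>M) powr r) \<le> ennreal (A powr (r - 1)) * (\<integral>\<^sup>+x. ennreal (k x powr r * w x powr (1 - r)) \<partial>M)"
proof -
  have [measurable]: "k \<in> borel_measurable M" "w \<in> borel_measurable M" using k w by auto
  define \<kappa> where "\<kappa> = (\<integral>x. k x \<partial>M)"
  define L where "L x = A powr (r - 1) * (k x powr r * w x powr (1 - r))" for x
  \<comment> \<open>The tangent at the mean \<kappa>, already multiplied by w/A. Its linear term
    integrates to 0, so its integral is \<kappa>^r.\<close>
  define T where "T x = \<kappa> powr r / A * w x + r * \<kappa> powr (r - 1) * (k x - \<kappa> / A * w x)" for x
  have [measurable]: "L \<in> borel_measurable M" unfolding L_def by measurable
  have TL: "T x \<le> L x" for x
  proof (cases "w x > 0")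
    case False
    then show ?thesis using w(2)[of x] r by (simp add: T_def L_def)
  next
    case wx: True
    have "\<kappa> powr r + r * \<kappa> powr (r - 1) * (k x * A / w x - \<kappa>) \<le> (k x * A / w x) powr r"
      by (rule powr_tangent) (use r k wx A pos in \<open>auto simp: \<kappa>_def\<close>)
    then have "(\<kappa> powr r + r * \<kappa> powr (r - 1) * (k x * A / w x - \<kappa>)) * (w x / A) \<le> (k x * A / w x) powr r * (w x / A)"
      using wx A by (intro mult_right_mono) auto
    also have "(\<kappa> powr r + r * \<kappa> powr (r - 1) * (k x * A / w x - \<kappa>)) * (w x / A) = T x"
      unfolding T_def using wx A(2) by (simp add: field_simps)
    also have "(k x * A / w x) powr r * (w x / A) = L x"
    proof -
      have "(k x * A / w x) powr r * (w x / A) = k x powr r * (A powr r / A) * (w x / w x powr r)"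
        using wx A(2) k(2)[of x] by (simp add: powr_divide powr_mult)
      also have "A powr r / A = A powr (r - 1)" using A(2) by (simp add: powr_diff)
      also have "w x / w x powr r = w x powr (1 - r)" using wx by (simp add: powr_diff)
      finally show ?thesis by (simp add: L_def)
    qed
    finally show ?thesis .
  qed
  have iT: "integrable M T" unfolding T_def using k w by auto
  have "(\<integral>x. T x \<partial>M) = \<kappa> powr r"
    unfolding T_def using k w A by (simp add: \<kappa>_def)
  have L0: "L x \<ge> 0" for x using A(2) by (simp add: L_def)
  have "ennreal (\<kappa> powr r) \<le> (\<integral>\<^sup>+x. ennreal (L x) \<partial>M)"
  proof (cases "(\<integral>\<^sup>+x. ennreal (L x) \<partial>M) = \<infinity>")
    case False
    have iL: "integrable M L"
      by (rule integrableI_nonneg) (use L0 False in \<open>auto simp: top.not_eq_extremum\<close>)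
    have "\<kappa> powr r \<le> (\<integral>x. L x \<partial>M)"
      unfolding \<open>(\<integral>x. T x \<partial>M) = \<kappa> powr r\<close>[symmetric] by (rule integral_mono[OF iT iL TL])
    then show ?thesis by (subst nn_integral_eq_integral[OF iL]) (auto simp: L0 ennreal_leI)
  qed simp
  also have "(\<integral>\<^sup>+x. ennreal (L x) \<partial>M) = ennreal (A powr (r - 1)) * (\<integral>\<^sup>+x. ennreal (k x powr r * w x powr (1 - r)) \<partial>M)"
    unfolding L_def by (subst nn_integral_cmult[symmetric]) (auto simp: ennreal_mult)
  finally show ?thesis unfolding \<kappa>_def .
qed

text \<open>Every summand is replaced by the largest one; the crude constant is absorbed into
  C.\<close>

lemma sum_powr_le:
  fixes x :: "'a \<Rightarrow> real"
  assumes "finite S" "\<And>i. i \<in> S \<Longrightarrow> x i \<ge> 0" "q > 0"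
  shows "(\<Sum>i\<in>S. x i) powr q \<le> real (card S) powr q * (\<Sum>i\<in>S. x i powr q)"
proof (cases "S = {}")
  case False
  define m where "m = Max (x ` S)"
  have "m \<in> x ` S" unfolding m_def by (rule Max_in) (use assms(1) False in auto)
  then obtain j where j: "j \<in> S" "x j = m" by auto
  have "(\<Sum>i\<in>S. x i) \<le> real (card S) * m"
    by (rule sum_bounded_above) (auto simp: m_def assms)
  then have "(\<Sum>i\<in>S. x i) powr q \<le> (real (card S) * m) powr q"
    using assms by (intro powr_mono2 sum_nonneg) auto
  also have "\<dots> = real (card S) powr q * x j powr q" using assms j by (simp add: powr_mult)
  also have "\<dots> \<le> real (card S) powr q * (\<Sum>i\<in>S. x i powr q)"
    by (intro mult_left_mono member_le_sum) (use j assms in auto)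
  finally show ?thesis .
qed (use assms in simp)

lemma exp_diff_ge: "x \<ge> 0 \<Longrightarrow> 2 * x \<le> exp x - exp (- x :: real)"
proof -
  assume x: "x \<ge> 0"
  have "exp 0 - exp (- 0) - 2 * 0 \<le> exp x - exp (- x) - 2 * x"
  proof (rule DERIV_nonneg_imp_nondecreasing[OF x])
    fix y :: real
    have "2 \<le> exp y + exp (- y)"
      using exp_ge_add_one_self[of y] exp_ge_add_one_self[of "- y"] by linarith
    then show "\<exists>d. ((\<lambda>x. exp x - exp (- x) - 2 * x) has_real_derivative d) (at y) \<and> 0 \<le> d"
      by (intro exI[of _ "exp y + exp (- y) - 2"]) (auto intro!: derivative_eq_intros)
  qed
  then show ?thesis by simp
qed

lemma exp_interval_integral:
  fixes a b :: real assumes a: "a > 0" and b: "b \<noteq> 0"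
  shows "integrable lborel (\<lambda>t. indicator {-a<..<a} t * exp (b * t))"
    and "(\<integral>t. indicator {-a<..<a} t * exp (b * t) \<partial>lborel) = (exp (b * a) - exp (- b * a)) / b"
proof -
  have "((\<lambda>t. exp (b * t)) has_integral (exp (b * a) / b - exp (b * (- a)) / b)) {-a..a}"
    by (rule fundamental_theorem_of_calculus)
       (use a b in \<open>auto intro!: derivative_eq_intros simp flip: has_real_derivative_iff_has_vector_derivative\<close>)
  then have h: "((\<lambda>t. exp (b * t)) has_integral (exp (b * a) - exp (- b * a)) / b) {-a<..<a}"
    by (simp add: has_integral_Icc_iff_Ioo diff_divide_distrib)
  have i: "set_integrable lborel {-a<..<a} (\<lambda>t. exp (b * t))"
    by (rule set_integrable_subset[of lborel "{-a..a}"]) (auto intro!: borel_integrable_atLeastAtMost' continuous_intros)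
  then show "integrable lborel (\<lambda>t. indicator {-a<..<a} t * exp (b * t))"
    unfolding set_integrable_def by simp
  from set_borel_integral_eq_integral(2)[OF i] h
  show "(\<integral>t. indicator {-a<..<a} t * exp (b * t) \<partial>lborel) = (exp (b * a) - exp (- b * a)) / b"
    unfolding set_lebesgue_integral_def by (simp add: integral_unique)
qed

lemma evolve_0: "evolve g 0 \<xi> U = g \<xi> U"
  unfolding evolve_def using cl_mult_chi_sum[of \<xi> "g \<xi>" U] by simp

lemma chi_evolve_cl_norm:
  fixes \<xi> :: "real ^ 'm::{finite,linorder}"
  assumes s: "s = 1 \<or> s = - 1" and \<xi>: "\<xi> \<noteq> 0"
  shows "exp (- s * t * norm \<xi>) * cl_norm (cl_mult (chi s \<xi>) (g \<xi>))
    \<le> (1 + real CARD('m)) * real CARD('m set) * (\<Sum>T\<in>UNIV. cmod (evolve g t \<xi> T))"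
proof -
  have "exp (- s * t * norm \<xi>) * cl_norm (cl_mult (chi s \<xi>) (g \<xi>)) \<le> exp (- s * t * norm \<xi>) * (\<Sum>U\<in>UNIV. cmod (cl_mult (chi s \<xi>) (g \<xi>) U))"
    by (intro mult_left_mono cl_norm_le_sum) auto
  also have "\<dots> = (\<Sum>U\<in>UNIV. cmod (cl_mult (chi s \<xi>) (evolve g t \<xi>) U))"
    unfolding chi_evolve[OF s \<xi>] by (simp add: norm_mult sum_distrib_left)
  also have "\<dots> \<le> real CARD('m set) * ((1 + real CARD('m)) * (\<Sum>T\<in>UNIV. cmod (evolve g t \<xi> T)))"
    by (intro sum_bounded_above cl_mult_chi_norm[OF s])
  finally show ?thesis by (simp add: mult_ac)
qed

lemma cl_norm_chi_split:
  fixes \<xi> :: "real ^ 'm::{finite,linorder}" and y :: "'m::{finite,linorder} clif"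
  shows "cl_norm y \<le> real CARD('m set) * (cl_norm (cl_mult (chi 1 \<xi>) y) + cl_norm (cl_mult (chi (-1) \<xi>) y))"
proof -
  have "cmod (y U) \<le> cl_norm (cl_mult (chi 1 \<xi>) y) + cl_norm (cl_mult (chi (-1) \<xi>) y)" for U
    using norm_triangle_ineq[of "cl_mult (chi 1 \<xi>) y U" "cl_mult (chi (-1) \<xi>) y U"]
      cl_norm_ge_component[of "cl_mult (chi 1 \<xi>) y" U] cl_norm_ge_component[of "cl_mult (chi (-1) \<xi>) y" U]
    unfolding cl_mult_chi_sum by linarith
  then have "(\<Sum>U\<in>UNIV. cmod (y U)) \<le> real CARD('m set) * (cl_norm (cl_mult (chi 1 \<xi>) y) + cl_norm (cl_mult (chi (-1) \<xi>) y))"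
    by (intro sum_bounded_above)
  then show ?thesis using cl_norm_le_sum[of y] by linarith
qed

section \<open>Representation, identification of the transform, slice estimates\<close>

context monogenic_Ap
begin

text \<open>The p-th power of the A^p norm, in which the slice masses integrate linearly.\<close>

definition S :: real where "S = enn2real (Ap_int a p f)"

text \<open>Infinite slice masses become 0 here. They occur only on a null set of heights, so the
  integral is unaffected.\<close>

definition Nr :: "real \<Rightarrow> real" where "Nr t = enn2real (N t)"

lemma S_nonneg: "0 \<le> S" by (simp add: S_def)

lemma Nr_nonneg: "0 \<le> Nr t" by (simp add: Nr_def)

lemma Nr_measurable [measurable]: "Nr \<in> borel_measurable borel"
  unfolding Nr_def by measurable

lemma nn_integral_Nr: "(\<integral>\<^sup>+t. ennreal (Nr t) \<partial>lborel) = ennreal S"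
proof -
  have "(\<integral>\<^sup>+t. ennreal (Nr t) \<partial>lborel) = (\<integral>\<^sup>+t. N t \<partial>lborel)"
  proof (rule nn_integral_cong_AE)
    show "AE t in lborel. ennreal (Nr t) = N t"
      using AE_good
    proof eventually_elim
      case (elim t)
      show ?case using elim good_N[of t] N_outside[of t] by (cases "\<bar>t\<bar> < a") (auto simp: Nr_def)
    qed
  qed
  also have "\<dots> = ennreal S" unfolding S_def Ap_int_eq[symmetric] using Ap_finite by simp
  finally show ?thesis .
qed

lemma Nr_integral: "integrable lborel Nr" "(\<integral>t. Nr t \<partial>lborel) = S"
proof -
  show i: "integrable lborel Nr"
    by (rule integrableI_nonneg) (auto simp: Nr_nonneg nn_integral_Nr)
  show "(\<integral>t. Nr t \<partial>lborel) = S"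
    using nn_integral_eq_integral[OF i] nn_integral_Nr Nr_nonneg S_nonneg by (simp add: integral_nonneg_AE)
qed

lemma Nr_outside: "\<not> \<bar>t\<bar> < a \<Longrightarrow> Nr t = 0"
  by (simp add: Nr_def N_outside)

lemma spectrum_modify:
  assumes g: "spectrum g" and m: "\<And>T. (\<lambda>\<xi>. g' \<xi> T) \<in> borel_measurable borel" and eq: "AE \<xi> in lborel. g' \<xi> = g \<xi>"
  shows "spectrum g'"
proof -
  have "(\<integral>\<^sup>+\<xi>. ennreal (cmod (vhat (real (Suc n)) t \<xi> U - evolve g' t \<xi> U) * exp (- (2 * a + 1) * norm \<xi>)) \<partial>lborel)
     = (\<integral>\<^sup>+\<xi>. ennreal (cmod (vhat (real (Suc n)) t \<xi> U - evolve g t \<xi> U) * exp (- (2 * a + 1) * norm \<xi>)) \<partial>lborel)" for n t U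
  proof (rule nn_integral_cong_AE)
    show "AE \<xi> in lborel. ennreal (cmod (vhat (real (Suc n)) t \<xi> U - evolve g' t \<xi> U) * exp (- (2 * a + 1) * norm \<xi>))
      = ennreal (cmod (vhat (real (Suc n)) t \<xi> U - evolve g t \<xi> U) * exp (- (2 * a + 1) * norm \<xi>))"
      using eq by eventually_elim (simp add: evolve_def)
  qed
  then show ?thesis using g m unfolding spectrum_def by simp
qed

lemma spectrum_integrable: "spectrum g \<Longrightarrow> integrable lborel (\<lambda>\<xi>. g \<xi> T)"
  using evolve_integrable[of g 0 T] a_pos by (simp add: evolve_0)

lemma spectrum_representation:
  assumes g: "spectrum g" and x: "x \<in> strip a"
  shows "integrable lborel (\<lambda>\<xi>. cl_mult (e_ker x \<xi>) (g \<xi>) T)"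
    and "f x T = (1 / (2 * pi) ^ CARD('m)) * (\<integral>\<xi>. cl_mult (e_ker x \<xi>) (g \<xi>) T \<partial>lborel)"
proof -
  obtain t y where ty: "x = (t, y)" by (cases x)
  have t: "\<bar>t\<bar> < a" using x ty by (simp add: strip_def)
  have eq: "cl_mult (e_ker x \<xi>) (g \<xi>) T = exp (\<i> * complex_of_real (\<xi> \<bullet> y)) * evolve g t \<xi> T" for \<xi>
    unfolding cl_mult_e_ker evolve_def ty by (simp add: inner_commute)
  show "integrable lborel (\<lambda>\<xi>. cl_mult (e_ker x \<xi>) (g \<xi>) T)"
    unfolding eq by (rule integrable_character_mult(2)[OF evolve_integrable[OF g t]])
  show "f x T = (1 / (2 * pi) ^ CARD('m)) * (\<integral>\<xi>. cl_mult (e_ker x \<xi>) (g \<xi>) T \<partial>lborel)"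
    unfolding eq inversion[OF g t] by (simp add: ty)
qed

text \<open>Inversion at height 0 says that f(0, .) is (2 pi)^(-m) times the reflected transform of
  g, which turns the multiplication formula of \<open>is_fourier\<close> into Parseval for g and the
  test function.\<close>

lemma spectrum_is_fourier:
  assumes g: "spectrum g" and g2: "\<And>T. (\<integral>\<^sup>+\<xi>. ennreal ((cmod (g \<xi> T))\<^sup>2) \<partial>lborel) < \<infinity>"
  shows "is_fourier (\<lambda>y. f (0, y)) g"
  unfolding is_fourier_def
proof (intro allI impI)
  fix \<phi> :: "real ^ 'm::{finite,linorder} \<Rightarrow> complex" and T
  assume \<phi>: "continuous_on UNIV \<phi>" and bd: "bounded {y. \<phi> y \<noteq> 0}"
  obtain B where "\<forall>y\<in>{y. \<phi> y \<noteq> 0}. norm y \<le> B" using bd by (auto simp only: bounded_iff)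
  \<comment> \<open>The bound B is attained possibly inside the support, so the radius is enlarged
    by 1 to get vanishing on a closed exterior.\<close>
  then have R: "\<phi> y = 0" if "norm y \<ge> B + 1" for y using that by force
  have f0: "f (0, y) T = fourier_int (\<lambda>\<xi>. g \<xi> T) (- y) / (2 * pi) ^ CARD('m)" for y
  proof -
    have "(\<integral>\<xi>. exp (\<i> * complex_of_real (\<xi> \<bullet> y)) * evolve g 0 \<xi> T \<partial>lborel) = (2 * pi) ^ CARD('m) * f (0, y) T"
      by (rule inversion[OF g]) (use a_pos in simp)
    then show ?thesis unfolding fourier_int_def evolve_0 by simp
  qed
  have "(\<integral>x. f (0, x) T * fourier_int \<phi> x \<partial>lborel) = (\<integral>x. fourier_int (\<lambda>\<xi>. g \<xi> T) (- x) * fourier_int \<phi> x \<partial>lborel) / (2 * pi) ^ CARD('m)"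
    unfolding f0 by (simp flip: integral_divide_zero)
  also have "\<dots> = (\<integral>\<xi>. g \<xi> T * \<phi> \<xi> \<partial>lborel)"
    using fourier_parseval_test[OF spectrum_integrable[OF g, of T] g2[of T] \<phi> R] by simp
  finally show "(\<integral>\<xi>. g \<xi> T * \<phi> \<xi> \<partial>lborel) = (\<integral>x. f (0, x) T * fourier_int \<phi> x \<partial>lborel)" ..
qed

lemma spectrum_chi_measurable:
  assumes "spectrum g"
  shows "(\<lambda>\<xi>. cl_norm (cl_mult (chi s \<xi>) (g \<xi>))) \<in> borel_measurable borel"
proof -
  have [measurable]: "(\<lambda>\<xi>. cl_mult (chi s \<xi>) (g \<xi>) U) \<in> borel_measurable borel" for U
    by (rule cl_mult_chi_measurable) (use assms in \<open>simp add: spectrum_def\<close>)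
  show ?thesis by measurable
qed

text \<open>Hausdorff-Young at one good height: e^(-s t|\<xi>|) times the projection of g is the
  projection of \<open>evolve g t\<close>. The powers of \<open>M\<close> pay for passing between
  the Clifford norm and its 2^m components.\<close>

lemma chi_slice_bound:
  assumes g: "spectrum g" and t: "good t" and s: "s = 1 \<or> s = - 1" and q: "q > 0" and K0: "K \<ge> 0"
    and K: "\<And>(u :: real ^ 'm::{finite,linorder} \<Rightarrow> complex) I. integrable lborel u \<Longrightarrow> I \<ge> 0 \<Longrightarrow>
     (\<integral>\<^sup>+x. ennreal (cmod (u x) powr p) \<partial>lborel) \<le> ennreal I \<Longrightarrow>
     (\<integral>\<^sup>+\<xi>. ennreal (cmod (fourier_int u \<xi>) powr q) \<partial>lborel) \<le> ennreal (K * I powr (q / p))"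
  defines "M \<equiv> real CARD('m set)"
  shows "(\<integral>\<^sup>+\<xi>. ennreal (exp (- q * s * t * norm \<xi>) * cl_norm (cl_mult (chi s \<xi>) (g \<xi>)) powr q) \<partial>lborel)
    \<le> ennreal (((1 + real CARD('m)) * M) powr q * M powr q * M * K * Nr t powr (q / p))"
proof -
  define D where "D = ((1 + real CARD('m)) * M) powr q * M powr q"
  have [measurable]: "(\<lambda>\<xi>. evolve g t \<xi> U) \<in> borel_measurable borel" for U by (rule spectrum_evolve_measurable[OF g])
  have "(\<integral>\<^sup>+\<xi>. ennreal (exp (- q * s * t * norm \<xi>) * cl_norm (cl_mult (chi s \<xi>) (g \<xi>)) powr q) \<partial>lborel)
     \<le> (\<integral>\<^sup>+\<xi>. ennreal D * (\<Sum>T\<in>UNIV. ennreal (cmod (evolve g t \<xi> T) powr q)) \<partial>lborel)"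
  proof (rule nn_integral_mono_AE)
    have "AE \<xi> in lborel. \<xi> \<noteq> (0 :: real ^ 'm::{finite,linorder})" by (rule AE_lborel_singleton)
    then show "AE \<xi> in lborel. ennreal (exp (- q * s * t * norm \<xi>) * cl_norm (cl_mult (chi s \<xi>) (g \<xi>)) powr q)
      \<le> ennreal D * (\<Sum>T\<in>UNIV. ennreal (cmod (evolve g t \<xi> T) powr q))"
    proof eventually_elim
      case (elim \<xi>)
      have "exp (- q * s * t * norm \<xi>) * cl_norm (cl_mult (chi s \<xi>) (g \<xi>)) powr q
         = (exp (- s * t * norm \<xi>) * cl_norm (cl_mult (chi s \<xi>) (g \<xi>))) powr q"
        by (simp add: powr_mult exp_powr_real mult_ac)
      also have "\<dots> \<le> ((1 + real CARD('m)) * M * (\<Sum>T\<in>UNIV. cmod (evolve g t \<xi> T))) powr q"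
        unfolding M_def by (intro powr_mono2 chi_evolve_cl_norm[OF s elim]) (use q in auto)
      also have "\<dots> = ((1 + real CARD('m)) * M) powr q * (\<Sum>T\<in>UNIV. cmod (evolve g t \<xi> T)) powr q"
        by (simp add: powr_mult M_def sum_nonneg)
      also have "\<dots> \<le> ((1 + real CARD('m)) * M) powr q * (M powr q * (\<Sum>T\<in>UNIV. cmod (evolve g t \<xi> T) powr q))"
        unfolding M_def by (intro mult_left_mono sum_powr_le) (use q in auto)
      finally have "exp (- q * s * t * norm \<xi>) * cl_norm (cl_mult (chi s \<xi>) (g \<xi>)) powr q \<le> D * (\<Sum>T\<in>UNIV. cmod (evolve g t \<xi> T) powr q)"
        by (simp add: D_def mult.assoc)
      then have "ennreal (exp (- q * s * t * norm \<xi>) * cl_norm (cl_mult (chi s \<xi>) (g \<xi>)) powr q) \<le> ennreal (D * (\<Sum>T\<in>UNIV. cmod (evolve g t \<xi> T) powr q))"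
        by (rule ennreal_leI)
      also have "\<dots> = ennreal D * (\<Sum>T\<in>UNIV. ennreal (cmod (evolve g t \<xi> T) powr q))"
        by (subst ennreal_mult) (auto simp: D_def sum_nonneg sum_ennreal)
      finally show ?case .
    qed
  qed
  also have "\<dots> = ennreal D * (\<Sum>T\<in>UNIV. \<integral>\<^sup>+\<xi>. ennreal (cmod (evolve g t \<xi> T) powr q) \<partial>lborel)"
    by (subst nn_integral_cmult, simp, subst nn_integral_sum) simp_all
  also have "\<dots> \<le> ennreal D * (\<Sum>T\<in>(UNIV::'m set set). ennreal (K * Nr t powr (q / p)))"
    unfolding Nr_def by (intro mult_left_mono sum_mono evolve_hausdorff_young[OF g t K q]) auto
  also have "\<dots> = ennreal (D * (M * (K * Nr t powr (q / p))))"
    using K0 unfolding M_def by (simp add: ennreal_mult D_def ennreal_of_nat_eq_real_of_nat)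
  finally show ?thesis by (simp add: D_def mult.assoc)
qed

text \<open>For \<xi> nonzero this is the integral of e^(-p s t|\<xi>|) over |t| < a, the same for
  both signs by symmetry of the interval; its power q/p is the weight of the theorem.\<close>

definition strip_weight :: "real ^ 'm::{finite,linorder} \<Rightarrow> real" where
  "strip_weight \<xi> = (exp (p * a * norm \<xi>) - exp (- p * a * norm \<xi>)) / (p * norm \<xi>)"

lemma strip_weight_integral:
  assumes s: "s = 1 \<or> s = - 1" and \<xi>: "\<xi> \<noteq> 0"
  shows "integrable lborel (\<lambda>t. indicator {-a<..<a} t * exp (- p * s * norm \<xi> * t))"
    and "(\<integral>t. indicator {-a<..<a} t * exp (- p * s * norm \<xi> * t) \<partial>lborel) = strip_weight \<xi>"
proof -
  have b: "- p * s * norm \<xi> \<noteq> 0" using s \<xi> p by auto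
  show "integrable lborel (\<lambda>t. indicator {-a<..<a} t * exp (- p * s * norm \<xi> * t))"
    by (rule exp_interval_integral(1)[OF a_pos b])
  show "(\<integral>t. indicator {-a<..<a} t * exp (- p * s * norm \<xi> * t) \<partial>lborel) = strip_weight \<xi>"
  proof -
    define n where "n = p * norm \<xi>"
    have "(\<integral>t. indicator {-a<..<a} t * exp (- p * s * norm \<xi> * t) \<partial>lborel) = (exp (- s * n * a) - exp (s * n * a)) / (- s * n)"
      using exp_interval_integral(2)[OF a_pos b] by (simp add: n_def mult_ac)
    also have "\<dots> = (exp (n * a) - exp (- n * a)) / n"
      using s
    proof
      assume "s = 1"
      then show ?thesis using minus_divide_left[of "exp (- n * a) - exp (n * a)" n] by simp
    next
      assume "s = - 1"
      then show ?thesis by simp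
    qed
    also have "\<dots> = strip_weight \<xi>" unfolding strip_weight_def n_def by (simp add: mult_ac)
    finally show ?thesis .
  qed
qed

text \<open>From 2 sinh x >= 2x. A weight bounded below lets the weighted estimates imply membership
  of g in L^q or L^infinity.\<close>

lemma strip_weight_ge:
  assumes "\<xi> \<noteq> 0" shows "2 * a \<le> strip_weight \<xi>"
proof -
  have "2 * (p * a * norm \<xi>) \<le> exp (p * a * norm \<xi>) - exp (- (p * a * norm \<xi>))"
    by (rule exp_diff_ge) (use p a_pos in auto)
  then show ?thesis unfolding strip_weight_def using assms p by (simp add: pos_le_divide_eq mult_ac)
qed

end

lemma two_term_powr_le:
  fixes x y q :: real
  assumes "0 \<le> x" "0 \<le> y" "q > 0"
  shows "(x + y) powr q \<le> 2 powr q * (x powr q + y powr q)"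
proof -
  have "(x + y) powr q \<le> (2 * max x y) powr q" using assms by (intro powr_mono2) auto
  also have "\<dots> = 2 powr q * max x y powr q" using assms by (intro powr_mult)
  also have "\<dots> \<le> 2 powr q * (x powr q + y powr q)"
    by (intro mult_left_mono) (auto simp: max_def)
  finally show ?thesis .
qed

section \<open>The weighted estimates\<close>

context monogenic_Ap
begin

text \<open>Jensen with r = q/p bounds the weight by A^(r-1) times an integral over t of e^(-q s
  t|\<xi>|) w(t)^(1-r). After exchanging integrals, the slice bound supplies Nr(t)^r. With w close
  to Nr these powers combine to w(t), whose integral is A, so the total is K2 A^r.\<close>

lemma one_sided_bound:
  assumes g: "spectrum g" and s: "s = 1 \<or> s = - 1" and p1: "1 < p" and q: "q = p / (p - 1)" and K0: "K \<ge> 0"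
    and K: "\<And>(u :: real ^ 'm::{finite,linorder} \<Rightarrow> complex) I. integrable lborel u \<Longrightarrow> I \<ge> 0 \<Longrightarrow>
     (\<integral>\<^sup>+x. ennreal (cmod (u x) powr p) \<partial>lborel) \<le> ennreal I \<Longrightarrow>
     (\<integral>\<^sup>+\<xi>. ennreal (cmod (fourier_int u \<xi>) powr q) \<partial>lborel) \<le> ennreal (K * I powr (q / p))"
    and K2: "K2 = ((1 + real CARD('m)) * real CARD('m set)) powr q * real CARD('m set) powr q * real CARD('m set) * K"
    and \<epsilon>: "\<epsilon> > 0"
  shows "(\<integral>\<^sup>+\<xi>. ennreal (strip_weight \<xi> powr (q / p) * cl_norm (cl_mult (chi s \<xi>) (g \<xi>)) powr q) \<partial>lborel)
    \<le> ennreal (K2 * (S + 2 * a * \<epsilon>) powr (q / p))"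
proof -
  define r where "r = q / p"
  have q0: "q > 0" unfolding q using p1 by simp
  have r: "r \<ge> 1" unfolding r_def q using p1 p by (simp add: field_simps)
  have pr: "p * r = q" unfolding r_def using p1 by simp
  have K20: "K2 \<ge> 0" unfolding K2 using K0 by simp
  define I where "I = {-a<..<a}"
  \<comment> \<open>Proportionality to the slice mass makes the exponents match; the added
    \<epsilon> keeps w positive on heights where that mass is 0.\<close>
  define w where "w t = indicator I t * (Nr t + \<epsilon>)" for t
  have [measurable]: "w \<in> borel_measurable borel" unfolding w_def I_def by measurable
  have wpos: "w t = Nr t + \<epsilon>" "w t > 0" if "t \<in> I" for t
    using that \<epsilon> Nr_nonneg[of t] by (auto simp: w_def)
  have w_eq: "w = (\<lambda>t. Nr t + \<epsilon> * indicator I t)"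
  proof
    fix t show "w t = Nr t + \<epsilon> * indicator I t"
      using Nr_outside[of t] by (cases "t \<in> I") (auto simp: w_def I_def)
  qed
  have iI: "integrable lborel (indicator I :: real \<Rightarrow> real)" "(\<integral>t. indicator I t \<partial>lborel) = 2 * a"
    unfolding I_def using a_pos by auto
  have iw: "integrable lborel w" unfolding w_eq using Nr_integral(1) iI(1) by auto
  define A where "A = S + 2 * a * \<epsilon>"
  have A: "A = (\<integral>t. w t \<partial>lborel)" unfolding w_eq A_def using Nr_integral iI by simp
  have A0: "A > 0" unfolding A_def using S_nonneg a_pos \<epsilon> by (simp add: add_nonneg_pos)
  define c where "c \<xi> = cl_norm (cl_mult (chi s \<xi>) (g \<xi>)) powr q" for \<xi>
  have [measurable]: "(\<lambda>\<xi>. cl_norm (cl_mult (chi s \<xi>) (g \<xi>))) \<in> borel_measurable borel"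
    by (rule spectrum_chi_measurable[OF g])
  have [measurable]: "c \<in> borel_measurable borel" unfolding c_def by measurable
  have c0: "c \<xi> \<ge> 0" for \<xi> by (simp add: c_def)
  define k where "k t \<xi> = w t powr (1 - r) * (exp (- q * s * t * norm \<xi>) * c \<xi>)" for t and \<xi> :: "real ^ 'm::{finite,linorder}"
  have k0: "k t \<xi> \<ge> 0" for t \<xi> using c0 by (simp add: k_def)
  have km: "(\<lambda>(\<xi>, t). ennreal (k t \<xi>) * indicator I t) \<in> borel_measurable (lborel \<Otimes>\<^sub>M lborel)"
    unfolding k_def I_def by measurable
  have "(\<integral>\<^sup>+\<xi>. ennreal (strip_weight \<xi> powr r * c \<xi>) \<partial>lborel)
     \<le> (\<integral>\<^sup>+\<xi>. ennreal (A powr (r - 1)) * (\<integral>\<^sup>+t. ennreal (k t \<xi>) * indicator I t \<partial>lborel) \<partial>lborel)"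
  proof (rule nn_integral_mono_AE)
    have "AE \<xi> in lborel. \<xi> \<noteq> (0 :: real ^ 'm::{finite,linorder})" by (rule AE_lborel_singleton)
    then show "AE \<xi> in lborel. ennreal (strip_weight \<xi> powr r * c \<xi>)
      \<le> ennreal (A powr (r - 1)) * (\<integral>\<^sup>+t. ennreal (k t \<xi>) * indicator I t \<partial>lborel)"
    proof eventually_elim
      case (elim \<xi>)
      define h where "h t = indicator I t * exp (- p * s * norm \<xi> * t)" for t
      have [measurable]: "h \<in> borel_measurable borel" unfolding h_def I_def by measurable
      have ih: "integrable lborel h" "(\<integral>t. h t \<partial>lborel) = strip_weight \<xi>"
        unfolding h_def I_def using strip_weight_integral[OF s elim] by auto
      have "ennreal ((\<integral>t. h t \<partial>lborel) powr r) \<le> ennreal (A powr (r - 1)) * (\<integral>\<^sup>+t. ennreal (h t powr r * w t powr (1 - r)) \<partial>lborel)"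
      proof (rule weighted_power_mean[OF ih(1) _ iw _ A A0 r])
        show "h t \<ge> 0" for t by (simp add: h_def)
        show "w t > 0 \<or> w t = 0 \<and> h t = 0" for t
          using wpos[of t] by (cases "t \<in> I") (auto simp: h_def w_def)
        show "0 < (\<integral>t. h t \<partial>lborel)" unfolding ih(2) using strip_weight_ge[OF elim] a_pos by linarith
      qed
      then have 1: "ennreal (strip_weight \<xi> powr r) \<le> ennreal (A powr (r - 1)) * (\<integral>\<^sup>+t. ennreal (h t powr r * w t powr (1 - r)) \<partial>lborel)"
        unfolding ih(2) .
      have "ennreal (strip_weight \<xi> powr r * c \<xi>) = ennreal (strip_weight \<xi> powr r) * ennreal (c \<xi>)"
        by (rule ennreal_mult) (auto simp: c0)
      also have "\<dots> \<le> ennreal (A powr (r - 1)) * (\<integral>\<^sup>+t. ennreal (h t powr r * w t powr (1 - r)) \<partial>lborel) * ennreal (c \<xi>)"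
        by (intro mult_right_mono 1) auto
      also have "\<dots> = ennreal (A powr (r - 1)) * (\<integral>\<^sup>+t. ennreal (h t powr r * w t powr (1 - r)) * ennreal (c \<xi>) \<partial>lborel)"
        unfolding mult.assoc by (subst nn_integral_multc) auto
      also have "(\<integral>\<^sup>+t. ennreal (h t powr r * w t powr (1 - r)) * ennreal (c \<xi>) \<partial>lborel) = (\<integral>\<^sup>+t. ennreal (k t \<xi>) * indicator I t \<partial>lborel)"
      proof (intro nn_integral_cong)
        fix t
        show "ennreal (h t powr r * w t powr (1 - r)) * ennreal (c \<xi>) = ennreal (k t \<xi>) * indicator I t"
        proof (cases "t \<in> I")
          case True
          have "h t powr r = exp (- p * s * norm \<xi> * t * r)"
            using True by (simp add: h_def exp_powr_real)
          also have "- p * s * norm \<xi> * t * r = - (p * r) * s * t * norm \<xi>" by (simp add: mult_ac)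
          finally have "h t powr r * w t powr (1 - r) * c \<xi> = k t \<xi>"
            unfolding k_def pr by (simp add: mult_ac)
          then show ?thesis using True c0[of \<xi>] by (simp flip: ennreal_mult)
        qed (use r in \<open>simp add: h_def\<close>)
      qed
      finally show ?case .
    qed
  qed
  also have "\<dots> = ennreal (A powr (r - 1)) * (\<integral>\<^sup>+\<xi>. (\<integral>\<^sup>+t. ennreal (k t \<xi>) * indicator I t \<partial>lborel) \<partial>lborel)"
    using km by (intro nn_integral_cmult lborel.borel_measurable_nn_integral) auto
  also have "(\<integral>\<^sup>+\<xi>. (\<integral>\<^sup>+t. ennreal (k t \<xi>) * indicator I t \<partial>lborel) \<partial>lborel) = (\<integral>\<^sup>+t. (\<integral>\<^sup>+\<xi>. ennreal (k t \<xi>) * indicator I t \<partial>lborel) \<partial>lborel)"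
    by (rule lborel_pair.Fubini'[symmetric]) (use km in simp)
  also have "\<dots> \<le> (\<integral>\<^sup>+t. ennreal (K2 * w t) \<partial>lborel)"
  proof (rule nn_integral_mono_AE)
    show "AE t in lborel. (\<integral>\<^sup>+\<xi>. ennreal (k t \<xi>) * indicator I t \<partial>lborel) \<le> ennreal (K2 * w t)"
      using AE_good
    proof eventually_elim
      case (elim t)
      show ?case
      proof (cases "t \<in> I")
        case True
        then have t: "good t" using elim by (auto simp: I_def)
        have "(\<integral>\<^sup>+\<xi>. ennreal (k t \<xi>) * indicator I t \<partial>lborel)
           = (\<integral>\<^sup>+\<xi>. ennreal (w t powr (1 - r)) * ennreal (exp (- q * s * t * norm \<xi>) * c \<xi>) \<partial>lborel)"
          using True c0 unfolding k_def by (intro nn_integral_cong) (simp add: ennreal_mult)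
        also have "\<dots> = ennreal (w t powr (1 - r)) * (\<integral>\<^sup>+\<xi>. ennreal (exp (- q * s * t * norm \<xi>) * c \<xi>) \<partial>lborel)"
          by (rule nn_integral_cmult) measurable
        also have "\<dots> \<le> ennreal (w t powr (1 - r)) * ennreal (K2 * Nr t powr r)"
          unfolding c_def K2 r_def by (intro mult_left_mono chi_slice_bound[OF g t s q0 K0 K]) auto
        also have "\<dots> = ennreal (K2 * (w t powr (1 - r) * Nr t powr r))"
          using K20 by (simp add: mult_ac flip: ennreal_mult)
        also have "\<dots> \<le> ennreal (K2 * w t)"
        proof (intro ennreal_leI mult_left_mono K20)
          \<comment> \<open>The cancellation on which the choice of w rests: w^(1-r) Nr^r is at most
            w.\<close>
          have "Nr t powr r \<le> w t powr r"
            using wpos[OF True] Nr_nonneg[of t] \<epsilon> r by (intro powr_mono2) auto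
          then have "w t powr (1 - r) * Nr t powr r \<le> w t powr (1 - r) * w t powr r"
            by (intro mult_left_mono) auto
          also have "\<dots> = w t" using wpos(2)[OF True] by (simp flip: powr_add)
          finally show "w t powr (1 - r) * Nr t powr r \<le> w t" .
        qed
        finally show ?thesis .
      qed simp
    qed
  qed
  also have "(\<integral>\<^sup>+t. ennreal (K2 * w t) \<partial>lborel) = ennreal (K2 * A)"
  proof -
    have "w t \<ge> 0" for t using wpos(2)[of t] by (cases "t \<in> I") (auto simp: w_def)
    then have "(\<integral>\<^sup>+t. ennreal (K2 * w t) \<partial>lborel) = ennreal (\<integral>t. K2 * w t \<partial>lborel)"
      using iw K20 by (intro nn_integral_eq_integral) auto
    then show ?thesis using A by simp
  qed
  finally have "(\<integral>\<^sup>+\<xi>. ennreal (strip_weight \<xi> powr r * c \<xi>) \<partial>lborel) \<le> ennreal (A powr (r - 1)) * ennreal (K2 * A)"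
    by (simp add: mult_left_mono)
  also have "\<dots> = ennreal (K2 * A powr r)"
  proof -
    have "A powr (r - 1) * A = A powr r" using A0 by (simp add: powr_diff)
    then have "A powr (r - 1) * (K2 * A) = K2 * A powr r" by (metis mult.assoc mult.commute)
    then show ?thesis using K20 A0 by (simp flip: ennreal_mult)
  qed
  finally show ?thesis unfolding c_def r_def A_def .
qed

text \<open>The two signs contribute equally, and the resulting factor 2 is cancelled by the 1/2 in
  the theorem.\<close>

lemma two_sided_bound:
  assumes g: "spectrum g" and p1: "1 < p" and q: "q = p / (p - 1)" and K0: "K \<ge> 0"
    and K: "\<And>(u :: real ^ 'm::{finite,linorder} \<Rightarrow> complex) I. integrable lborel u \<Longrightarrow> I \<ge> 0 \<Longrightarrow>
     (\<integral>\<^sup>+x. ennreal (cmod (u x) powr p) \<partial>lborel) \<le> ennreal I \<Longrightarrow>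
     (\<integral>\<^sup>+\<xi>. ennreal (cmod (fourier_int u \<xi>) powr q) \<partial>lborel) \<le> ennreal (K * I powr (q / p))"
    and K2: "K2 = ((1 + real CARD('m)) * real CARD('m set)) powr q * real CARD('m set) powr q * real CARD('m set) * K"
  shows "(\<integral>\<^sup>+\<xi>. ennreal ((exp (p * a * norm \<xi>) - exp (- p * a * norm \<xi>)) powr (q / p)
       * (cl_norm (cl_mult (chi 1 \<xi>) (g \<xi>)) powr q + cl_norm (cl_mult (chi (-1) \<xi>) (g \<xi>)) powr q)
       / (p * norm \<xi>) powr (q / p)) \<partial>lborel) \<le> ennreal (2 * K2 * S powr (q / p))"
    (is "?I \<le> _")
proof -
  have K20: "K2 \<ge> 0" unfolding K2 using K0 by simp
  have q0: "q > 0" unfolding q using p1 by simp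
  define c where "c s \<xi> = strip_weight \<xi> powr (q / p) * cl_norm (cl_mult (chi s \<xi>) (g \<xi>)) powr q" for s \<xi>
  have [measurable]: "(\<lambda>\<xi>. cl_norm (cl_mult (chi s \<xi>) (g \<xi>))) \<in> borel_measurable borel" for s
    by (rule spectrum_chi_measurable[OF g])
  have [measurable]: "c s \<in> borel_measurable borel" for s unfolding c_def strip_weight_def by measurable
  have eq: "(exp (p * a * norm \<xi>) - exp (- p * a * norm \<xi>)) powr (q / p)
       * (cl_norm (cl_mult (chi 1 \<xi>) (g \<xi>)) powr q + cl_norm (cl_mult (chi (-1) \<xi>) (g \<xi>)) powr q)
       / (p * norm \<xi>) powr (q / p) = c 1 \<xi> + c (-1) \<xi>" for \<xi>
  proof -
    have "exp (- p * a * norm \<xi>) \<le> exp (p * a * norm \<xi>)" using p1 a_pos by simp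
    then have "strip_weight \<xi> powr (q / p) = (exp (p * a * norm \<xi>) - exp (- p * a * norm \<xi>)) powr (q / p) / (p * norm \<xi>) powr (q / p)"
      unfolding strip_weight_def by (simp only: powr_divide)
    then show ?thesis unfolding c_def by (simp add: distrib_left add_divide_distrib)
  qed
  \<comment> \<open>The left side does not contain \<epsilon>, so \<epsilon> = 1/(n+1) can be sent
    to 0.\<close>
  have "?I \<le> ennreal (2 * K2 * (S + 2 * a * (1 / real (Suc n))) powr (q / p))" for n
  proof -
    have "?I = (\<integral>\<^sup>+\<xi>. ennreal (c 1 \<xi>) + ennreal (c (-1) \<xi>) \<partial>lborel)"
      unfolding eq by (intro nn_integral_cong ennreal_plus) (simp_all add: c_def)
    also have "\<dots> = (\<integral>\<^sup>+\<xi>. ennreal (c 1 \<xi>) \<partial>lborel) + (\<integral>\<^sup>+\<xi>. ennreal (c (-1) \<xi>) \<partial>lborel)"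
      by (rule nn_integral_add) measurable
    also have "\<dots> \<le> ennreal (K2 * (S + 2 * a * (1 / real (Suc n))) powr (q / p)) + ennreal (K2 * (S + 2 * a * (1 / real (Suc n))) powr (q / p))"
      unfolding c_def by (intro add_mono one_sided_bound[OF g _ p1 q K0 K K2]) auto
    also have "\<dots> = ennreal (2 * K2 * (S + 2 * a * (1 / real (Suc n))) powr (q / p))"
      using K20 by (subst ennreal_plus[symmetric]) auto
    finally show ?thesis .
  qed
  moreover have "(\<lambda>n. ennreal (2 * K2 * (S + 2 * a * (1 / real (Suc n))) powr (q / p))) \<longlonglongrightarrow> ennreal (2 * K2 * S powr (q / p))"
  proof (intro tendsto_ennrealI tendsto_mult tendsto_const)
    have "(\<lambda>n. S + 2 * a * (1 / real (Suc n))) \<longlonglongrightarrow> S + 2 * a * 0"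
      by (intro tendsto_intros LIMSEQ_Suc lim_1_over_n)
    then have "(\<lambda>n. S + 2 * a * (1 / real (Suc n))) \<longlonglongrightarrow> S" by simp
    then show "(\<lambda>n. (S + 2 * a * (1 / real (Suc n))) powr (q / p)) \<longlonglongrightarrow> S powr (q / p)"
      by (rule tendsto_powr2[OF _ tendsto_const]) (use S_nonneg a_pos q0 p1 in \<open>auto intro!: always_eventually\<close>)
  qed
  ultimately show ?thesis by (intro LIMSEQ_le_const) auto
qed

text \<open>For p = 1 the slice estimate is pointwise: e^(-s t|\<xi>|) times the projection is at
  most a constant times Nr(t). Integrating over t produces the weight on the left and the norm on
  the right, without Jensen.\<close>

lemma linf_bound:
  assumes g: "spectrum g" and p1: "p = 1" and s: "s = 1 \<or> s = - 1"
  shows "AE \<xi> in lborel. strip_weight \<xi> * cl_norm (cl_mult (chi s \<xi>) (g \<xi>)) \<le> (1 + real CARD('m)) * real CARD('m set) * real CARD('m set) * S"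
proof -
  define D where "D = (1 + real CARD('m)) * real CARD('m set) * real CARD('m set)"
  define c where "c \<xi> = cl_norm (cl_mult (chi s \<xi>) (g \<xi>))" for \<xi>
  have [measurable]: "c \<in> borel_measurable borel" unfolding c_def by (rule spectrum_chi_measurable[OF g])
  have "AE t in lborel. AE \<xi> in lborel. \<bar>t\<bar> < a \<longrightarrow> exp (- s * t * norm \<xi>) * c \<xi> \<le> D * Nr t"
    using AE_good
  proof eventually_elim
    case (elim t)
    show ?case
    proof (cases "\<bar>t\<bar> < a")
      case True
      then have t: "good t" using elim by simp
      have "AE \<xi> in lborel. \<xi> \<noteq> (0 :: real ^ 'm::{finite,linorder})" by (rule AE_lborel_singleton)
      moreover have "AE \<xi> in lborel. \<forall>U\<in>UNIV. cmod (evolve g t \<xi> U) \<le> Nr t"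
        using evolve_bounded[OF g t p1] unfolding Nr_def by (intro AE_finite_allI) auto
      ultimately show ?thesis
      proof eventually_elim
        case (elim \<xi>)
        have "(\<Sum>T\<in>UNIV. cmod (evolve g t \<xi> T)) \<le> real CARD('m set) * Nr t"
          using elim(2) by (intro sum_bounded_above) auto
        then have "(1 + real CARD('m)) * real CARD('m set) * (\<Sum>T\<in>UNIV. cmod (evolve g t \<xi> T)) \<le> (1 + real CARD('m)) * real CARD('m set) * (real CARD('m set) * Nr t)"
          by (intro mult_left_mono) auto
        with chi_evolve_cl_norm[OF s elim(1), of t g] have "exp (- s * t * norm \<xi>) * c \<xi> \<le> (1 + real CARD('m)) * real CARD('m set) * (real CARD('m set) * Nr t)"
          unfolding c_def by (rule order_trans)
        then show ?case unfolding D_def by (simp only: mult.assoc simp_thms)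
      qed
    qed simp
  qed
  \<comment> \<open>The exceptional frequencies depend on t; Fubini for null sets exchanges the
    quantifiers so that t can be integrated at a fixed \<xi>.\<close>
  then have "AE \<xi> in lborel. AE t in lborel. \<bar>t\<bar> < a \<longrightarrow> exp (- s * t * norm \<xi>) * c \<xi> \<le> D * Nr t"
    by (subst lborel_pair.AE_commute[symmetric]) measurable
  moreover have "AE \<xi> in lborel. \<xi> \<noteq> (0 :: real ^ 'm::{finite,linorder})" by (rule AE_lborel_singleton)
  ultimately show ?thesis
  proof eventually_elim
    case (elim \<xi>)
    note W = strip_weight_integral[OF s elim(2)]
    have "strip_weight \<xi> * c \<xi> = (\<integral>t. indicator {-a<..<a} t * exp (- p * s * norm \<xi> * t) * c \<xi> \<partial>lborel)"
      using W by simp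
    also have "\<dots> \<le> (\<integral>t. D * Nr t \<partial>lborel)"
    proof (rule integral_mono_AE)
      show "integrable lborel (\<lambda>t. indicator {-a<..<a} t * exp (- p * s * norm \<xi> * t) * c \<xi>)" using W(1) by auto
      show "integrable lborel (\<lambda>t. D * Nr t)" using Nr_integral by auto
      show "AE t in lborel. indicator {-a<..<a} t * exp (- p * s * norm \<xi> * t) * c \<xi> \<le> D * Nr t"
        using elim(1)
      proof eventually_elim
        case (elim t)
        show ?case
        proof (cases "\<bar>t\<bar> < a")
          case True
          then have "exp (- s * t * norm \<xi>) * c \<xi> \<le> D * Nr t" using elim by simp
          moreover have "t \<in> {-a<..<a}" using True by auto
          ultimately show ?thesis using p1 by (simp add: mult_ac)
        next
          case False
          then show ?thesis using Nr_nonneg[of t] by (auto simp: indicator_def D_def)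
        qed
      qed
    qed
    also have "\<dots> = D * S" using Nr_integral by simp
    finally show ?case unfolding c_def D_def .
  qed
qed

lemma Ap_norm_eq: "Ap_norm a p f = S powr (1 / p)"
  by (simp add: Ap_norm_def S_def)


section \<open>The choice of g, its integrability, and the theorem\<close>

lemma spectrum_exists: "\<exists>g. spectrum g"
  by (rule evolve_limit_exists) (auto simp: spectrum_def)

lemma strip_weight_powr:
  "(exp (p * a * norm \<xi>) - exp (- p * a * norm \<xi>)) powr r * z / (p * norm \<xi>) powr r = strip_weight \<xi> powr r * z"
  unfolding strip_weight_def powr_divide by simp

text \<open>g is the sum of its two projections, and the weight is at least (2a)^r, so the finite
  weighted integral dominates the q-th power of g up to the constant \<open>D\<close>.\<close>

lemma spectrum_in_Lr:
  assumes g: "spectrum g" and q: "q > 0" and r: "r \<ge> 0"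
    and fin: "(\<integral>\<^sup>+\<xi>. ennreal ((exp (p * a * norm \<xi>) - exp (- p * a * norm \<xi>)) powr r
       * (cl_norm (cl_mult (chi 1 \<xi>) (g \<xi>)) powr q + cl_norm (cl_mult (chi (-1) \<xi>) (g \<xi>)) powr q)
       / (p * norm \<xi>) powr r) \<partial>lborel) < \<infinity>"
  shows "in_Lr q g"
proof -
  define M where "M = real CARD('m set)"
  define X where "X \<xi> = cl_norm (cl_mult (chi 1 \<xi>) (g \<xi>)) powr q + cl_norm (cl_mult (chi (-1) \<xi>) (g \<xi>)) powr q" for \<xi>
  define D where "D = (M powr q * 2 powr q) / (2 * a) powr r"
  have D: "D \<ge> 0" by (simp add: D_def)
  have [measurable]: "(\<lambda>\<xi>. cl_norm (cl_mult (chi s \<xi>) (g \<xi>))) \<in> borel_measurable borel" for s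
    by (rule spectrum_chi_measurable[OF g])
  have [measurable]: "X \<in> borel_measurable borel" unfolding X_def by measurable
  have [measurable]: "strip_weight \<in> borel_measurable borel" unfolding strip_weight_def by measurable
  have "(\<integral>\<^sup>+\<xi>. ennreal (cl_norm (g \<xi>) powr q) \<partial>lborel) \<le> (\<integral>\<^sup>+\<xi>. ennreal D * ennreal (strip_weight \<xi> powr r * X \<xi>) \<partial>lborel)"
  proof (rule nn_integral_mono_AE)
    have "AE \<xi> in lborel. \<xi> \<noteq> (0 :: real ^ 'm::{finite,linorder})" by (rule AE_lborel_singleton)
    then show "AE \<xi> in lborel. ennreal (cl_norm (g \<xi>) powr q) \<le> ennreal D * ennreal (strip_weight \<xi> powr r * X \<xi>)"
    proof eventually_elim
      case (elim \<xi>)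
      let ?x = "cl_norm (cl_mult (chi 1 \<xi>) (g \<xi>))" and ?y = "cl_norm (cl_mult (chi (-1) \<xi>) (g \<xi>))"
      have "cl_norm (g \<xi>) powr q \<le> (M * (?x + ?y)) powr q"
        unfolding M_def by (intro powr_mono2 cl_norm_chi_split) (use q in auto)
      also have "\<dots> = M powr q * (?x + ?y) powr q" by (rule powr_mult)
      also have "\<dots> \<le> M powr q * (2 powr q * X \<xi>)"
        unfolding X_def by (intro mult_left_mono two_term_powr_le) (use q in auto)
      also have "\<dots> = D * ((2 * a) powr r * X \<xi>)" using a_pos by (simp add: D_def)
      also have "\<dots> \<le> D * (strip_weight \<xi> powr r * X \<xi>)"
        using strip_weight_ge[OF elim] a_pos r D
        by (intro mult_left_mono mult_right_mono powr_mono2) (auto simp: X_def)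
      finally show ?case using D by (simp add: ennreal_leI X_def flip: ennreal_mult)
    qed
  qed
  also have "\<dots> = ennreal D * (\<integral>\<^sup>+\<xi>. ennreal (strip_weight \<xi> powr r * X \<xi>) \<partial>lborel)"
    by (rule nn_integral_cmult) measurable
  also have "\<dots> < \<infinity>"
    using fin unfolding strip_weight_powr X_def[symmetric] by (auto simp: ennreal_mult_less_top less_top)
  finally show ?thesis using g unfolding in_Lr_def spectrum_def by simp
qed

text \<open>Interpolation between L^1 and L^q for q >= 2: z^2 is at most z when z <= 1 and at most
  z^q otherwise. Parseval with test functions asks for this.\<close>

lemma spectrum_square_integrable_Lr:
  assumes g: "spectrum g" and L: "in_Lr q g" and q: "q \<ge> 2"
  shows "(\<integral>\<^sup>+\<xi>. ennreal ((cmod (g \<xi> T))\<^sup>2) \<partial>lborel) < \<infinity>"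
proof -
  have [measurable]: "(\<lambda>\<xi>. g \<xi> T) \<in> borel_measurable borel" for T using g by (simp add: spectrum_def)
  have "(\<integral>\<^sup>+\<xi>. ennreal ((cmod (g \<xi> T))\<^sup>2) \<partial>lborel) \<le> (\<integral>\<^sup>+\<xi>. ennreal (cmod (g \<xi> T)) + ennreal (cl_norm (g \<xi>) powr q) \<partial>lborel)"
  proof (intro nn_integral_mono)
    fix \<xi>
    have "(cmod (g \<xi> T))\<^sup>2 \<le> cmod (g \<xi> T) + cl_norm (g \<xi>) powr q"
    proof (cases "cmod (g \<xi> T) \<le> 1")
      case True
      then have "(cmod (g \<xi> T))\<^sup>2 \<le> cmod (g \<xi> T)" by (simp add: power2_eq_square mult_left_le)
      then show ?thesis using powr_ge_zero[of "cl_norm (g \<xi>)" q] by linarith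
    next
      case False
      have "(cmod (g \<xi> T))\<^sup>2 = cmod (g \<xi> T) powr 2" by simp
      also have "\<dots> \<le> cmod (g \<xi> T) powr q" using False q by (intro powr_mono) auto
      also have "\<dots> \<le> cl_norm (g \<xi>) powr q" using q by (intro powr_mono2 cl_norm_ge_component) auto
      finally show ?thesis by (simp add: add_increasing)
    qed
    then show "ennreal ((cmod (g \<xi> T))\<^sup>2) \<le> ennreal (cmod (g \<xi> T)) + ennreal (cl_norm (g \<xi>) powr q)"
      by (subst ennreal_plus[symmetric]) (simp_all only: norm_ge_zero powr_ge_zero ennreal_leI)
  qed
  also have "\<dots> = (\<integral>\<^sup>+\<xi>. ennreal (cmod (g \<xi> T)) \<partial>lborel) + (\<integral>\<^sup>+\<xi>. ennreal (cl_norm (g \<xi>) powr q) \<partial>lborel)"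
    by (rule nn_integral_add) measurable
  also have "\<dots> < \<infinity>"
    using spectrum_integrable[OF g, of T] L by (simp add: integrable_iff_bounded in_Lr_def less_top)
  finally show ?thesis .
qed

text \<open>The counterpart for p = 1: g is integrable and essentially bounded, so |g|^2 is at most
  B |g|.\<close>

lemma spectrum_square_integrable_Linf:
  assumes g: "spectrum g" and L: "in_Linf g"
  shows "(\<integral>\<^sup>+\<xi>. ennreal ((cmod (g \<xi> T))\<^sup>2) \<partial>lborel) < \<infinity>"
proof -
  obtain B where B: "AE \<xi> in lborel. cl_norm (g \<xi>) \<le> B" using L by (auto simp: in_Linf_def)
  have "(\<integral>\<^sup>+\<xi>. ennreal ((cmod (g \<xi> T))\<^sup>2) \<partial>lborel) \<le> (\<integral>\<^sup>+\<xi>. ennreal (norm (B * cmod (g \<xi> T))) \<partial>lborel)"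
  proof (rule nn_integral_mono_AE)
    show "AE \<xi> in lborel. ennreal ((cmod (g \<xi> T))\<^sup>2) \<le> ennreal (norm (B * cmod (g \<xi> T)))"
      using B
    proof eventually_elim
      case (elim \<xi>)
      then have "cmod (g \<xi> T) \<le> \<bar>B\<bar>" using cl_norm_ge_component[of "g \<xi>" T] by linarith
      then have "cmod (g \<xi> T) * cmod (g \<xi> T) \<le> \<bar>B\<bar> * cmod (g \<xi> T)" by (intro mult_right_mono) auto
      then show ?case by (intro ennreal_leI) (simp add: power2_eq_square abs_mult)
    qed
  qed
  also have "\<dots> < \<infinity>"
  proof -
    have "integrable lborel (\<lambda>\<xi>. B * cmod (g \<xi> T))" using spectrum_integrable[OF g, of T] by auto
    then show ?thesis by (simp only: integrable_iff_bounded)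
  qed
  finally show ?thesis .
qed

text \<open>The theorem claims the bound for p = 1 at every \<xi>, whereas the limit gives it almost
  everywhere; g is set to 0 on the measurable exceptional set. At \<xi> = 0 the weight is 0 by the
  convention on division.\<close>

lemma bounded_spectrum_exists:
  assumes p1: "p = 1"
  defines "D \<equiv> (1 + real CARD('m)) * real CARD('m set) * real CARD('m set)"
  obtains g where "spectrum g" "\<And>\<xi> s. s = 1 \<or> s = - 1 \<Longrightarrow> strip_weight \<xi> * cl_norm (cl_mult (chi s \<xi>) (g \<xi>)) \<le> D * S"
proof -
  obtain g0 where g0: "spectrum g0" using spectrum_exists by blast
  define P where "P \<xi> \<longleftrightarrow> strip_weight \<xi> * cl_norm (cl_mult (chi 1 \<xi>) (g0 \<xi>)) \<le> D * S \<and>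
     strip_weight \<xi> * cl_norm (cl_mult (chi (-1) \<xi>) (g0 \<xi>)) \<le> D * S" for \<xi>
  have [measurable]: "(\<lambda>\<xi>. cl_norm (cl_mult (chi s \<xi>) (g0 \<xi>))) \<in> borel_measurable borel" for s
    by (rule spectrum_chi_measurable[OF g0])
  have [measurable]: "strip_weight \<in> borel_measurable borel" unfolding strip_weight_def by measurable
  have [measurable]: "Measurable.pred borel P" unfolding P_def by measurable
  have [measurable]: "(\<lambda>\<xi>. g0 \<xi> T) \<in> borel_measurable borel" for T using g0 by (simp add: spectrum_def)
  define g where "g \<xi> = (if P \<xi> then g0 \<xi> else (\<lambda>_. 0))" for \<xi>
  have AEP: "AE \<xi> in lborel. P \<xi>"
    using linf_bound[OF g0 p1, of 1] linf_bound[OF g0 p1, of "-1"] unfolding P_def D_def by auto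
  show thesis
  proof (rule that[of g])
    show "spectrum g"
    proof (rule spectrum_modify[OF g0])
      fix T
      have "(\<lambda>\<xi>. g \<xi> T) = (\<lambda>\<xi>. if P \<xi> then g0 \<xi> T else 0)" by (auto simp: g_def)
      then show "(\<lambda>\<xi>. g \<xi> T) \<in> borel_measurable borel" by simp
      show "AE \<xi> in lborel. g \<xi> = g0 \<xi>" using AEP by eventually_elim (simp add: g_def)
    qed
    fix \<xi> :: "real ^ 'm::{finite,linorder}" and s :: real assume s: "s = 1 \<or> s = - 1"
    have "cl_norm (cl_mult (chi s \<xi>) (\<lambda>_. 0)) = 0" by (simp add: cl_norm_def cl_mult_def)
    then show "strip_weight \<xi> * cl_norm (cl_mult (chi s \<xi>) (g \<xi>)) \<le> D * S"
      using s S_nonneg by (auto simp: g_def P_def D_def)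
  qed
qed

lemma spectrum_in_Linf:
  assumes g: "spectrum g" and b: "\<And>\<xi> s. s = 1 \<or> s = - 1 \<Longrightarrow> strip_weight \<xi> * cl_norm (cl_mult (chi s \<xi>) (g \<xi>)) \<le> B"
  shows "in_Linf g"
proof -
  have "AE \<xi> in lborel. \<xi> \<noteq> (0 :: real ^ 'm::{finite,linorder})" by (rule AE_lborel_singleton)
  then have "AE \<xi> in lborel. cl_norm (g \<xi>) \<le> real CARD('m set) * (B / (2 * a) + B / (2 * a))"
  proof eventually_elim
    case (elim \<xi>)
    have x: "cl_norm (cl_mult (chi s \<xi>) (g \<xi>)) \<le> B / (2 * a)" if s: "s = 1 \<or> s = - 1" for s
    proof -
      have "2 * a * cl_norm (cl_mult (chi s \<xi>) (g \<xi>)) \<le> strip_weight \<xi> * cl_norm (cl_mult (chi s \<xi>) (g \<xi>))"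
        using strip_weight_ge[OF elim] by (intro mult_right_mono) auto
      then have "2 * a * cl_norm (cl_mult (chi s \<xi>) (g \<xi>)) \<le> B" using b[OF s, of \<xi>] by linarith
      then show ?thesis using a_pos by (simp add: pos_le_divide_eq mult_ac)
    qed
    show ?case
      by (rule order_trans[OF cl_norm_chi_split[of _ \<xi>]], intro mult_left_mono add_mono x) auto
  qed
  then show ?thesis using g unfolding in_Linf_def spectrum_def by auto
qed

end

text \<open>C stands before f, so it may depend only on a, p and the dimension. Finiteness of I is
  claimed explicitly because \<open>enn2real\<close> sends infinity to 0, which would make the norm
  bound empty.\<close>

theorem theorem3p8:
  fixes a p :: real
  assumes "a > 0" and "1 \<le> p" and "p \<le> 2"
  shows "\<exists>C::real. \<forall>f :: real \<times> (real ^ 'm::{finite,linorder}) \<Rightarrow> 'm::{finite,linorder} clif.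
    in_Ap a p f \<longrightarrow>
    (\<exists>g :: real ^ 'm::{finite,linorder} \<Rightarrow> 'm::{finite,linorder} clif.
       is_fourier (\<lambda>y. f (0, y)) g \<and>
       (p = 1 \<longrightarrow> in_Linf g) \<and>
       (1 < p \<longrightarrow> in_Lr (p / (p - 1)) g) \<and>
       (\<forall>x\<in>strip a. \<forall>T.
          integrable lborel (\<lambda>\<xi>. cl_mult (e_ker x \<xi>) (g \<xi>) T) \<and>
          f x T = (1 / (2 * pi) ^ CARD('m)) * (\<integral>\<xi>. cl_mult (e_ker x \<xi>) (g \<xi>) T \<partial>lborel)) \<and>
       (1 < p \<longrightarrow>
          (let q = p / (p - 1);
               I = (\<integral>\<^sup>+ \<xi>. ennreal
                      ((exp (p * a * norm \<xi>) - exp (- p * a * norm \<xi>)) powr (q / p)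
                       * (cl_norm (cl_mult (chi 1 \<xi>) (g \<xi>)) powr q
                          + cl_norm (cl_mult (chi (-1) \<xi>) (g \<xi>)) powr q)
                       / (p * norm \<xi>) powr (q / p)) \<partial>lborel)
           in I < \<infinity> \<and> ((1/2) * enn2real I) powr (1 / q) \<le> C * Ap_norm a p f)) \<and>
       (p = 1 \<longrightarrow>
          (\<forall>\<xi>. (1/2) * (exp (a * norm \<xi>) - exp (- a * norm \<xi>))
                 * (cl_norm (cl_mult (chi 1 \<xi>) (g \<xi>)) + cl_norm (cl_mult (chi (-1) \<xi>) (g \<xi>)))
                 / norm \<xi> \<le> C * Ap_norm a 1 f)))"
  (is "\<exists>C. \<forall>f. _ f \<longrightarrow> ?spectral C f")
proof (cases "p = 1")
  case True
  define D where "D = (1 + real CARD('m)) * real CARD('m set) * real CARD('m set)"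
  show ?thesis
  proof (intro exI[of _ D] allI impI)
    fix f :: "real \<times> (real ^ 'm::{finite,linorder}) \<Rightarrow> 'm::{finite,linorder} clif"
    assume f: "in_Ap a p f"
    interpret monogenic_Ap a f p
      by unfold_locales (use f assms in \<open>auto simp: in_Ap_def\<close>)
    obtain g where g: "spectrum g" "\<And>\<xi> s. s = 1 \<or> s = - 1 \<Longrightarrow> strip_weight \<xi> * cl_norm (cl_mult (chi s \<xi>) (g \<xi>)) \<le> D * S"
      unfolding D_def using bounded_spectrum_exists[OF True] by blast
    have Linf: "in_Linf g" by (rule spectrum_in_Linf[OF g])
    have F: "is_fourier (\<lambda>y. f (0, y)) g"
      by (rule spectrum_is_fourier[OF g(1) spectrum_square_integrable_Linf[OF g(1) Linf]])
    have bound: "(1/2) * (exp (a * norm \<xi>) - exp (- a * norm \<xi>))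
                 * (cl_norm (cl_mult (chi 1 \<xi>) (g \<xi>)) + cl_norm (cl_mult (chi (-1) \<xi>) (g \<xi>)))
                 / norm \<xi> \<le> D * Ap_norm a 1 f" for \<xi>
    proof -
      let ?x = "cl_norm (cl_mult (chi 1 \<xi>) (g \<xi>))" and ?y = "cl_norm (cl_mult (chi (-1) \<xi>) (g \<xi>))"
      have N: "Ap_norm a 1 f = S" using Ap_norm_eq True S_nonneg by simp
      have W: "(1/2) * (exp (a * norm \<xi>) - exp (- a * norm \<xi>)) * (?x + ?y) / norm \<xi>
         = (1/2) * (strip_weight \<xi> * ?x + strip_weight \<xi> * ?y)"
        unfolding strip_weight_def using True by (simp add: distrib_left add_divide_distrib)
      show ?thesis unfolding N W using g(2)[of 1 \<xi>] g(2)[of "-1" \<xi>] by simp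
    qed
    show "?spectral D f"
    proof (intro exI[of _ g] conjI ballI allI impI F Linf bound spectrum_representation[OF g(1)])
    qed (use True in auto)
  qed
next
  case False
  then have p1: "1 < p" using assms by simp
  define q where "q = p / (p - 1)"
  \<comment> \<open>This is p <= 2 again, needed for the square integrability of g.\<close>
  have q2: "q \<ge> 2" unfolding q_def using p1 assms by (simp add: field_simps)
  obtain K where K: "K \<ge> 0" "\<And>(u :: real ^ 'm::{finite,linorder} \<Rightarrow> complex) I. integrable lborel u \<Longrightarrow> I \<ge> 0 \<Longrightarrow>
     (\<integral>\<^sup>+x. ennreal (cmod (u x) powr p) \<partial>lborel) \<le> ennreal I \<Longrightarrow>
     (\<integral>\<^sup>+\<xi>. ennreal (cmod (fourier_int u \<xi>) powr q) \<partial>lborel) \<le> ennreal (K * I powr (q / p))"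
    using hausdorff_young[OF p1 assms(3) q_def] by blast
  define K2 where "K2 = ((1 + real CARD('m)) * real CARD('m set)) powr q * real CARD('m set) powr q * real CARD('m set) * K"
  have K20: "K2 \<ge> 0" using K(1) by (simp add: K2_def)
  \<comment> \<open>The q-th root of 1/2 times 2 K2 S^(q/p) is K2^(1/q) S^(1/p), and S^(1/p) is the
    A^p norm.\<close>
  define C where "C = K2 powr (1 / q)"
  show ?thesis
  proof (intro exI[of _ C] allI impI)
    fix f :: "real \<times> (real ^ 'm::{finite,linorder}) \<Rightarrow> 'm::{finite,linorder} clif"
    assume f: "in_Ap a p f"
    interpret monogenic_Ap a f p
      by unfold_locales (use f assms in \<open>auto simp: in_Ap_def\<close>)
    obtain g where g: "spectrum g" using spectrum_exists by blast
    define I where "I = (\<integral>\<^sup>+ \<xi>. ennreal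
                      ((exp (p * a * norm \<xi>) - exp (- p * a * norm \<xi>)) powr (q / p)
                       * (cl_norm (cl_mult (chi 1 \<xi>) (g \<xi>)) powr q
                          + cl_norm (cl_mult (chi (-1) \<xi>) (g \<xi>)) powr q)
                       / (p * norm \<xi>) powr (q / p)) \<partial>lborel)"
    have Ib: "I \<le> ennreal (2 * K2 * S powr (q / p))"
      unfolding I_def by (rule two_sided_bound[OF g p1 q_def K K2_def])
    have Ifin: "I < \<infinity>" using Ib by (rule order_le_less_trans) simp
    have Lr: "in_Lr q g"
      by (rule spectrum_in_Lr[OF g]) (use Ifin q2 p1 in \<open>auto simp: I_def\<close>)
    have F: "is_fourier (\<lambda>y. f (0, y)) g"
      by (rule spectrum_is_fourier[OF g spectrum_square_integrable_Lr[OF g Lr q2]])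
    have "enn2real I \<le> 2 * K2 * S powr (q / p)"
      using Ib K20 by (intro enn2real_leI) auto
    then have "((1/2) * enn2real I) powr (1 / q) \<le> (K2 * S powr (q / p)) powr (1 / q)"
      using q2 by (intro powr_mono2) auto
    also have "\<dots> = C * Ap_norm a p f"
      unfolding Ap_norm_eq C_def using K20 S_nonneg q2 p1 by (simp add: powr_mult powr_powr)
    finally have bound: "((1/2) * enn2real I) powr (1 / q) \<le> C * Ap_norm a p f" .
    have let_bound: "(let q = p / (p - 1);
               I = (\<integral>\<^sup>+ \<xi>. ennreal
                      ((exp (p * a * norm \<xi>) - exp (- p * a * norm \<xi>)) powr (q / p)
                       * (cl_norm (cl_mult (chi 1 \<xi>) (g \<xi>)) powr q
                          + cl_norm (cl_mult (chi (-1) \<xi>) (g \<xi>)) powr q)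
                       / (p * norm \<xi>) powr (q / p)) \<partial>lborel)
           in I < \<infinity> \<and> ((1/2) * enn2real I) powr (1 / q) \<le> C * Ap_norm a p f)"
      unfolding Let_def q_def[symmetric] I_def[symmetric] using Ifin bound by (rule conjI)
    show "?spectral C f"
      using F Lr[unfolded q_def] spectrum_representation[OF g] let_bound False
      by (intro exI[of _ g] conjI ballI allI impI) auto
  qed
qed

end
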